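(* Let $\mathcal{F}=(F_n)_{n\geq0}$ be a tower over $\mathbb{F}_q$ with $F:=F_0$, and let $E/F$ be a finite separable extension such that $\mathcal{E}:=E\cdot\mathcal{F}$ is a composite tower of $\mathcal{F}$ with $E/F$. Write $E=F(y)$, $m:=[E:F]$, and let $M$ be the set of places $P$ of $F$ such that $\{1,y,\ldots,y^{m-1}\}$ is an integral basis for $E/F$ at $P$. Let $P\in M$ be such that for every place $Q$ of $E$ with $Q\mid P$, $e(Q|P)$ is coprime to $e(P'|P)$ for every place $P'$ of $F_n$ lying over $P$, for every $n\geq1$. Then for every place $Q$ of $E$ with $Q\mid P$ and every $s\geq1$, \[\nu_s(Q,\mathcal{E})=\frac{f(Q|P)}{s}\sum_{\substack{d\in\mathbb{N}\\ \mathrm{lcm}(\deg Q,\,d)=s}} d\cdot\nu_d(P,\mathcal{F}).\]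
   Context: All algebraic function fields considered have $\mathbb{F}_q$ as full constant field. A tower over $\mathbb{F}_q$ is a sequence $\mathcal{T}=(T_n)_{n\geq0}$ of function fields with $T_0\subsetneq T_1\subsetneq\cdots$, all $T_{n+1}/T_n$ finite separable, and genus $g(T_n)\to\infty$. For a place $P$ of $T_0$, $\nu_r(P,\mathcal{T}):=\lim_n B_r(P,T_n)/[T_n:T_0]$, where $B_r(P,T_n)$ is the number of places of $T_n$ of degree $r$ over $P$ (the limit exists). Given a tower $\mathcal{F}$ with $F=F_0$ and a finite separable $E/F$ in a common algebraic closure, $E\cdot\mathcal{F}:=(EF_n)_{n\ge0}$ (whose $0$-th field is $E$); it is a composite tower of $\mathcal{F}$ with $E/F$ if it is a tower over $\mathbb{F}_q$ and $E/F$, $F_n/F$ are linearly disjoint for all $n\geq1$. $e(\cdot|\cdot)$, $f(\cdot|\cdot)$ denote ramification index and relative degree. An integral basis at $P$ is a basis of the integral closure of $\mathcal{O}_P$ in $E$ as $\mathcal{O}_P$-module. *)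

theory Defs
  imports Complex_Main "HOL-Algebra.Algebraic_Closure" "HOL-Algebra.Generated_Fields"
begin

text \<open>All fields are subfields, given as sets, of one ambient field \<open>L\<close>, which in the theorem is an
  algebraic closure of the bottom field of the tower. The constant field is \<open>k\<close>.\<close>

section \<open>Function fields and their extensions\<close>

definition full_constant_field :: "('a, 'b) ring_scheme \<Rightarrow> 'a set \<Rightarrow> 'a set \<Rightarrow> bool"
  where "full_constant_field L k F \<longleftrightarrow> (\<forall>z\<in>F. \<not> ring.transcendental L k z \<longrightarrow> z \<in> k)"

definition function_field :: "('a, 'b) ring_scheme \<Rightarrow> 'a set \<Rightarrow> 'a set \<Rightarrow> bool"
  where "function_field L k F \<longleftrightarrow>
    subfield k L \<and> subfield F L \<and> k \<subseteq> F \<and>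
    (\<exists>x\<in>F. ring.transcendental L k x \<and>
       ring.finite_dimension L (generate_field L (insert x k)) F)"

text \<open>Every minimal polynomial over \<open>K\<close> is required to have only simple roots in \<open>L\<close>. This is
  separability when \<open>L\<close> is algebraically closed.\<close>

definition separable_extension :: "('a, 'b) ring_scheme \<Rightarrow> 'a set \<Rightarrow> 'a set \<Rightarrow> bool"
  where "separable_extension L K E \<longleftrightarrow>
    (\<forall>x\<in>E. \<not> ring.transcendental L K x \<and>
       (\<forall>a\<in>carrier L. ring.alg_mult L (ring.Irr L K x) a \<le> 1))"

definition finite_separable_extension :: "('a, 'b) ring_scheme \<Rightarrow> 'a set \<Rightarrow> 'a set \<Rightarrow> bool"
  where "finite_separable_extension L K E \<longleftrightarrow>
    subfield K L \<and> subfield E L \<and> K \<subseteq> E \<and>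
    ring.finite_dimension L K E \<and> separable_extension L K E"

definition linearly_disjoint ::
    "('a, 'b) ring_scheme \<Rightarrow> 'a set \<Rightarrow> 'a set \<Rightarrow> 'a set \<Rightarrow> bool"
  where "linearly_disjoint L K E E' \<longleftrightarrow>
    (\<forall>Us. set Us \<subseteq> E \<longrightarrow> ring.independent L K Us \<longrightarrow> ring.independent L E' Us)"

definition composite_field :: "('a, 'b) ring_scheme \<Rightarrow> 'a set \<Rightarrow> 'a set \<Rightarrow> 'a set"
  where "composite_field L E E' = generate_field L (E \<union> E')"


section \<open>Places\<close>

definition valuation_ring :: "('a, 'b) ring_scheme \<Rightarrow> 'a set \<Rightarrow> 'a set \<Rightarrow> 'a set \<Rightarrow> bool"
  where "valuation_ring L k F V \<longleftrightarrow>
    subring V L \<and> k \<subset> V \<and> V \<subset> F \<and> (\<forall>z\<in>F - {\<zero>\<^bsub>L\<^esub>}. z \<in> V \<or> inv\<^bsub>L\<^esub> z \<in> V)"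

definition places :: "('a, 'b) ring_scheme \<Rightarrow> 'a set \<Rightarrow> 'a set \<Rightarrow> 'a set set"
  where "places L k F =
    {P. \<exists>V. valuation_ring L k F V \<and> maximalideal P (L\<lparr>carrier := V\<rparr>)}"

text \<open>The valuation ring \<open>V\<close> is recovered from its maximal ideal \<open>P\<close>; see
  \<open>valuation_ring_eq_ring_of_place\<close> below.\<close>

definition ring_of_place :: "('a, 'b) ring_scheme \<Rightarrow> 'a set \<Rightarrow> 'a set \<Rightarrow> 'a set"
  where "ring_of_place L F P = {z \<in> F. z = \<zero>\<^bsub>L\<^esub> \<or> inv\<^bsub>L\<^esub> z \<notin> P}"

abbreviation local_ring :: "('a, 'b) ring_scheme \<Rightarrow> 'a set \<Rightarrow> 'a set \<Rightarrow> ('a, 'b) ring_scheme"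
  where "local_ring L F P \<equiv> L\<lparr>carrier := ring_of_place L F P\<rparr>"

lemma valuation_ring_eq_ring_of_place:
  fixes L (structure)
  assumes "field L" and F: "subfield F L" and V: "valuation_ring L k F V"
    and P: "maximalideal P (L\<lparr>carrier := V\<rparr>)"
  shows "V = ring_of_place L F P"
proof -
  interpret field L by fact
  have Vr: "subring V L" using V by (simp add: valuation_ring_def)
  note V_zero = subringE(2)[OF Vr] and V_one = subringE(3)[OF Vr] and V_add = subringE(7)[OF Vr]
  interpret P: maximalideal P "L\<lparr>carrier := V\<rparr>" by fact
  have VF: "V \<subseteq> F" and val: "\<And>z. z \<in> F \<Longrightarrow> z \<noteq> \<zero> \<Longrightarrow> z \<in> V \<or> inv z \<in> V"
    using V by (auto simp: valuation_ring_def)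
  have FL: "F \<subseteq> carrier L" using subfieldE(3)[OF F] .
  have PV: "P \<subseteq> V" using P.a_subset by simp
  have one_notin: "\<one> \<notin> P"
    using P.I_notcarr P.one_imp_carrier by auto
  have unit: "z \<in> Units L" if "z \<in> F" "z \<noteq> \<zero>" for z
    using that FL field_Units by auto
  have Finv: "inv z \<in> F" "inv z \<noteq> \<zero>" if "z \<in> F" "z \<noteq> \<zero>" for z
    using subfield_m_inv(1)[OF F, of z] that by auto
  have PmultV: "a \<otimes> p \<in> P" "p \<otimes> a \<in> P" if "a \<in> V" "p \<in> P" for a p
    using P.I_l_closed[of p a] P.I_r_closed[of p a] that by auto
  show ?thesis
  proof (intro equalityI subsetI)
    fix z assume z: "z \<in> V"
    have "inv z \<notin> P" if "z \<noteq> \<zero>"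
    proof
      assume "inv z \<in> P"
      then have "z \<otimes> inv z \<in> P" using PmultV z by blast
      moreover have "z \<otimes> inv z = \<one>" using unit that z VF by (auto intro: Units_r_inv)
      ultimately show False using one_notin by simp
    qed
    then show "z \<in> ring_of_place L F P" using z VF by (auto simp: ring_of_place_def)
  next
    fix z assume "z \<in> ring_of_place L F P"
    then have zF: "z \<in> F" and zP: "z = \<zero> \<or> inv z \<notin> P" by (auto simp: ring_of_place_def)
    show "z \<in> V"
    proof (rule ccontr)
      assume zV: "z \<notin> V"
      then have z0: "z \<noteq> \<zero>" using V_zero by auto
      define w where "w = inv z"
      have w: "w \<in> V" "w \<notin> P" "w \<in> F" "w \<noteq> \<zero>"
        using val[OF zF z0] zV zP z0 Finv[OF zF z0] by (auto simp: w_def)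
      have wz: "w \<otimes> z = \<one>" and zw: "z \<otimes> w = \<one>" using unit[OF zF z0] by (auto simp: w_def)
      interpret VR: cring "L\<lparr>carrier := V\<rparr>"
        using subring_is_domain[OF Vr] by (simp add: domain_def)
      let ?J = "PIdl\<^bsub>L\<lparr>carrier := V\<rparr>\<^esub> w"
      have J: "ideal ?J (L\<lparr>carrier := V\<rparr>)" using VR.cgenideal_ideal w by simp
      have S: "ideal (P <+>\<^bsub>L\<lparr>carrier := V\<rparr>\<^esub> ?J) (L\<lparr>carrier := V\<rparr>)"
        using P.add_ideals[OF P.ideal_axioms J] .
      have wL: "w \<in> carrier L" and zL: "z \<in> carrier L" using w zF FL by auto
      have VL: "V \<subseteq> carrier L" using VF FL by auto
      have wJ: "w \<in> ?J" using P.cgenideal_self w by simp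
      have sub: "P \<subseteq> P <+>\<^bsub>L\<lparr>carrier := V\<rparr>\<^esub> ?J"
      proof
        fix p assume p: "p \<in> P"
        have "p \<oplus> \<zero> = p" using p PV VL by auto
        moreover have "\<zero> \<in> ?J" using additive_subgroup.zero_closed[OF ideal.axioms(1)[OF J]] by simp
        ultimately show "p \<in> P <+>\<^bsub>L\<lparr>carrier := V\<rparr>\<^esub> ?J"
          using p by (simp add: set_add_def') metis
      qed
      have win: "w \<in> P <+>\<^bsub>L\<lparr>carrier := V\<rparr>\<^esub> ?J"
      proof -
        have "\<zero> \<oplus> w = w" using wL by auto
        moreover have "\<zero> \<in> P" using additive_subgroup.zero_closed[OF P.additive_subgroup_axioms] by simp
        ultimately show ?thesis
          using wJ by (simp add: set_add_def') metis
      qed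
      have "P <+>\<^bsub>L\<lparr>carrier := V\<rparr>\<^esub> ?J = V"
        using P.I_maximal[OF S sub] win w(2) ideal.Icarr[OF S] by auto
      then have "\<one> \<in> P <+>\<^bsub>L\<lparr>carrier := V\<rparr>\<^esub> ?J" using V_one by simp
      then obtain p a where p: "p \<in> P" and a: "a \<in> V" and eq: "\<one> = p \<oplus> a \<otimes> w"
        by (auto simp: set_add_def' cgenideal_def)
      have pL: "p \<in> carrier L" and aL: "a \<in> carrier L" using p a PV VL by auto
      have zexp: "z = p \<otimes> z \<oplus> a"
      proof -
        have "z = \<one> \<otimes> z" using zL by simp
        also have "\<dots> = (p \<oplus> a \<otimes> w) \<otimes> z" using arg_cong[OF eq, of "\<lambda>x. x \<otimes> z"] .
        also have "\<dots> = p \<otimes> z \<oplus> a \<otimes> (w \<otimes> z)"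
          using pL aL wL zL by (simp add: l_distr m_assoc)
        finally show ?thesis using wz aL r_one[OF aL] by (simp only:)
      qed
      have pz: "p \<otimes> z \<notin> V"
        using V_add[OF _ a, of "p \<otimes> z"] zV unfolding zexp[symmetric] by blast
      have pzF: "p \<otimes> z \<in> F" using subringE(6)[OF subfieldE(1)[OF F], of p z] p PV VF zF by auto
      have pz0: "p \<otimes> z \<noteq> \<zero>" using pz V_zero by auto
      have iV: "inv (p \<otimes> z) \<in> V" using val[OF pzF pz0] pz by simp
      have iL: "inv (p \<otimes> z) \<in> carrier L" using iV VL by auto
      have "w = (p \<otimes> z \<otimes> inv (p \<otimes> z)) \<otimes> w"
        using unit[OF pzF pz0] wL by simp
      also have "\<dots> = (p \<otimes> inv (p \<otimes> z)) \<otimes> (z \<otimes> w)"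
        using pL zL wL iL by (simp add: m_ac)
      also have "\<dots> = p \<otimes> inv (p \<otimes> z)" using zw pL iL by simp
      finally have "w \<in> P" using PmultV(2)[OF iV p] by simp
      then show False using w by simp
    qed
  qed
qed

text \<open>\<open>Q\<close> lies over \<open>P\<close> iff \<open>P \<subseteq> Q\<close>.\<close>

definition places_over :: "('a, 'b) ring_scheme \<Rightarrow> 'a set \<Rightarrow> 'a set \<Rightarrow> 'a set \<Rightarrow> 'a set set"
  where "places_over L k E P = {Q \<in> places L k E. P \<subseteq> Q}"

definition prime_element :: "('a, 'b) ring_scheme \<Rightarrow> 'a set \<Rightarrow> 'a set \<Rightarrow> 'a \<Rightarrow> bool"
  where "prime_element L F P t \<longleftrightarrow> t \<in> P \<and> P = PIdl\<^bsub>local_ring L F P\<^esub> t"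

text \<open>The normalised discrete valuation, used only for \<open>z \<noteq> \<zero>\<close>.\<close>

definition place_valuation :: "('a, 'b) ring_scheme \<Rightarrow> 'a set \<Rightarrow> 'a set \<Rightarrow> 'a \<Rightarrow> int"
  where "place_valuation L F P z =
    (THE n. \<exists>t u. prime_element L F P t \<and> u \<in> Units (local_ring L F P) \<and>
       z = t [^]\<^bsub>L\<^esub> n \<otimes>\<^bsub>L\<^esub> u)"

definition residue_field :: "('a, 'b) ring_scheme \<Rightarrow> 'a set \<Rightarrow> 'a set \<Rightarrow> 'a set ring"
  where "residue_field L F P = local_ring L F P Quot P"

definition residue_image :: "('a, 'b) ring_scheme \<Rightarrow> 'a set \<Rightarrow> 'a set \<Rightarrow> 'a set \<Rightarrow> 'a set set"
  where "residue_image L F P A = (\<lambda>a. P +>\<^bsub>local_ring L F P\<^esub> a) ` A"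

definition place_degree :: "('a, 'b) ring_scheme \<Rightarrow> 'a set \<Rightarrow> 'a set \<Rightarrow> 'a set \<Rightarrow> nat"
  where "place_degree L k F P =
    ring.dim (residue_field L F P) (residue_image L F P k) (carrier (residue_field L F P))"

text \<open>In the next two definitions \<open>Q\<close> is a place of \<open>E\<close> lying over the place \<open>P\<close> of \<open>F\<close>.\<close>

definition ramification_index ::
    "('a, 'b) ring_scheme \<Rightarrow> 'a set \<Rightarrow> 'a set \<Rightarrow> 'a set \<Rightarrow> 'a set \<Rightarrow> nat"
  where "ramification_index L F P E Q =
    (THE e. \<forall>x\<in>F - {\<zero>\<^bsub>L\<^esub>}. place_valuation L E Q x = int e * place_valuation L F P x)"

definition relative_degree ::
    "('a, 'b) ring_scheme \<Rightarrow> 'a set \<Rightarrow> 'a set \<Rightarrow> 'a set \<Rightarrow> 'a set \<Rightarrow> nat"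
  where "relative_degree L F P E Q =
    ring.dim (residue_field L E Q) (residue_image L E Q (ring_of_place L F P))
      (carrier (residue_field L E Q))"


section \<open>Integral bases\<close>

definition integral_closure_in :: "('a, 'b) ring_scheme \<Rightarrow> 'a set \<Rightarrow> 'a set \<Rightarrow> 'a set"
  where "integral_closure_in L V E =
    {z \<in> E. \<exists>p. p \<noteq> [] \<and> polynomial\<^bsub>L\<^esub> V p \<and> lead_coeff p = \<one>\<^bsub>L\<^esub> \<and> ring.eval L p z = \<zero>\<^bsub>L\<^esub>}"

text \<open>\<^const>\<open>ring.Span\<close> and \<^const>\<open>ring.combine\<close> make sense over a subring \<open>V\<close>, but
  \<^const>\<open>ring.independent\<close> expresses linear independence only over a subfield.\<close>

definition module_basis :: "('a, 'b) ring_scheme \<Rightarrow> 'a set \<Rightarrow> 'a set \<Rightarrow> 'a list \<Rightarrow> bool"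
  where "module_basis L V B Us \<longleftrightarrow>
    set Us \<subseteq> carrier L \<and> ring.Span L V Us = B \<and>
    (\<forall>as. set as \<subseteq> V \<and> length as = length Us \<and> ring.combine L as Us = \<zero>\<^bsub>L\<^esub>
       \<longrightarrow> set as \<subseteq> {\<zero>\<^bsub>L\<^esub>})"

definition integral_basis_at ::
    "('a, 'b) ring_scheme \<Rightarrow> 'a set \<Rightarrow> 'a set \<Rightarrow> 'a set \<Rightarrow> 'a list \<Rightarrow> bool"
  where "integral_basis_at L F P E Us \<longleftrightarrow>
    module_basis L (ring_of_place L F P) (integral_closure_in L (ring_of_place L F P) E) Us"


section \<open>Divisors and the genus\<close>

definition divisors :: "('a, 'b) ring_scheme \<Rightarrow> 'a set \<Rightarrow> 'a set \<Rightarrow> ('a set \<Rightarrow> int) set"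
  where "divisors L k F = {A. finite {P. A P \<noteq> 0} \<and> {P. A P \<noteq> 0} \<subseteq> places L k F}"

definition divisor_degree ::
    "('a, 'b) ring_scheme \<Rightarrow> 'a set \<Rightarrow> 'a set \<Rightarrow> ('a set \<Rightarrow> int) \<Rightarrow> int"
  where "divisor_degree L k F A = (\<Sum>P | A P \<noteq> 0. A P * int (place_degree L k F P))"

definition riemann_roch_space ::
    "('a, 'b) ring_scheme \<Rightarrow> 'a set \<Rightarrow> 'a set \<Rightarrow> ('a set \<Rightarrow> int) \<Rightarrow> 'a set"
  where "riemann_roch_space L k F A =
    {x \<in> F. x = \<zero>\<^bsub>L\<^esub> \<or> (\<forall>P\<in>places L k F. place_valuation L F P x \<ge> - A P)}"

text \<open>\<open>g(F) = max {deg A - \<ell>(A) + 1}\<close> over all divisors \<open>A\<close>; by Riemann's theorem the set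
  is bounded above, so its supremum in the integers is attained.\<close>

definition genus :: "('a, 'b) ring_scheme \<Rightarrow> 'a set \<Rightarrow> 'a set \<Rightarrow> int"
  where "genus L k F =
    (SUP A\<in>divisors L k F.
       divisor_degree L k F A - int (ring.dim L k (riemann_roch_space L k F A)) + 1)"


section \<open>Towers\<close>

definition tower :: "('a, 'b) ring_scheme \<Rightarrow> 'a set \<Rightarrow> (nat \<Rightarrow> 'a set) \<Rightarrow> bool"
  where "tower L k T \<longleftrightarrow>
    (\<forall>n. function_field L k (T n) \<and> full_constant_field L k (T n)) \<and>
    (\<forall>n. T n \<subset> T (Suc n)) \<and>
    (\<forall>n. finite_separable_extension L (T n) (T (Suc n))) \<and>
    filterlim (\<lambda>n. genus L k (T n)) at_top sequentially"

definition composite_sequence ::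
    "('a, 'b) ring_scheme \<Rightarrow> 'a set \<Rightarrow> (nat \<Rightarrow> 'a set) \<Rightarrow> nat \<Rightarrow> 'a set"
  where "composite_sequence L E F n = composite_field L E (F n)"

definition is_composite_tower ::
    "('a, 'b) ring_scheme \<Rightarrow> 'a set \<Rightarrow> 'a set \<Rightarrow> (nat \<Rightarrow> 'a set) \<Rightarrow> bool"
  where "is_composite_tower L k E F \<longleftrightarrow>
    tower L k (composite_sequence L E F) \<and> (\<forall>n\<ge>1. linearly_disjoint L (F 0) E (F n))"

definition num_places_over ::
    "('a, 'b) ring_scheme \<Rightarrow> 'a set \<Rightarrow> 'a set \<Rightarrow> nat \<Rightarrow> 'a set \<Rightarrow> nat"
  where "num_places_over L k E r P = card {Q \<in> places_over L k E P. place_degree L k E Q = r}"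

definition nu ::
    "('a, 'b) ring_scheme \<Rightarrow> 'a set \<Rightarrow> nat \<Rightarrow> 'a set \<Rightarrow> (nat \<Rightarrow> 'a set) \<Rightarrow> real"
  where "nu L k r P T =
    lim (\<lambda>n. real (num_places_over L k (T n) r P) / real (ring.dim L (T 0) (T n)))"

end

theory Submission
  imports Defs "HOL-Computational_Algebra.Primes" "HOL-Algebra.Ideal_Product" "HOL-Algebra.Sylow"
begin

text \<open>
  Let \<open>P'\<close> be a place of \<open>F\<^sub>n\<close> over \<open>P\<close> with local ring \<open>\<O>'\<close> and residue field of order \<open>q\<close>, and let
  \<open>\<A>\<close> be the integral closure of \<open>\<O>\<^sub>P\<close> in \<open>E\<close>. By linear disjointness the given integral basis stays
  a basis of \<open>E F\<^sub>n\<close> over \<open>F\<^sub>n\<close>, so \<open>\<A>' = \<O>' \<A>\<close> is free of rank \<open>m\<close> over \<open>\<O>'\<close>. For each place \<open>Q\<close> over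
  \<open>P\<close> choose \<open>s\<^sub>Q \<in> \<A>\<close> of valuation \<open>1\<close> at \<open>Q\<close> and \<open>0\<close> at the other places over \<open>P\<close>, and put
  \<open>I\<^sub>Q = s\<^sub>Q \<A>' + P' \<A>'\<close>. As the product of the \<open>s\<^sub>Q\<close> to the powers \<open>e(Q|P)\<close> lies in \<open>P \<A>\<close>, one gets
  \<open>q^m \<le> \<Prod>\<^sub>Q |\<A>'/I\<^sub>Q|^e(Q|P)\<close>, while \<open>|\<A>'/I\<^sub>Q| \<le> q^f(Q|P)\<close>; the fundamental inequality
  \<open>\<Sum> e f \<le> m\<close> forces equality throughout.

  A power of Frobenius is the identity on \<open>\<A>'/I\<^sub>Q\<close>, so this ring is reduced and embeds into the product of
  the residue fields at the places \<open>Q'\<close> of \<open>E F\<^sub>n\<close> over both \<open>Q\<close> and \<open>P'\<close>. By coprimality \<open>e(Q|P)\<close>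
  divides \<open>e(Q'|P')\<close>, and the fundamental inequality for \<open>E F\<^sub>n / F\<^sub>n\<close> now shows that \<open>\<A>'\<close> maps onto each
  residue field at \<open>Q'\<close> and that \<open>f(Q|P)\<close> is the sum of the \<open>f(Q'|P')\<close>. Hence
  \<open>deg Q' = lcm (deg Q) (deg P')\<close>, which gives the formula at every level \<open>n\<close>.

  The limits exist because \<open>(\<Sum>\<^bsub>d dvd r\<^esub> d B\<^sub>d(P, T\<^sub>n)) / [T\<^sub>n : T\<^sub>0]\<close> decreases in \<open>n\<close>, again by the
  fundamental inequality.
\<close>

section \<open>Cosets of finite index\<close>

context ring
begin

definition finite_index :: "'a set \<Rightarrow> 'a set \<Rightarrow> bool"
  where "finite_index A I \<longleftrightarrow> finite ((\<lambda>a. I +> a) ` A)"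

definition index :: "'a set \<Rightarrow> 'a set \<Rightarrow> nat"
  where "index A I = card ((\<lambda>a. I +> a) ` A)"

definition transversal :: "'a set \<Rightarrow> 'a set \<Rightarrow> 'a set \<Rightarrow> bool"
  where "transversal A I S \<longleftrightarrow>
    S \<subseteq> A \<and> (\<forall>x\<in>A. \<exists>r\<in>S. x \<ominus> r \<in> I) \<and> (\<forall>r\<in>S. \<forall>s\<in>S. r \<ominus> s \<in> I \<longrightarrow> r = s)"

lemma additive_subgroup_minusI:
  assumes "I \<subseteq> carrier R" "\<zero> \<in> I" "\<And>a b. a \<in> I \<Longrightarrow> b \<in> I \<Longrightarrow> a \<ominus> b \<in> I"
  shows "additive_subgroup I R"
proof -
  have inv: "\<ominus> a \<in> I" if "a \<in> I" for a
    using assms(3)[OF assms(2) that] assms(1) that by (auto simp: a_minus_def)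
  have "a \<oplus> b \<in> I" if "a \<in> I" "b \<in> I" for a b
    using assms(3)[OF that(1) inv[OF that(2)]] assms(1) that by (auto simp: a_minus_def)
  then show ?thesis
    using assms inv by (intro additive_subgroup.intro add.subgroupI) (auto simp: a_inv_def)
qed

lemma additive_subgroup_minus_closed:
  assumes "additive_subgroup I R" "a \<in> I" "b \<in> I"
  shows "a \<ominus> b \<in> I"
  using assms by (simp add: a_minus_def additive_subgroup.a_closed additive_subgroup.a_inv_closed)

lemma additive_subgroup_finsum_closed:
  assumes I: "additive_subgroup I R" and f: "\<And>i. i \<in> S \<Longrightarrow> f i \<in> I"
  shows "finsum R f S \<in> I"
  using f
proof (induction S rule: infinite_finite_induct)
  case (insert i S)
  then have "f i \<in> carrier R" "f \<in> S \<rightarrow> carrier R"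
    using additive_subgroup.a_subset[OF I] by blast+
  then show ?case using insert additive_subgroup.a_closed[OF I] by simp
qed (simp_all add: additive_subgroup.zero_closed[OF I])

lemma coset_eq_iff:
  assumes I: "additive_subgroup I R" and ab: "a \<in> carrier R" "b \<in> carrier R"
  shows "I +> a = I +> b \<longleftrightarrow> a \<ominus> b \<in> I"
proof -
  interpret abelian_subgroup I R
    using I by (intro abelian_subgroupI3 abelian_group_axioms)
  have "I +> a = I +> b \<longleftrightarrow> a \<in> I +> b"
  proof
    show "a \<in> I +> b" if "I +> a = I +> b"
      using a_repr_independenceD[OF ab(1) that[symmetric]] .
    show "I +> a = I +> b" if "a \<in> I +> b"
      using a_repr_independence'[OF that ab(2)] by simp
  qed
  then show ?thesis using a_rcos_module_minus[OF ring_axioms ab(2,1)] by simp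
qed

lemma index_le_cover:
  assumes I: "additive_subgroup I R" and A: "A \<subseteq> carrier R" and S: "finite S" "S \<subseteq> carrier R"
    and cover: "\<And>x. x \<in> A \<Longrightarrow> \<exists>r\<in>S. x \<ominus> r \<in> I"
  shows "finite_index A I" and "index A I \<le> card S"
proof -
  have subset: "(\<lambda>a. I +> a) ` A \<subseteq> (\<lambda>a. I +> a) ` S"
  proof (rule image_subsetI)
    fix x assume "x \<in> A"
    then obtain r where "r \<in> S" "x \<ominus> r \<in> I" using cover by blast
    moreover from this have "I +> x = I +> r"
      using coset_eq_iff[OF I, of x r] A S \<open>x \<in> A\<close> by auto
    ultimately show "I +> x \<in> (\<lambda>a. I +> a) ` S" by blast
  qed
  then show "finite_index A I" unfolding finite_index_def using S(1) finite_subset by blast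
  have "index A I \<le> card ((\<lambda>a. I +> a) ` S)"
    unfolding index_def using subset S(1) by (intro card_mono) auto
  also have "\<dots> \<le> card S" using S(1) by (rule card_image_le)
  finally show "index A I \<le> card S" .
qed

lemma index_ge_separated:
  assumes I: "additive_subgroup I R" and A: "A \<subseteq> carrier R" and fin: "finite_index A I"
    and S: "S \<subseteq> A" and separated: "\<And>a b. a \<in> S \<Longrightarrow> b \<in> S \<Longrightarrow> a \<ominus> b \<in> I \<Longrightarrow> a = b"
  shows "card S \<le> index A I"
proof -
  have inj: "inj_on (\<lambda>a. I +> a) S"
  proof (rule inj_onI)
    fix a b assume ab: "a \<in> S" "b \<in> S" "I +> a = I +> b"
    then have "a \<ominus> b \<in> I" using coset_eq_iff[OF I, of a b] A S by blast
    then show "a = b" using separated ab by blast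
  qed
  have "card S = card ((\<lambda>a. I +> a) ` S)" using card_image[OF inj] by simp
  also have "\<dots> \<le> index A I"
    unfolding index_def using fin[unfolded finite_index_def] S by (intro card_mono) auto
  finally show ?thesis .
qed

lemma exists_transversal:
  assumes I: "additive_subgroup I R" and A: "A \<subseteq> carrier R" and fin: "finite_index A I"
  obtains S where "transversal A I S" "finite S" "card S = index A I"
proof -
  let ?C = "(\<lambda>a. I +> a) ` A"
  define h where "h = inv_into A (\<lambda>a. I +> a)"
  have h: "h (I +> a) \<in> A" "I +> h (I +> a) = I +> a" if "a \<in> A" for a
    using that inv_into_into[of "I +> a" "\<lambda>a. I +> a" A] f_inv_into_f[of "I +> a" "\<lambda>a. I +> a" A]
    unfolding h_def by blast+
  have "transversal A I (h ` ?C)"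
    unfolding transversal_def
  proof (intro conjI ballI impI)
    show "h ` ?C \<subseteq> A" using h by auto
    fix x assume "x \<in> A"
    moreover from this have "x \<ominus> h (I +> x) \<in> I"
      using coset_eq_iff[OF I, of x "h (I +> x)"] h[of x] A by auto
    ultimately show "\<exists>r\<in>h ` ?C. x \<ominus> r \<in> I" by blast
  next
    fix r s assume "r \<in> h ` ?C" "s \<in> h ` ?C" and diff: "r \<ominus> s \<in> I"
    then obtain x y where xy: "x \<in> A" "r = h (I +> x)" "y \<in> A" "s = h (I +> y)" by auto
    then have "I +> r = I +> s" using coset_eq_iff[OF I, of r s] h[of x] h[of y] A diff by auto
    then show "r = s" using h[of x] h[of y] xy by simp
  qed
  moreover have "card (h ` ?C) = index A I"
    unfolding index_def h_def by (intro card_image inj_on_inv_into) simp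
  ultimately show ?thesis using that fin by (auto simp: finite_index_def)
qed

lemma index_transversal:
  assumes I: "additive_subgroup I R" and A: "A \<subseteq> carrier R"
    and S: "transversal A I S" "finite S"
  shows "finite_index A I" and "index A I = card S"
proof -
  have SA: "S \<subseteq> A" and cover: "\<And>x. x \<in> A \<Longrightarrow> \<exists>r\<in>S. x \<ominus> r \<in> I"
    and separated: "\<And>r s. r \<in> S \<Longrightarrow> s \<in> S \<Longrightarrow> r \<ominus> s \<in> I \<Longrightarrow> r = s"
    using S(1) by (auto simp: transversal_def)
  have SR: "S \<subseteq> carrier R" using SA A by (rule subset_trans)
  show fin: "finite_index A I" using index_le_cover(1)[OF I A S(2) SR cover] .
  show "index A I = card S"
    using index_le_cover(2)[OF I A S(2) SR cover]
      index_ge_separated[OF I A fin SA separated] by (rule antisym)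
qed

lemma index_cong:
  assumes I: "additive_subgroup I R" "finite_index A I" and J: "additive_subgroup J R"
    and A: "A \<subseteq> carrier R"
    and same: "\<And>a b. a \<in> A \<Longrightarrow> b \<in> A \<Longrightarrow> a \<ominus> b \<in> I \<longleftrightarrow> a \<ominus> b \<in> J"
  shows "index A J = index A I"
proof -
  obtain S where S: "transversal A I S" "finite S" "card S = index A I"
    by (rule exists_transversal[OF I(1) A I(2)])
  then have "transversal A J S" using same unfolding transversal_def by (meson subsetD)
  then show ?thesis using index_transversal(2)[OF J A _ S(2)] S(3) by simp
qed

lemma index_pos:
  assumes "finite_index A I" "A \<noteq> {}"
  shows "0 < index A I"
  using assms by (auto simp: index_def finite_index_def card_gt_0_iff)

lemma index_mono:
  assumes "finite_index A I" "B \<subseteq> A"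
  shows "finite_index B I" and "index B I \<le> index A I"
proof -
  have subset: "(\<lambda>a. I +> a) ` B \<subseteq> (\<lambda>a. I +> a) ` A" using assms(2) by (rule image_mono)
  show "finite_index B I"
    using assms(1) finite_subset[OF subset] unfolding finite_index_def by simp
  show "index B I \<le> index A I"
    using assms(1) card_mono[OF _ subset] unfolding finite_index_def index_def by simp
qed

lemma finite_index_antimono:
  assumes I: "additive_subgroup I R" and J: "additive_subgroup J R" and A: "A \<subseteq> carrier R"
    and fin: "finite_index A I" and "I \<subseteq> J"
  shows "finite_index A J"
proof -
  obtain S where S: "transversal A I S" "finite S"
    by (rule exists_transversal[OF I A fin])
  have SR: "S \<subseteq> carrier R" using S(1) A by (auto simp: transversal_def)
  have "\<exists>r\<in>S. x \<ominus> r \<in> J" if "x \<in> A" for x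
    using S(1) \<open>I \<subseteq> J\<close> that unfolding transversal_def by blast
  then show ?thesis by (rule index_le_cover(1)[OF J A S(2) SR])
qed

lemma index_self:
  assumes A: "additive_subgroup A R"
  shows "finite_index A A" and "index A A = 1"
proof -
  have AR: "A \<subseteq> carrier R" using additive_subgroup.a_subset[OF A] .
  have "transversal A A {\<zero>}"
    unfolding transversal_def
    using additive_subgroup.zero_closed[OF A] additive_subgroup_minus_closed[OF A] by blast
  then show "finite_index A A" "index A A = 1" using index_transversal[OF A AR, of "{\<zero>}"] by simp_all
qed

lemma transversal_add_unique:
  assumes I: "additive_subgroup I R" and J: "additive_subgroup J R" and sub: "I \<subseteq> J"
    and A: "A \<subseteq> carrier R" and S: "transversal A J S" and T: "transversal J I T"
    and st: "s \<in> S" "s' \<in> S" "t \<in> T" "t' \<in> T" and diff: "(s \<oplus> t) \<ominus> (s' \<oplus> t') \<in> I"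
  shows "s = s'" "t = t'"
proof -
  have tJ: "t \<in> J" "t' \<in> J" using st(3,4) T by (auto simp: transversal_def)
  have R: "s \<in> carrier R" "s' \<in> carrier R" "t \<in> carrier R" "t' \<in> carrier R"
    using st(1,2) S A tJ additive_subgroup.a_subset[OF J] by (auto simp: transversal_def)
  have "s \<ominus> s' = ((s \<oplus> t) \<ominus> (s' \<oplus> t')) \<ominus> (t \<ominus> t')" using R by algebra
  then have "s \<ominus> s' \<in> J"
    using additive_subgroup_minus_closed[OF J subsetD[OF sub diff] additive_subgroup_minus_closed[OF J tJ]]
    by simp
  then show s: "s = s'" using st(1,2) S by (simp add: transversal_def)
  have "(s' \<oplus> t) \<ominus> (s' \<oplus> t') = t \<ominus> t'" using R by algebra
  then have "t \<ominus> t' \<in> I" using diff s by simp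
  then show "t = t'" using st(3,4) T by (simp add: transversal_def)
qed

lemma transversal_tower:
  assumes I: "additive_subgroup I R" and J: "additive_subgroup J R" and A: "additive_subgroup A R"
    and sub: "I \<subseteq> J" "J \<subseteq> A" and S: "transversal A J S" and T: "transversal J I T"
  shows "inj_on (\<lambda>(s, t). s \<oplus> t) (S \<times> T)" and "transversal A I ((\<lambda>(s, t). s \<oplus> t) ` (S \<times> T))"
proof -
  have AR: "A \<subseteq> carrier R" using additive_subgroup.a_subset[OF A] .
  have SA: "S \<subseteq> A" and cover_S: "\<And>x. x \<in> A \<Longrightarrow> \<exists>s\<in>S. x \<ominus> s \<in> J"
    using S by (simp_all add: transversal_def)
  have TA: "T \<subseteq> A" and cover_T: "\<And>x. x \<in> J \<Longrightarrow> \<exists>t\<in>T. x \<ominus> t \<in> I"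
    using T sub(2) by (auto simp: transversal_def)
  note unique = transversal_add_unique[OF I J sub(1) AR S T]
  show "inj_on (\<lambda>(s, t). s \<oplus> t) (S \<times> T)"
  proof (rule inj_onI, clarify)
    fix s t s' t' assume st: "s \<in> S" "t \<in> T" "s' \<in> S" "t' \<in> T" and eq: "s \<oplus> t = s' \<oplus> t'"
    have "s' \<oplus> t' \<in> carrier R" using st SA TA AR by blast
    then have "(s \<oplus> t) \<ominus> (s' \<oplus> t') = \<zero>" unfolding eq by simp
    then have "(s \<oplus> t) \<ominus> (s' \<oplus> t') \<in> I" using additive_subgroup.zero_closed[OF I] by simp
    then show "s = s' \<and> t = t'" using unique st by blast
  qed
  show "transversal A I ((\<lambda>(s, t). s \<oplus> t) ` (S \<times> T))"
    unfolding transversal_def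
  proof (intro conjI ballI impI)
    show "(\<lambda>(s, t). s \<oplus> t) ` (S \<times> T) \<subseteq> A"
      using SA TA additive_subgroup.a_closed[OF A] by auto
    fix x assume x: "x \<in> A"
    then obtain s where s: "s \<in> S" "x \<ominus> s \<in> J" using cover_S by blast
    then obtain t where t: "t \<in> T" "(x \<ominus> s) \<ominus> t \<in> I" using cover_T by blast
    have R: "x \<in> carrier R" "s \<in> carrier R" "t \<in> carrier R" using x s t SA TA AR by auto
    have "x \<ominus> (s \<oplus> t) = (x \<ominus> s) \<ominus> t" using R by algebra
    then have "x \<ominus> (s \<oplus> t) \<in> I" using t(2) by simp
    then show "\<exists>r\<in>(\<lambda>(s, t). s \<oplus> t) ` (S \<times> T). x \<ominus> r \<in> I" using s(1) t(1) by blast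
  next
    fix r r' assume "r \<in> (\<lambda>(s, t). s \<oplus> t) ` (S \<times> T)" "r' \<in> (\<lambda>(s, t). s \<oplus> t) ` (S \<times> T)"
      and diff: "r \<ominus> r' \<in> I"
    then obtain s t s' t' where st: "s \<in> S" "t \<in> T" "s' \<in> S" "t' \<in> T"
      and r: "r = s \<oplus> t" "r' = s' \<oplus> t'" by auto
    then show "r = r'" using unique[OF st(1,3,2,4)] diff by simp
  qed
qed

lemma index_tower:
  assumes I: "additive_subgroup I R" and J: "additive_subgroup J R" and A: "additive_subgroup A R"
    and sub: "I \<subseteq> J" "J \<subseteq> A" and fin: "finite_index A J" "finite_index J I"
  shows "finite_index A I" and "index A I = index A J * index J I"
proof -
  have R: "A \<subseteq> carrier R" "J \<subseteq> carrier R"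
    using additive_subgroup.a_subset[OF A] additive_subgroup.a_subset[OF J] by auto
  obtain S where S: "transversal A J S" "finite S" "card S = index A J"
    by (rule exists_transversal[OF J R(1) fin(1)])
  obtain T where T: "transversal J I T" "finite T" "card T = index J I"
    by (rule exists_transversal[OF I R(2) fin(2)])
  note tower = transversal_tower[OF I J A sub S(1) T(1)]
  have finite: "finite ((\<lambda>(s, t). s \<oplus> t) ` (S \<times> T))" using S T by simp
  show "finite_index A I" using index_transversal(1)[OF I R(1) tower(2) finite] .
  have "index A I = card ((\<lambda>(s, t). s \<oplus> t) ` (S \<times> T))"
    using index_transversal(2)[OF I R(1) tower(2) finite] .
  also have "\<dots> = index A J * index J I"
    using card_image[OF tower(1)] S(3) T(3) by (simp add: card_cartesian_product)
  finally show "index A I = index A J * index J I" .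
qed

lemma index_less:
  assumes I: "additive_subgroup I R" and J: "additive_subgroup J R" and A: "additive_subgroup A R"
    and sub: "I \<subset> J" "J \<subseteq> A" and fin: "finite_index A I"
  shows "index A J < index A I"
proof -
  have R: "A \<subseteq> carrier R" "J \<subseteq> carrier R"
    using additive_subgroup.a_subset[OF A] additive_subgroup.a_subset[OF J] by auto
  have finAJ: "finite_index A J" using finite_index_antimono[OF I J R(1) fin] sub by blast
  have finJI: "finite_index J I" using index_mono(1)[OF fin sub(2)] .
  obtain j where j: "j \<in> J" "j \<notin> I" using sub by blast
  have zeroJ: "\<zero> \<in> J" using additive_subgroup.zero_closed[OF J] .
  have "card {\<zero>, j} \<le> index J I"
  proof (rule index_ge_separated[OF I R(2) finJI])
    show "{\<zero>, j} \<subseteq> J" using zeroJ j by simp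
    have jR: "j \<in> carrier R" using j R by auto
    have "\<zero> \<ominus> j \<notin> I"
    proof
      assume "\<zero> \<ominus> j \<in> I"
      then have "\<ominus> (\<zero> \<ominus> j) \<in> I" using additive_subgroup.a_inv_closed[OF I] by simp
      then show False using j jR by (simp add: a_minus_def)
    qed
    moreover have "j \<ominus> \<zero> \<notin> I" using j jR by (simp add: a_minus_def)
    ultimately show "a = b" if "a \<in> {\<zero>, j}" "b \<in> {\<zero>, j}" "a \<ominus> b \<in> I" for a b using that by auto
  qed
  moreover have "j \<noteq> \<zero>" using j additive_subgroup.zero_closed[OF I] by metis
  ultimately have "2 \<le> index J I" by simp
  moreover have "0 < index A J" using index_pos[OF finAJ] zeroJ sub by blast
  moreover have "index A I = index A J * index J I"
    using index_tower(2)[OF I J A _ sub(2) finAJ finJI] sub by blast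
  ultimately show ?thesis by simp
qed

lemma index_eq_imp_cover:
  assumes I: "additive_subgroup I R" and A: "A \<subseteq> carrier R" "finite_index A I" and B: "B \<subseteq> A"
    and eq: "index B I = index A I" and x: "x \<in> A"
  shows "\<exists>b\<in>B. x \<ominus> b \<in> I"
proof -
  have "(\<lambda>a. I +> a) ` B = (\<lambda>a. I +> a) ` A"
    using A(2) B eq by (intro card_subset_eq) (auto simp: finite_index_def index_def)
  then obtain b where "b \<in> B" "I +> x = I +> b" using x by blast
  then show ?thesis using coset_eq_iff[OF I, of x b] A(1) B x by blast
qed

lemma index_le_prod:
  assumes A: "additive_subgroup A R" and I: "additive_subgroup I R" "finite_index A I"
    and N: "finite N" "\<And>i. i \<in> N \<Longrightarrow> additive_subgroup (B i) R" "\<And>i. i \<in> N \<Longrightarrow> finite_index A (B i)"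
    and kernel: "\<And>x. x \<in> A \<Longrightarrow> (\<And>i. i \<in> N \<Longrightarrow> x \<in> B i) \<Longrightarrow> x \<in> I"
  shows "index A I \<le> (\<Prod>i\<in>N. index A (B i))"
proof -
  have R: "A \<subseteq> carrier R" using additive_subgroup.a_subset[OF A] .
  obtain S where S: "transversal A I S" "card S = index A I"
    using exists_transversal[OF I(1) R I(2)] by metis
  have SA: "S \<subseteq> A" using S(1) by (simp add: transversal_def)
  define h where "h x = (\<lambda>i\<in>N. B i +> x)" for x
  have inj: "inj_on h S"
  proof (rule inj_onI)
    fix a b assume ab: "a \<in> S" "b \<in> S" "h a = h b"
    then have AA: "a \<in> A" "b \<in> A" using SA by auto
    have "a \<ominus> b \<in> B i" if i: "i \<in> N" for i
    proof -
      have "B i +> a = B i +> b" using ab(3) i unfolding h_def by (metis restrict_apply')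
      then show ?thesis using coset_eq_iff[OF N(2)[OF i]] AA R by blast
    qed
    then have "a \<ominus> b \<in> I" using kernel additive_subgroup_minus_closed[OF A AA] by blast
    then show "a = b" using S(1) ab by (simp add: transversal_def)
  qed
  have "card (h ` S) \<le> card (\<Pi>\<^sub>E i\<in>N. (\<lambda>a. B i +> a) ` A)"
  proof (rule card_mono)
    show "finite (\<Pi>\<^sub>E i\<in>N. (\<lambda>a. B i +> a) ` A)"
      using N(3) by (intro finite_PiE[OF N(1)]) (auto simp: finite_index_def)
    show "h ` S \<subseteq> (\<Pi>\<^sub>E i\<in>N. (\<lambda>a. B i +> a) ` A)" using SA by (auto simp: h_def)
  qed
  then show ?thesis
    unfolding card_image[OF inj] card_PiE[OF N(1)] S(2) index_def[symmetric] .
qed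

lemma index_ge_prod:
  assumes I: "additive_subgroup I R" and C: "C \<subseteq> carrier R" "finite_index C I"
    and N: "finite N" "\<And>i. i \<in> N \<Longrightarrow> additive_subgroup (B i) R" "\<And>i. i \<in> N \<Longrightarrow> finite_index (A i) (B i)"
      "\<And>i. i \<in> N \<Longrightarrow> A i \<subseteq> carrier R" "\<And>i. i \<in> N \<Longrightarrow> I \<subseteq> B i"
    and approx: "\<And>g. g \<in> Pi\<^sub>E N A \<Longrightarrow> \<exists>c\<in>C. \<forall>i\<in>N. c \<ominus> g i \<in> B i"
  shows "(\<Prod>i\<in>N. index (A i) (B i)) \<le> index C I"
proof -
  have "\<forall>i\<in>N. \<exists>T. transversal (A i) (B i) T \<and> card T = index (A i) (B i)"
    using exists_transversal[OF N(2,4,3)] by metis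
  then obtain T where T: "\<And>i. i \<in> N \<Longrightarrow> transversal (A i) (B i) (T i)"
      "\<And>i. i \<in> N \<Longrightarrow> card (T i) = index (A i) (B i)" by metis
  have TA: "g \<in> Pi\<^sub>E N A" if "g \<in> Pi\<^sub>E N T" for g
  proof (rule PiE_I)
    show "g i \<in> A i" if "i \<in> N" for i
      using PiE_mem[OF \<open>g \<in> Pi\<^sub>E N T\<close> that] T(1)[OF that] by (auto simp: transversal_def)
    show "g i = undefined" if "i \<notin> N" for i using PiE_arb[OF \<open>g \<in> Pi\<^sub>E N T\<close> that] .
  qed
  obtain c where c: "\<And>g. g \<in> Pi\<^sub>E N T \<Longrightarrow> c g \<in> C"
      "\<And>g i. g \<in> Pi\<^sub>E N T \<Longrightarrow> i \<in> N \<Longrightarrow> c g \<ominus> g i \<in> B i"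
    using approx[OF TA] by metis
  have separated: "g = h" if g: "g \<in> Pi\<^sub>E N T" and h: "h \<in> Pi\<^sub>E N T" and "c g \<ominus> c h \<in> I" for g h
  proof (rule PiE_ext[OF g h])
    fix i assume i: "i \<in> N"
    have R: "c g \<in> carrier R" "c h \<in> carrier R" "g i \<in> carrier R" "h i \<in> carrier R"
      using c(1)[OF g] c(1)[OF h] C(1) PiE_mem[OF TA[OF g] i] PiE_mem[OF TA[OF h] i] N(4)[OF i] by auto
    have "c g \<ominus> c h \<in> B i" using N(5)[OF i] \<open>c g \<ominus> c h \<in> I\<close> by blast
    then have "(c g \<ominus> c h) \<ominus> ((c g \<ominus> g i) \<ominus> (c h \<ominus> h i)) \<in> B i"
      using additive_subgroup_minus_closed[OF N(2)[OF i]] c(2)[OF g i] c(2)[OF h i] by blast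
    moreover have "(c g \<ominus> c h) \<ominus> ((c g \<ominus> g i) \<ominus> (c h \<ominus> h i)) = g i \<ominus> h i" using R by algebra
    ultimately have "g i \<ominus> h i \<in> B i" by simp
    then show "g i = h i"
      using T(1)[OF i] PiE_mem[OF g i] PiE_mem[OF h i] by (simp add: transversal_def)
  qed
  have inj: "inj_on c (Pi\<^sub>E N T)"
  proof (rule inj_onI)
    fix g h assume gh: "g \<in> Pi\<^sub>E N T" "h \<in> Pi\<^sub>E N T" "c g = c h"
    then have "c h \<in> carrier R" using c(1) C(1) by blast
    then have "c g \<ominus> c h = \<zero>" using gh(3) by simp
    then show "g = h" using separated gh additive_subgroup.zero_closed[OF I] by metis
  qed
  have "(\<Prod>i\<in>N. index (A i) (B i)) = card (Pi\<^sub>E N T)" using card_PiE[OF N(1), of T] T(2) by simp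
  also have "\<dots> = card (c ` Pi\<^sub>E N T)" using card_image[OF inj] by simp
  also have "\<dots> \<le> index C I"
    using c(1) separated by (intro index_ge_separated[OF I C]) auto
  finally show ?thesis .
qed

end

section \<open>Linear combinations modulo a subgroup\<close>

context ring
begin

lemma combine_mem:
  assumes M: "additive_subgroup M R" and mult: "\<And>a u. a \<in> V \<Longrightarrow> u \<in> U \<Longrightarrow> a \<otimes> u \<in> M"
  shows "set as \<subseteq> V \<Longrightarrow> set Us \<subseteq> U \<Longrightarrow> combine as Us \<in> M"
  by (induction as Us rule: combine.induct)
    (use mult additive_subgroup.a_closed[OF M] additive_subgroup.zero_closed[OF M] in auto)

lemma combine_minus:
  assumes "length as = length Us" "length bs = length Us"
    and "set as \<subseteq> carrier R" "set bs \<subseteq> carrier R" "set Us \<subseteq> carrier R"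
  shows "combine (map2 (\<lambda>a b. a \<ominus> b) as bs) Us = combine as Us \<ominus> combine bs Us"
proof -
  have neg: "set (map (\<lambda>b. \<ominus> b) bs) \<subseteq> carrier R" using assms(4) by auto
  have "map2 (\<lambda>a b. a \<ominus> b) as bs = map2 (\<oplus>) as (map (\<lambda>b. \<ominus> b) bs)"
    using assms(1,2) by (intro nth_equalityI) (auto simp: a_minus_def)
  then have "combine (map2 (\<lambda>a b. a \<ominus> b) as bs) Us = combine as Us \<oplus> combine (map (\<lambda>b. \<ominus> b) bs) Us"
    using combine_add[OF assms(1) _ assms(3) neg assms(5)] assms(2) by simp
  also have "combine (map (\<lambda>b. \<ominus> b) bs) Us = \<ominus> \<one> \<otimes> combine bs Us"
  proof -
    have neg_eq: "map (\<lambda>b. \<ominus> b) bs = map ((\<otimes>) (\<ominus> \<one>)) bs"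
      using assms(4) by (intro map_cong) (auto simp: l_minus)
    show ?thesis unfolding neg_eq using combine_r_distr[OF assms(4,5), of "\<ominus> \<one>"] by simp
  qed
  also have "\<ominus> \<one> \<otimes> combine bs Us = \<ominus> combine bs Us" using assms(4,5) by (simp add: l_minus)
  finally show ?thesis by (simp add: a_minus_def)
qed

lemma index_le_span:
  assumes J: "additive_subgroup J R" and V: "V \<subseteq> carrier R" "finite_index V J"
    and I: "additive_subgroup I R" and C: "C \<subseteq> carrier R" and Us: "set Us \<subseteq> carrier R"
    and mult: "\<And>a u. a \<in> J \<Longrightarrow> u \<in> set Us \<Longrightarrow> a \<otimes> u \<in> I"
    and span: "\<And>c. c \<in> C \<Longrightarrow> \<exists>as. set as \<subseteq> V \<and> length as = length Us \<and> c \<ominus> combine as Us \<in> I"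
  shows "finite_index C I" and "index C I \<le> index V J ^ length Us"
proof -
  obtain S where S: "transversal V J S" "finite S" "card S = index V J"
    by (rule exists_transversal[OF J V])
  then obtain h where h: "\<And>a. a \<in> V \<Longrightarrow> h a \<in> S" "\<And>a. a \<in> V \<Longrightarrow> a \<ominus> h a \<in> J"
    unfolding transversal_def by metis
  have SV: "S \<subseteq> V" using S(1) by (simp add: transversal_def)
  let ?D = "{rs. set rs \<subseteq> S \<and> length rs = length Us}"
  define T where "T = (\<lambda>rs. combine rs Us) ` ?D"
  have fin: "finite ?D" using finite_lists_length_eq[OF S(2)] .
  have T: "finite T" "T \<subseteq> carrier R"
    unfolding T_def using fin SV V(1) Us by (auto intro!: combine_in_carrier)
  have cover: "\<exists>r\<in>T. c \<ominus> r \<in> I" if c: "c \<in> C" for c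
  proof -
    obtain as where as: "set as \<subseteq> V" "length as = length Us" "c \<ominus> combine as Us \<in> I"
      using span[OF c] by blast
    define rs where "rs = map h as"
    have rs: "set rs \<subseteq> S" "length rs = length Us" using h(1) as(1,2) by (auto simp: rs_def)
    have R: "set as \<subseteq> carrier R" "set rs \<subseteq> carrier R" using as(1) rs(1) SV V(1) by auto
    have "set (map2 (\<lambda>a b. a \<ominus> b) as rs) \<subseteq> J"
      using h(2) as(1) by (auto simp: rs_def zip_map2 zip_same_conv_map)
    then have "combine as Us \<ominus> combine rs Us \<in> I"
      unfolding combine_minus[OF as(2) rs(2) R Us, symmetric]
      using combine_mem[OF I mult] by blast
    then have "(c \<ominus> combine as Us) \<oplus> (combine as Us \<ominus> combine rs Us) \<in> I"
      using additive_subgroup.a_closed[OF I as(3)] by blast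
    moreover have "(c \<ominus> combine as Us) \<oplus> (combine as Us \<ominus> combine rs Us) = c \<ominus> combine rs Us"
    proof -
      have "c \<in> carrier R" "combine as Us \<in> carrier R" "combine rs Us \<in> carrier R"
        using c C R Us by auto
      then show ?thesis by algebra
    qed
    ultimately show ?thesis using rs by (auto simp: T_def)
  qed
  note cover_bound = index_le_cover[OF I C T cover]
  show "finite_index C I" by (rule cover_bound(1))
  have "card T \<le> card ?D" unfolding T_def by (rule card_image_le[OF fin])
  then show "index C I \<le> index V J ^ length Us"
    using cover_bound(2) card_lists_length_eq[OF S(2), of "length Us"] S(3) by simp
qed

lemma combine_eq_mod_imp_eq:
  assumes V: "additive_subgroup V R" and S: "transversal V J S" and Us: "set Us \<subseteq> carrier R"
    and free: "\<And>as. set as \<subseteq> V \<Longrightarrow> length as = length Us \<Longrightarrow> combine as Us \<in> I \<Longrightarrow> set as \<subseteq> J"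
    and as: "set as \<subseteq> S" "length as = length Us" and bs: "set bs \<subseteq> S" "length bs = length Us"
    and diff: "combine as Us \<ominus> combine bs Us \<in> I"
  shows "as = bs"
proof (rule nth_equalityI)
  let ?cs = "map2 (\<lambda>a b. a \<ominus> b) as bs"
  have in_V: "set as \<subseteq> V" "set bs \<subseteq> V" using as(1) bs(1) S by (auto simp: transversal_def)
  have R: "set as \<subseteq> carrier R" "set bs \<subseteq> carrier R"
    using in_V additive_subgroup.a_subset[OF V] by auto
  show "length as = length bs" using as(2) bs(2) by simp
  have "combine ?cs Us \<in> I" using diff combine_minus[OF as(2) bs(2) R Us] by simp
  moreover have "set ?cs \<subseteq> V"
  proof
    fix x assume "x \<in> set ?cs"
    then obtain a b where ab: "(a, b) \<in> set (zip as bs)" "x = a \<ominus> b" by auto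
    have "a \<in> V" "b \<in> V" using in_V set_zip_leftD[OF ab(1)] set_zip_rightD[OF ab(1)] by auto
    then show "x \<in> V" using additive_subgroup_minus_closed[OF V] ab(2) by simp
  qed
  moreover have "length ?cs = length Us" using as(2) bs(2) by simp
  ultimately have cs: "set ?cs \<subseteq> J" using free by blast
  fix i assume i: "i < length as"
  have "?cs ! i \<in> J" using i as(2) bs(2) nth_mem[of i ?cs] cs by auto
  then have "as ! i \<ominus> bs ! i \<in> J" using i as(2) bs(2) by simp
  moreover have "as ! i \<in> S" "bs ! i \<in> S" using as bs i by auto
  ultimately show "as ! i = bs ! i" using S by (simp add: transversal_def)
qed

lemma index_ge_free:
  assumes J: "additive_subgroup J R" and V: "additive_subgroup V R" "finite_index V J"
    and I: "additive_subgroup I R" and C: "C \<subseteq> carrier R" "finite_index C I"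
    and Us: "set Us \<subseteq> carrier R"
    and in_C: "\<And>as. set as \<subseteq> V \<Longrightarrow> length as = length Us \<Longrightarrow> combine as Us \<in> C"
    and free: "\<And>as. set as \<subseteq> V \<Longrightarrow> length as = length Us \<Longrightarrow> combine as Us \<in> I \<Longrightarrow> set as \<subseteq> J"
  shows "index V J ^ length Us \<le> index C I"
proof -
  obtain S where S: "transversal V J S" "finite S" "card S = index V J"
    by (rule exists_transversal[OF J additive_subgroup.a_subset[OF V(1)] V(2)])
  define D where "D = {rs. set rs \<subseteq> S \<and> length rs = length Us}"
  have separated: "as = bs" if "as \<in> D" "bs \<in> D" "combine as Us \<ominus> combine bs Us \<in> I" for as bs
    using that combine_eq_mod_imp_eq[OF V(1) S(1) Us free, where as = as and bs = bs]
    by (simp add: D_def)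
  have combine_C: "combine rs Us \<in> C" if "rs \<in> D" for rs
    using in_C[of rs] that S(1) by (auto simp: D_def transversal_def)
  have inj: "inj_on (\<lambda>rs. combine rs Us) D"
  proof (rule inj_onI)
    fix as bs assume ab: "as \<in> D" "bs \<in> D" "combine as Us = combine bs Us"
    then have "combine bs Us \<in> carrier R" using combine_C C(1) by blast
    then have "combine as Us \<ominus> combine bs Us = \<zero>" using ab(3) by simp
    then show "as = bs" using separated ab additive_subgroup.zero_closed[OF I] by metis
  qed
  have "index V J ^ length Us = card D"
    unfolding D_def using card_lists_length_eq[OF S(2), of "length Us"] S(3) by simp
  also have "\<dots> = card ((\<lambda>rs. combine rs Us) ` D)" using card_image[OF inj] by simp
  also have "\<dots> \<le> index C I"
    using combine_C separated by (intro index_ge_separated[OF I C]) auto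
  finally show ?thesis .
qed

end

section \<open>Ideals of subrings\<close>

context ring
begin

abbreviation ideal_in :: "'a set \<Rightarrow> 'a set \<Rightarrow> bool"
  where "ideal_in I A \<equiv> ideal I (R\<lparr>carrier := A\<rparr>)"

lemma subring_additive_subgroup: "subring A R \<Longrightarrow> additive_subgroup A R"
  by (intro additive_subgroup.intro subring.axioms(1))

lemma subring_minus_closed: "subring A R \<Longrightarrow> a \<in> A \<Longrightarrow> b \<in> A \<Longrightarrow> a \<ominus> b \<in> A"
  by (rule additive_subgroup_minus_closed[OF subring_additive_subgroup])

lemma subring_nat_pow_closed:
  assumes "subring A R" "a \<in> A"
  shows "a [^] (n::nat) \<in> A"
  by (induction n) (use assms subringE(3,6)[OF assms(1)] in auto)

lemma subring_minus_eq:
  assumes A: "subring A R" and ab: "a \<in> A" "b \<in> A"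
  shows "a \<ominus>\<^bsub>R\<lparr>carrier := A\<rparr>\<^esub> b = a \<ominus> b"
proof -
  interpret A: ring "R\<lparr>carrier := A\<rparr>" using subring_is_ring[OF A] .
  have "b \<in> carrier R" using subringE(1)[OF A] ab by blast
  then have "\<ominus>\<^bsub>R\<lparr>carrier := A\<rparr>\<^esub> b = \<ominus> b"
    using A.minus_equality[of "\<ominus> b" b] subringE(5)[OF A ab(2)] ab(2) by (simp add: l_neg)
  then show ?thesis by (simp add: a_minus_def)
qed

lemma l_coset_mem: "x \<in> t <# A \<longleftrightarrow> (\<exists>a\<in>A. x = t \<otimes> a)"
  by (auto simp: l_coset_def)

lemma set_add_mem: "x \<in> A <+> B \<longleftrightarrow> (\<exists>a\<in>A. \<exists>b\<in>B. x = a \<oplus> b)"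
  by (auto simp: set_add_def')

end

lemma (in cring) ideal_in_iff:
  assumes A: "subring A R"
  shows "ideal_in I A \<longleftrightarrow> additive_subgroup I R \<and> I \<subseteq> A \<and> (\<forall>a\<in>A. \<forall>x\<in>I. a \<otimes> x \<in> I)"
proof -
  interpret A: ring "R\<lparr>carrier := A\<rparr>" using subring_is_ring[OF A] .
  have AR: "A \<subseteq> carrier R" using subringE(1)[OF A] .
  show ?thesis
  proof (intro iffI conjI ballI)
    assume I: "ideal_in I A"
    interpret I: ideal I "R\<lparr>carrier := A\<rparr>" by (rule I)
    show IA: "I \<subseteq> A" using I.a_subset by simp
    show "additive_subgroup I R"
    proof (rule additive_subgroup_minusI)
      show "I \<subseteq> carrier R" "\<zero> \<in> I" using IA AR I.zero_closed by auto
      show "a \<ominus> b \<in> I" if ab: "a \<in> I" "b \<in> I" for a b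
        using A.additive_subgroup_minus_closed[OF I.additive_subgroup_axioms ab]
        unfolding subring_minus_eq[OF A subsetD[OF IA ab(1)] subsetD[OF IA ab(2)]] .
    qed
    show "a \<otimes> x \<in> I" if "a \<in> A" "x \<in> I" for a x using I.I_l_closed that by simp
  next
    assume "additive_subgroup I R \<and> I \<subseteq> A \<and> (\<forall>a\<in>A. \<forall>x\<in>I. a \<otimes> x \<in> I)"
    then have I: "additive_subgroup I R" "I \<subseteq> A" and mult: "\<And>a x. a \<in> A \<Longrightarrow> x \<in> I \<Longrightarrow> a \<otimes> x \<in> I"
      by blast+
    have "additive_subgroup I (R\<lparr>carrier := A\<rparr>)"
    proof (rule A.additive_subgroup_minusI)
      show "I \<subseteq> carrier (R\<lparr>carrier := A\<rparr>)" "\<zero>\<^bsub>R\<lparr>carrier := A\<rparr>\<^esub> \<in> I"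
        using I(2) additive_subgroup.zero_closed[OF I(1)] by simp_all
      show "a \<ominus>\<^bsub>R\<lparr>carrier := A\<rparr>\<^esub> b \<in> I" if ab: "a \<in> I" "b \<in> I" for a b
        using additive_subgroup_minus_closed[OF I(1) ab]
        unfolding subring_minus_eq[OF A subsetD[OF I(2) ab(1)] subsetD[OF I(2) ab(2)]] .
    qed
    then have "subgroup I (add_monoid (R\<lparr>carrier := A\<rparr>))" by (rule additive_subgroup.a_subgroup)
    moreover have "x \<otimes> a \<in> I" if "a \<in> A" "x \<in> I" for a x
    proof -
      have "a \<in> carrier R" "x \<in> carrier R" using that I(2) AR by auto
      then show ?thesis using mult[OF that] by (simp add: m_comm)
    qed
    ultimately show "ideal_in I A" using mult by (intro idealI[OF A.ring_axioms]) simp_all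
  qed
qed

context cring
begin

lemma ideal_in_minusI:
  assumes "subring A R" "I \<subseteq> A" "\<zero> \<in> I" "\<And>a b. a \<in> I \<Longrightarrow> b \<in> I \<Longrightarrow> a \<ominus> b \<in> I"
    and "\<And>a x. a \<in> A \<Longrightarrow> x \<in> I \<Longrightarrow> a \<otimes> x \<in> I"
  shows "ideal_in I A"
proof -
  have "I \<subseteq> carrier R" using assms(2) subringE(1)[OF assms(1)] by (rule subset_trans)
  then show ?thesis using assms additive_subgroup_minusI by (simp add: ideal_in_iff)
qed

lemma ideal_inD:
  assumes "subring A R" "ideal_in I A"
  shows "additive_subgroup I R" "I \<subseteq> A" "\<And>a x. a \<in> A \<Longrightarrow> x \<in> I \<Longrightarrow> a \<otimes> x \<in> I"
  using assms ideal_in_iff by auto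

lemma ideal_in_r_closed:
  assumes A: "subring A R" and I: "ideal_in I A" and "a \<in> A" "x \<in> I"
  shows "x \<otimes> a \<in> I"
  using ideal.I_r_closed[OF I, of x a] assms(3,4) by simp

lemma ideal_in_l_coset:
  assumes A: "subring A R" and t: "t \<in> A"
  shows "ideal_in (t <# A) A"
proof (rule ideal_in_minusI[OF A])
  have AR: "A \<subseteq> carrier R" and tR: "t \<in> carrier R" using subringE(1)[OF A] t by auto
  show "t <# A \<subseteq> A" using subringE(6)[OF A t] by (auto simp: l_coset_mem)
  have "\<zero> = t \<otimes> \<zero>" using tR by simp
  then show "\<zero> \<in> t <# A" using subringE(2)[OF A] unfolding l_coset_mem by blast
  fix a b assume "b \<in> t <# A"
  then obtain d where d: "d \<in> A" "b = t \<otimes> d" by (auto simp: l_coset_mem)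
  show "a \<ominus> b \<in> t <# A" if a: "a \<in> t <# A"
  proof -
    obtain c where c: "c \<in> A" "a = t \<otimes> c" using a by (auto simp: l_coset_mem)
    have R: "c \<in> carrier R" "d \<in> carrier R" using c d AR by auto
    have "a \<ominus> b = t \<otimes> (c \<ominus> d)" unfolding c(2) d(2) using R tR by algebra
    then show ?thesis using subring_minus_closed[OF A c(1) d(1)] unfolding l_coset_mem by blast
  qed
  show "a \<otimes> b \<in> t <# A" if "a \<in> A"
  proof -
    have "a \<otimes> b = t \<otimes> (a \<otimes> d)" unfolding d(2) using that d(1) AR tR by (simp add: m_lcomm subset_iff)
    then show ?thesis using subringE(6)[OF A that d(1)] unfolding l_coset_mem by blast
  qed
qed

lemma l_coset_self:
  assumes A: "subring A R" and "t \<in> carrier R"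
  shows "t \<in> t <# A"
proof -
  have "t = t \<otimes> \<one>" using assms(2) by simp
  then show ?thesis using subringE(3)[OF A] unfolding l_coset_mem by blast
qed

lemma l_coset_subset:
  assumes A: "subring A R" and "t \<in> carrier R" and s: "s \<in> t <# A"
  shows "s <# A \<subseteq> t <# A"
proof
  fix x assume "x \<in> s <# A"
  then obtain b where b: "b \<in> A" "x = s \<otimes> b" by (auto simp: l_coset_mem)
  obtain a where a: "a \<in> A" "s = t \<otimes> a" using s by (auto simp: l_coset_mem)
  have "x = t \<otimes> (a \<otimes> b)"
    unfolding b(2) a(2) using a(1) b(1) assms(2) subringE(1)[OF A] by (simp add: m_assoc subset_iff)
  then show "x \<in> t <# A" using subringE(6)[OF A a(1) b(1)] unfolding l_coset_mem by blast
qed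

lemma ideal_in_set_add:
  assumes A: "subring A R" and I: "ideal_in I A" and J: "ideal_in J A"
  shows "ideal_in (I <+> J) A"
proof -
  interpret A: ring "R\<lparr>carrier := A\<rparr>" using subring_is_ring[OF A] .
  have "I <+>\<^bsub>R\<lparr>carrier := A\<rparr>\<^esub> J = I <+> J" by (simp add: set_add_def')
  then show ?thesis using A.add_ideals[OF I J] by simp
qed

lemma ideal_in_subset_set_add:
  assumes A: "subring A R" and I: "ideal_in I A" and J: "ideal_in J A"
  shows "I \<subseteq> I <+> J" "J \<subseteq> I <+> J"
proof -
  note I' = ideal_inD[OF A I] and J' = ideal_inD[OF A J] and AR = subringE(1)[OF A]
  have "x = x \<oplus> \<zero>" "x = \<zero> \<oplus> x" if "x \<in> A" for x using that AR by auto
  then show "I \<subseteq> I <+> J" "J \<subseteq> I <+> J"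
    using additive_subgroup.zero_closed[OF I'(1)] additive_subgroup.zero_closed[OF J'(1)] I'(2) J'(2)
    unfolding subset_iff set_add_mem by metis+
qed

lemma additive_subgroup_l_coset:
  assumes I: "additive_subgroup I R" and t: "t \<in> carrier R"
  shows "additive_subgroup (t <# I) R"
proof (rule additive_subgroup_minusI)
  have IR: "I \<subseteq> carrier R" using additive_subgroup.a_subset[OF I] .
  show "t <# I \<subseteq> carrier R" using IR t by (auto simp: l_coset_mem subset_iff)
  have "\<zero> = t \<otimes> \<zero>" using t by simp
  then show "\<zero> \<in> t <# I" using additive_subgroup.zero_closed[OF I] unfolding l_coset_mem by blast
  fix a b assume "a \<in> t <# I" "b \<in> t <# I"
  then obtain c d where cd: "c \<in> I" "d \<in> I" "a = t \<otimes> c" "b = t \<otimes> d" by (auto simp: l_coset_mem)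
  have "c \<in> carrier R" "d \<in> carrier R" using cd IR by auto
  then have "a \<ominus> b = t \<otimes> (c \<ominus> d)" unfolding cd(3,4) using t by algebra
  then show "a \<ominus> b \<in> t <# I"
    using additive_subgroup_minus_closed[OF I cd(1,2)] unfolding l_coset_mem by blast
qed

end

lemma (in domain) l_coset_minus_iff:
  assumes I: "I \<subseteq> carrier R" and t: "t \<in> carrier R" "t \<noteq> \<zero>" and ab: "a \<in> carrier R" "b \<in> carrier R"
  shows "t \<otimes> a \<ominus> t \<otimes> b \<in> t <# I \<longleftrightarrow> a \<ominus> b \<in> I"
proof -
  have "t \<otimes> a \<ominus> t \<otimes> b = t \<otimes> (a \<ominus> b)" using ab t(1) by algebra
  moreover have "a \<ominus> b = i" if "i \<in> I" "t \<otimes> (a \<ominus> b) = t \<otimes> i" for i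
    using m_lcancel[OF t(2,1)] that ab I by auto
  ultimately show ?thesis unfolding l_coset_mem by metis
qed

lemma (in domain) index_l_coset:
  assumes I: "additive_subgroup I R" and A: "additive_subgroup A R" "finite_index A I"
    and t: "t \<in> carrier R" "t \<noteq> \<zero>"
  shows "finite_index (t <# A) (t <# I)" and "index (t <# A) (t <# I) = index A I"
proof -
  have AR: "A \<subseteq> carrier R" using additive_subgroup.a_subset[OF A(1)] .
  have tI: "additive_subgroup (t <# I) R" using additive_subgroup_l_coset[OF I t(1)] .
  have tA: "t <# A \<subseteq> carrier R" using AR t(1) by (auto simp: l_coset_mem subset_iff)
  obtain S where S: "transversal A I S" "finite S" "card S = index A I"
    by (rule exists_transversal[OF I AR A(2)])
  have SA: "S \<subseteq> A" and cover: "\<And>x. x \<in> A \<Longrightarrow> \<exists>r\<in>S. x \<ominus> r \<in> I"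
    and separated: "\<And>r s. r \<in> S \<Longrightarrow> s \<in> S \<Longrightarrow> r \<ominus> s \<in> I \<Longrightarrow> r = s"
    using S(1) by (simp_all add: transversal_def)
  have diff: "t \<otimes> a \<ominus> t \<otimes> b \<in> t <# I \<longleftrightarrow> a \<ominus> b \<in> I" if "a \<in> A" "b \<in> A" for a b
    using that AR by (intro l_coset_minus_iff[OF additive_subgroup.a_subset[OF I] t]) auto
  have "transversal (t <# A) (t <# I) ((\<otimes>) t ` S)"
    unfolding transversal_def
  proof (intro conjI ballI impI)
    show "(\<otimes>) t ` S \<subseteq> t <# A" using SA unfolding l_coset_def by blast
    fix x assume "x \<in> t <# A"
    then obtain a where a: "a \<in> A" "x = t \<otimes> a" by (auto simp: l_coset_mem)
    then obtain r where r: "r \<in> S" "a \<ominus> r \<in> I" using cover by blast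
    then have "x \<ominus> t \<otimes> r \<in> t <# I" using diff[of a r] a SA by auto
    then show "\<exists>r\<in>(\<otimes>) t ` S. x \<ominus> r \<in> t <# I" using r(1) by blast
  next
    fix x y assume "x \<in> (\<otimes>) t ` S" "y \<in> (\<otimes>) t ` S" "x \<ominus> y \<in> t <# I"
    then obtain a b where ab: "a \<in> S" "b \<in> S" "x = t \<otimes> a" "y = t \<otimes> b" "t \<otimes> a \<ominus> t \<otimes> b \<in> t <# I"
      by blast
    then show "x = y" using diff[of a b] separated SA by blast
  qed
  then have "finite_index (t <# A) (t <# I)" "index (t <# A) (t <# I) = card ((\<otimes>) t ` S)"
    using index_transversal[OF tI tA] S(2) by auto
  moreover have "inj_on ((\<otimes>) t) S"
    using m_lcancel[OF t(2,1)] SA AR by (auto simp: inj_on_def subset_iff)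
  ultimately show "finite_index (t <# A) (t <# I)" "index (t <# A) (t <# I) = index A I"
    using S(3) by (auto simp: card_image)
qed

section \<open>Valuation rings\<close>

context field
begin

lemma inv_nonzero:
  assumes "a \<in> carrier R" "a \<noteq> \<zero>"
  shows "inv a \<in> carrier R" "inv a \<noteq> \<zero>" "a \<otimes> inv a = \<one>" "inv a \<otimes> a = \<one>" "inv (inv a) = a"
  using assms field_Units by auto

lemma inv_mult_nonzero:
  assumes "a \<in> carrier R" "a \<noteq> \<zero>" "b \<in> carrier R" "b \<noteq> \<zero>"
  shows "inv (a \<otimes> b) = inv a \<otimes> inv b"
proof (rule comm_inv_char)
  note inv_nonzero[OF assms(1,2)] inv_nonzero[OF assms(3,4)]
  then have "a \<otimes> b \<otimes> (inv a \<otimes> inv b) = (a \<otimes> inv a) \<otimes> (b \<otimes> inv b)" using assms by (simp add: m_ac)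
  then show "a \<otimes> b \<otimes> (inv a \<otimes> inv b) = \<one>" using inv_nonzero assms by simp
qed (use assms inv_nonzero in auto)

lemma subfield_inv:
  assumes "subfield F R" "a \<in> F" "a \<noteq> \<zero>"
  shows "inv a \<in> F" "inv a \<noteq> \<zero>" "a \<otimes> inv a = \<one>" "inv a \<otimes> a = \<one>"
  using subfield_m_inv[OF assms(1), of a] assms by auto

definition nonunits :: "'a set \<Rightarrow> 'a set"
  where "nonunits V = {z \<in> V. z = \<zero> \<or> inv z \<notin> V}"

end

locale val_ring = field R for R (structure) +
  fixes F V
  assumes subfield: "subfield F R" and subring: "subring V R" and ring_subset: "V \<subseteq> F"
    and total: "z \<in> F \<Longrightarrow> z \<noteq> \<zero> \<Longrightarrow> z \<in> V \<or> inv z \<in> V"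
begin

lemma field_subring: "subring F R"
  using subfield by (rule subfieldE(1))

lemma field_carrier: "F \<subseteq> carrier R"
  using subfield by (rule subfieldE(3))

lemma ring_carrier: "V \<subseteq> carrier R"
  using subring by (rule subringE(1))

lemma divides_total:
  assumes x: "x \<in> F" and y: "y \<in> F"
  shows "x \<in> y <# V \<or> y \<in> x <# V"
proof (cases "x = \<zero> \<or> y = \<zero>")
  case True
  have "\<zero> = x \<otimes> \<zero>" "\<zero> = y \<otimes> \<zero>" using x y field_carrier by auto
  then show ?thesis using True subringE(2)[OF subring] unfolding l_coset_mem by blast
next
  case False
  note inv_x = subfield_inv[OF subfield x] and inv_y = subfield_inv[OF subfield y]
  have R: "x \<in> carrier R" "y \<in> carrier R" "inv x \<in> carrier R" "inv y \<in> carrier R"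
    using x y inv_x(1) inv_y(1) False field_carrier by auto
  have "x \<otimes> inv y \<in> F" using subringE(6)[OF field_subring x] inv_y(1) False by blast
  moreover have "x \<otimes> inv y \<noteq> \<zero>" using integral[of x "inv y"] R inv_y(2) False by blast
  ultimately have "x \<otimes> inv y \<in> V \<or> inv (x \<otimes> inv y) \<in> V" by (rule total)
  moreover have "inv (x \<otimes> inv y) = inv x \<otimes> y"
    using inv_mult_nonzero[of x "inv y"] inv_nonzero[of y] R inv_y(2) False by simp
  moreover have "x = y \<otimes> (x \<otimes> inv y)" using R inv_y(3) False by (simp add: m_lcomm)
  moreover have "y = x \<otimes> (inv x \<otimes> y)" using R inv_x(3) False by (simp add: m_assoc[symmetric])
  ultimately show ?thesis unfolding l_coset_mem by metis
qed

lemma one_notin_nonunits: "\<one> \<notin> nonunits V"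
  using subringE(3)[OF subring] by (simp add: nonunits_def)

lemma zero_nonunit: "\<zero> \<in> nonunits V"
  using subringE(2)[OF subring] by (simp add: nonunits_def)

lemma nonunits_mult:
  assumes a: "a \<in> V" and x: "x \<in> nonunits V"
  shows "a \<otimes> x \<in> nonunits V"
proof -
  have xV: "x \<in> V" "x = \<zero> \<or> inv x \<notin> V" using x by (auto simp: nonunits_def)
  have R: "a \<in> carrier R" "x \<in> carrier R" using a xV ring_carrier by auto
  have "inv (a \<otimes> x) \<notin> V" if nz: "a \<otimes> x \<noteq> \<zero>"
  proof
    assume inv: "inv (a \<otimes> x) \<in> V"
    have x0: "x \<noteq> \<zero>" and a0: "a \<noteq> \<zero>" using nz R by auto
    have "a \<otimes> inv (a \<otimes> x) = inv x"
      using inv_mult_nonzero[OF R(1) a0 R(2) x0] inv_nonzero[OF R(1) a0] inv_nonzero[OF R(2) x0] R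
      by (simp add: m_assoc[symmetric])
    then have "inv x \<in> V" using subringE(6)[OF subring a inv] by simp
    then show False using xV x0 by simp
  qed
  then show ?thesis using subringE(6)[OF subring a xV(1)] by (auto simp: nonunits_def)
qed

lemma ideal_nonunits: "ideal_in (nonunits V) V"
proof (rule ideal_in_minusI[OF subring])
  show "nonunits V \<subseteq> V" by (auto simp: nonunits_def)
  show "\<zero> \<in> nonunits V" by (rule zero_nonunit)
  show "a \<otimes> x \<in> nonunits V" if "a \<in> V" "x \<in> nonunits V" for a x using nonunits_mult that .
  fix x y assume xy: "x \<in> nonunits V" "y \<in> nonunits V"
  then have R: "x \<in> carrier R" "y \<in> carrier R" using ring_carrier by (auto simp: nonunits_def)
  have one: "\<one> \<in> V" using subringE(3)[OF subring] .
  have "x \<in> F" "y \<in> F" using xy ring_subset by (auto simp: nonunits_def)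
  then consider (left) v where "v \<in> V" "x = y \<otimes> v" | (right) v where "v \<in> V" "y = x \<otimes> v"
    using divides_total unfolding l_coset_mem by blast
  then show "x \<ominus> y \<in> nonunits V"
  proof cases
    case left
    then have "v \<in> carrier R" using ring_carrier by blast
    then have "x \<ominus> y = (v \<ominus> \<one>) \<otimes> y" unfolding left(2) using R by algebra
    then show ?thesis using nonunits_mult[OF subring_minus_closed[OF subring left(1) one] xy(2)] by simp
  next
    case right
    then have "v \<in> carrier R" using ring_carrier by blast
    then have "x \<ominus> y = (\<one> \<ominus> v) \<otimes> x" unfolding right(2) using R by algebra
    then show ?thesis using nonunits_mult[OF subring_minus_closed[OF subring one right(1)] xy(1)] by simp
  qed
qed

lemmas nonunits_subgroup = ideal_inD(1)[OF subring ideal_nonunits]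

lemma nonunits_subset: "nonunits V \<subseteq> V"
  by (auto simp: nonunits_def)

lemma nonunitI: "z \<in> F \<Longrightarrow> z \<noteq> \<zero> \<Longrightarrow> inv z \<notin> V \<Longrightarrow> z \<in> nonunits V"
  using total by (auto simp: nonunits_def)

lemma inv_nonunit_of_notin:
  assumes "z \<in> F" "z \<notin> V"
  shows "inv z \<in> nonunits V"
proof -
  have "z \<noteq> \<zero>" using assms(2) subringE(2)[OF subring] by auto
  then show ?thesis
    using assms total[of z] inv_nonzero(5)[of z] field_carrier by (auto simp: nonunits_def)
qed

lemma ring_of_place_nonunits: "ring_of_place R F (nonunits V) = V"
proof (intro equalityI subsetI)
  fix z assume z: "z \<in> ring_of_place R F (nonunits V)"
  show "z \<in> V"
  proof (rule ccontr)
    assume "z \<notin> V"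
    then show False
      using z inv_nonunit_of_notin[of z] subringE(2)[OF subring] by (auto simp: ring_of_place_def)
  qed
next
  fix z assume z: "z \<in> V"
  have "inv z \<notin> nonunits V" if "z \<noteq> \<zero>"
    using that z inv_nonzero[of z] ring_carrier by (auto simp: nonunits_def)
  then show "z \<in> ring_of_place R F (nonunits V)" using z ring_subset by (auto simp: ring_of_place_def)
qed

lemma maximalideal_nonunits: "maximalideal (nonunits V) (R\<lparr>carrier := V\<rparr>)"
proof (rule maximalidealI[OF ideal_nonunits])
  show "carrier (R\<lparr>carrier := V\<rparr>) \<noteq> nonunits V"
    using one_notin_nonunits subringE(3)[OF subring] by auto
  fix J assume J: "ideal_in J V" "nonunits V \<subseteq> J" "J \<subseteq> carrier (R\<lparr>carrier := V\<rparr>)"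
  show "J = nonunits V \<or> J = carrier (R\<lparr>carrier := V\<rparr>)"
  proof (cases "J \<subseteq> nonunits V")
    case False
    then obtain u where u: "u \<in> J" "u \<in> V" "u \<noteq> \<zero>" "inv u \<in> V"
      using J(3) by (auto simp: nonunits_def)
    then have "inv u \<otimes> u \<in> J" using ideal_inD(3)[OF subring J(1)] by blast
    then have "\<one> \<in> J" using inv_nonzero(4)[of u] u ring_carrier by auto
    then show ?thesis using ideal.one_imp_carrier[OF J(1)] by simp
  qed (use J(2) in blast)
qed

lemma maximalideal_eq_nonunits:
  assumes P: "maximalideal P (R\<lparr>carrier := V\<rparr>)"
  shows "P = nonunits V"
proof -
  interpret P: maximalideal P "R\<lparr>carrier := V\<rparr>" by (rule P)
  have one: "\<one> \<notin> P" using P.I_notcarr P.one_imp_carrier by auto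
  have "P \<subseteq> nonunits V"
  proof
    fix z assume z: "z \<in> P"
    then have zV: "z \<in> V" using P.a_subset by auto
    have "inv z \<notin> V" if "z \<noteq> \<zero>"
    proof
      assume "inv z \<in> V"
      then have "inv z \<otimes> z \<in> P" using P.I_l_closed[OF z] by simp
      then show False using one inv_nonzero(4)[of z] that zV ring_carrier by auto
    qed
    then show "z \<in> nonunits V" using zV by (auto simp: nonunits_def)
  qed
  then show ?thesis
    using P.I_maximal[OF ideal_nonunits] one_notin_nonunits subringE(3)[OF subring] nonunits_subset
    by auto
qed

lemma exists_divisor:
  assumes "as \<noteq> []" "set as \<subseteq> F"
  shows "\<exists>b\<in>set as. set as \<subseteq> b <# V"
  using assms
proof (induction as rule: list_nonempty_induct)
  case (single a)
  then show ?case using l_coset_self[OF subring, of a] field_carrier by auto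
next
  case (cons a as)
  then obtain b where b: "b \<in> set as" "set as \<subseteq> b <# V" by auto
  have F: "a \<in> F" "b \<in> F" and R: "a \<in> carrier R" "b \<in> carrier R"
    using cons b(1) field_carrier by auto
  from divides_total[OF F] show ?case
  proof
    assume "a \<in> b <# V"
    then show ?case using b by auto
  next
    assume "b \<in> a <# V"
    then have "b <# V \<subseteq> a <# V" by (rule l_coset_subset[OF subring R(1)])
    then show ?case using b(2) l_coset_self[OF subring R(1)] by auto
  qed
qed

lemma val_ring_inter_subfield:
  assumes K: "subfield K R" "K \<subseteq> F"
  shows "val_ring R K (V \<inter> K)"
proof (intro val_ring.intro val_ring_axioms.intro field_axioms K(1))
  show "subring (V \<inter> K) R" using subring_inter[OF subring subfieldE(1)[OF K(1)]] .
  show "z \<in> V \<inter> K \<or> inv z \<in> V \<inter> K" if "z \<in> K" "z \<noteq> \<zero>" for z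
    using that total[of z] K(2) subfield_inv(1)[OF K(1) that] by auto
qed simp

lemma meets_nonunits_trivially:
  assumes k: "subfield k R" "k \<subseteq> V" and b: "b \<in> k" "b \<in> nonunits V"
  shows "b = \<zero>"
  using subfield_inv(1)[OF k(1) b(1)] k(2) b(2) by (auto simp: nonunits_def)

definition independent_mod :: "'a set \<Rightarrow> 'a list \<Rightarrow> bool"
  where "independent_mod I Us \<longleftrightarrow>
    (\<forall>as. set as \<subseteq> V \<longrightarrow> length as = length Us \<longrightarrow> combine as Us \<in> I \<longrightarrow> set as \<subseteq> nonunits V)"

lemma independent_mod_imp_independent:
  assumes Us: "set Us \<subseteq> carrier R" "independent_mod I Us" and "\<zero> \<in> I"
  shows "independent F Us"
proof (rule trivial_combine_imp_independent[OF subfield Us(1)], rule ccontr)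
  fix Ks assume Ks: "set Ks \<subseteq> F" "combine Ks Us = \<zero>" "\<not> set (take (length Us) Ks) \<subseteq> {\<zero>}"
  have KsR: "set Ks \<subseteq> carrier R" using Ks(1) field_carrier by (rule subset_trans)
  obtain bs where bs: "set (take (length Us) Ks) \<subseteq> set bs" "set bs \<subseteq> set (take (length Us) Ks) \<union> {\<zero>}"
      "length bs = length Us" "combine bs Us = \<zero>"
    by (rule combine_normalize[OF KsR Us(1) Ks(2)])
  have bsF: "set bs \<subseteq> F"
    using bs(2) Ks(1) subringE(2)[OF field_subring] set_take_subset[of "length Us" Ks] by auto
  obtain c where c: "c \<in> set bs" "c \<noteq> \<zero>" using Ks(3) bs(1) by blast
  then obtain b where b: "b \<in> set bs" "set bs \<subseteq> b <# V" using exists_divisor[of bs] bsF by force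
  have bR: "b \<in> carrier R" using b(1) bsF field_carrier by blast
  have b0: "b \<noteq> \<zero>"
  proof
    assume "b = \<zero>"
    then show False using b(2) c ring_carrier by (auto simp: l_coset_mem subset_iff)
  qed
  note inv_b = inv_nonzero[OF bR b0]
  define cs where "cs = map ((\<otimes>) (inv b)) bs"
  have "set cs \<subseteq> V"
  proof -
    have "inv b \<otimes> x \<in> V" if "x \<in> b <# V" for x
      using that inv_b bR ring_carrier by (auto simp: l_coset_mem m_assoc[symmetric] subset_iff)
    then show ?thesis using b(2) by (auto simp: cs_def)
  qed
  moreover have "combine cs Us = inv b \<otimes> combine bs Us"
    unfolding cs_def using combine_r_distr[of bs Us] bsF field_carrier Us(1) inv_b(1) by auto
  then have "combine cs Us \<in> I" using bs(4) inv_b(1) \<open>\<zero> \<in> I\<close> by simp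
  moreover have "length cs = length Us" using bs(3) by (simp add: cs_def)
  ultimately have "set cs \<subseteq> nonunits V" using Us(2) by (simp add: independent_mod_def)
  moreover have "inv b \<otimes> b \<in> set cs" unfolding cs_def using b(1) by simp
  ultimately show False using inv_b(4) one_notin_nonunits by auto
qed

lemma dependent_mod_imp_span:
  assumes C: "subring C R" "V \<subseteq> C" and I: "ideal_in I C" "nonunits V \<subseteq> I"
    and Us: "set Us \<subseteq> C" "independent_mod I Us" and c: "c \<in> C" "\<not> independent_mod I (c # Us)"
  shows "\<exists>as. set as \<subseteq> V \<and> length as = length Us \<and> c \<ominus> combine as Us \<in> I"
proof -
  note I_facts = ideal_inD[OF C(1) I(1)] and CR = subringE(1)[OF C(1)]
  have UsR: "set Us \<subseteq> carrier R" and cR: "c \<in> carrier R" using Us(1) c(1) CR by auto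
  obtain bs where bs: "set bs \<subseteq> V" "length bs = length (c # Us)" "combine bs (c # Us) \<in> I"
      "\<not> set bs \<subseteq> nonunits V" using c(2) by (auto simp: independent_mod_def)
  obtain a as where eq: "bs = a # as" using bs(2) by (cases bs) auto
  have as: "a \<in> V" "set as \<subseteq> V" "length as = length Us" "a \<otimes> c \<oplus> combine as Us \<in> I"
    using bs eq by auto
  have R: "a \<in> carrier R" "set as \<subseteq> carrier R" "combine as Us \<in> carrier R"
    using as ring_carrier UsR by (auto intro!: combine_in_carrier)
  have "a \<notin> nonunits V"
  proof
    assume a: "a \<in> nonunits V"
    then have "a \<otimes> c \<in> I" using I(2) ideal_in_r_closed[OF C(1) I(1) c(1)] by blast
    then have "(a \<otimes> c \<oplus> combine as Us) \<ominus> a \<otimes> c \<in> I"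
      by (rule additive_subgroup_minus_closed[OF I_facts(1) as(4)])
    moreover have "(a \<otimes> c \<oplus> combine as Us) \<ominus> a \<otimes> c = combine as Us" using R cR by algebra
    ultimately have "set as \<subseteq> nonunits V" using Us(2) as(2,3) by (simp add: independent_mod_def)
    then show False using bs(4) a eq by auto
  qed
  then have a: "a \<noteq> \<zero>" "inv a \<in> V" using as(1) by (auto simp: nonunits_def)
  note inv_a = inv_nonzero[OF R(1) a(1)]
  define ds where "ds = map ((\<otimes>) (\<ominus> (inv a))) as"
  have "combine ds Us = \<ominus> (inv a) \<otimes> combine as Us"
    unfolding ds_def using combine_r_distr[of as Us] R UsR inv_a by auto
  then have "c \<ominus> combine ds Us = inv a \<otimes> (a \<otimes> c \<oplus> combine as Us)"
    using inv_a R cR by (simp add: a_minus_def l_minus r_distr m_assoc[symmetric])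
  moreover have "inv a \<otimes> (a \<otimes> c \<oplus> combine as Us) \<in> I" using I_facts(3) as(4) a(2) C(2) by blast
  moreover have "set ds \<subseteq> V" "length ds = length Us"
    unfolding ds_def using a as subringE(5,6)[OF subring] by (auto simp: subset_iff)
  ultimately show ?thesis by metis
qed

lemma exists_spanning_list:
  assumes C: "subring C R" "V \<subseteq> C" and I: "ideal_in I C" "nonunits V \<subseteq> I"
    and bound: "\<And>Us. set Us \<subseteq> C \<Longrightarrow> independent_mod I Us \<Longrightarrow> length Us \<le> m"
  obtains Us where "set Us \<subseteq> C" "length Us \<le> m"
    "\<And>c. c \<in> C \<Longrightarrow> \<exists>as. set as \<subseteq> V \<and> length as = length Us \<and> c \<ominus> combine as Us \<in> I"
proof -
  let ?indep = "\<lambda>Us. set Us \<subseteq> C \<and> independent_mod I Us"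
  have "?indep []" by (simp add: independent_mod_def)
  moreover have "\<forall>Us. ?indep Us \<longrightarrow> length Us < Suc m" using bound by (simp add: less_Suc_eq_le)
  ultimately obtain Us where Us: "?indep Us" and maximal: "\<And>Vs. ?indep Vs \<Longrightarrow> length Vs \<le> length Us"
    using ex_has_greatest_nat[of ?indep "[]" length "Suc m"] by blast
  have "\<not> independent_mod I (c # Us)" if "c \<in> C" for c using maximal[of "c # Us"] Us that by auto
  then have "\<exists>as. set as \<subseteq> V \<and> length as = length Us \<and> c \<ominus> combine as Us \<in> I" if "c \<in> C" for c
    using dependent_mod_imp_span[OF C I] Us that by blast
  then show ?thesis using that[of Us] Us bound by blast
qed

lemma index_le_dimension:
  assumes t: "t \<in> V" "nonunits V = t <# V" and fin: "finite_index V (nonunits V)"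
    and C: "subring C R" "V \<subseteq> C" "C \<subseteq> E" and dim: "dimension m F E"
  shows "finite_index C (t <# C)" and "index C (t <# C) \<le> index V (nonunits V) ^ m"
proof -
  have tC: "t \<in> C" using t(1) C(2) by blast
  have I: "ideal_in (t <# C) C" using ideal_in_l_coset[OF C(1) tC] .
  have VI: "nonunits V \<subseteq> t <# C" using C(2) unfolding t(2) l_coset_def by blast
  note I_facts = ideal_inD[OF C(1) I] and CR = subringE(1)[OF C(1)]
  have bound: "length Us \<le> m" if Us: "set Us \<subseteq> C" "independent_mod (t <# C) Us" for Us
  proof (rule independent_length_le_dimension[OF subfield dim])
    show "independent F Us"
      using independent_mod_imp_independent[OF _ Us(2)] Us(1) CR
        additive_subgroup.zero_closed[OF I_facts(1)] by blast
    show "set Us \<subseteq> E" using Us(1) C(3) by (rule subset_trans)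
  qed
  obtain Us where Us: "set Us \<subseteq> C" "length Us \<le> m"
      "\<And>c. c \<in> C \<Longrightarrow> \<exists>as. set as \<subseteq> V \<and> length as = length Us \<and> c \<ominus> combine as Us \<in> t <# C"
    using exists_spanning_list[OF C(1,2) I VI bound] by blast
  have UsR: "set Us \<subseteq> carrier R" using Us(1) CR by (rule subset_trans)
  have mult: "a \<otimes> u \<in> t <# C" if "a \<in> nonunits V" "u \<in> set Us" for a u
    using ideal_in_r_closed[OF C(1) I] that Us(1) VI by blast
  note span_bound = index_le_span[OF nonunits_subgroup ring_carrier fin I_facts(1) CR UsR mult Us(3)]
  show "finite_index C (t <# C)" by (rule span_bound(1))
  have "index V (nonunits V) \<noteq> 0" using index_pos[OF fin] t(1) by blast
  then have "index V (nonunits V) ^ length Us \<le> index V (nonunits V) ^ m"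
    using Us(2) by (intro power_increasing) auto
  then show "index C (t <# C) \<le> index V (nonunits V) ^ m" using span_bound(2) by (rule le_trans[rotated])
qed

end

context field
begin

lemma valuation_ring_iff:
  assumes "subfield F R"
  shows "valuation_ring R k F V \<longleftrightarrow> val_ring R F V \<and> k \<subset> V \<and> V \<noteq> F"
  using assms field_axioms
  by (auto simp: valuation_ring_def val_ring_def val_ring_axioms_def)

lemma places_iff:
  assumes F: "subfield F R"
  shows "P \<in> places R k F \<longleftrightarrow> (\<exists>V. valuation_ring R k F V \<and> P = nonunits V)"
  using val_ring.maximalideal_nonunits val_ring.maximalideal_eq_nonunits valuation_ring_iff[OF F]
  unfolding places_def by blast

lemma valuation_ring_of_place:
  assumes F: "subfield F R" and P: "P \<in> places R k F"
  shows "valuation_ring R k F (ring_of_place R F P)" and "P = nonunits (ring_of_place R F P)"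
proof -
  obtain V where V: "valuation_ring R k F V" "P = nonunits V" using P places_iff[OF F] by blast
  then have "ring_of_place R F P = V"
    using val_ring.ring_of_place_nonunits valuation_ring_iff[OF F] by blast
  then show "valuation_ring R k F (ring_of_place R F P)" "P = nonunits (ring_of_place R F P)"
    using V by simp_all
qed

lemma nonunits_antimono:
  assumes V: "val_ring R F V" and W: "val_ring R F W" and sub: "nonunits V \<subseteq> nonunits W"
  shows "W \<subseteq> V"
proof (rule subsetI, rule ccontr)
  interpret W: val_ring R F W by (rule W)
  fix z assume z: "z \<in> W" "z \<notin> V"
  then have "inv z \<in> nonunits W" using val_ring.inv_nonunit_of_notin[OF V] W.ring_subset sub by blast
  moreover have "z \<noteq> \<zero>" using z val_ring.subring[OF V] subringE(2) by blast
  ultimately show False using z(1) inv_nonzero(2,5)[of z] W.ring_carrier by (auto simp: nonunits_def)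
qed

end

section \<open>Discrete places\<close>

context field
begin

abbreviation "\<O> \<equiv> ring_of_place R"
abbreviation "val \<equiv> place_valuation R"

definition residue_order :: "'a set \<Rightarrow> 'a set \<Rightarrow> nat"
  where "residue_order F P = index (\<O> F P) P"

definition val_ge :: "'a set \<Rightarrow> 'a set \<Rightarrow> int \<Rightarrow> 'a set"
  where "val_ge F P n = {z \<in> F. z = \<zero> \<or> n \<le> val F P z}"

lemma int_pow_mult_of:
  assumes "a \<in> carrier R" "a \<noteq> \<zero>"
  shows "a [^]\<^bsub>Multiplicative_Group.mult_of R\<^esub> (n::int) = a [^] n"
proof -
  interpret M: group "Multiplicative_Group.mult_of R" by (rule field_mult_group)
  have nat_pow: "a [^]\<^bsub>Multiplicative_Group.mult_of R\<^esub> (m::nat) = a [^] m" for m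
    by (simp only: Multiplicative_Group.nat_pow_mult_of)
  have pow: "a [^] (m::nat) \<in> carrier (Multiplicative_Group.mult_of R)" for m
    using M.nat_pow_closed[of a m] assms unfolding nat_pow by simp
  show ?thesis unfolding int_pow_def2 nat_pow m_inv_mult_of[OF pow] ..
qed

lemma nonzero_int_pow:
  fixes m n :: int
  assumes a: "a \<in> carrier R" "a \<noteq> \<zero>"
  shows "a [^] n \<in> carrier R" "a [^] n \<noteq> \<zero>"
    and "a [^] (m + n) = a [^] m \<otimes> a [^] n" "a [^] (- n) = inv (a [^] n)"
proof -
  interpret M: group "Multiplicative_Group.mult_of R" by (rule field_mult_group)
  have aM: "a \<in> carrier (Multiplicative_Group.mult_of R)" using a by simp
  have pow: "a [^] j \<in> carrier (Multiplicative_Group.mult_of R)" for j :: int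
    using M.int_pow_closed[OF aM, of j] int_pow_mult_of[OF a] by simp
  then show "a [^] n \<in> carrier R" "a [^] n \<noteq> \<zero>" by auto
  show "a [^] (m + n) = a [^] m \<otimes> a [^] n"
    using M.int_pow_mult[OF aM, of m n] int_pow_mult_of[OF a] by simp
  show "a [^] (- n) = inv (a [^] n)"
    using M.int_pow_neg[OF aM, of n] int_pow_mult_of[OF a] m_inv_mult_of[OF pow] by simp
qed

end

locale discrete_place = val_ring R F "ring_of_place R F P" for R (structure) and F P +
  assumes proper: "ring_of_place R F P \<noteq> F"
    and place_eq: "P = nonunits (ring_of_place R F P)"
    and finite_quotient: "z \<in> ring_of_place R F P \<Longrightarrow> z \<noteq> \<zero> \<Longrightarrow>
      finite_index (ring_of_place R F P) (z <# ring_of_place R F P)"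
begin

lemma place_subset: "P \<subseteq> \<O> F P"
  using nonunits_subset place_eq by simp

lemma place_iff: "z \<in> P \<longleftrightarrow> z \<in> \<O> F P \<and> (z = \<zero> \<or> inv z \<notin> \<O> F P)"
  by (subst place_eq) (simp add: nonunits_def)

lemma ideal_place: "ideal_in P (\<O> F P)"
  using ideal_nonunits place_eq by simp

lemma place_subgroup: "additive_subgroup P R"
  using nonunits_subgroup place_eq by simp

lemma place_mult: "a \<in> \<O> F P \<Longrightarrow> x \<in> P \<Longrightarrow> a \<otimes> x \<in> P"
  by (rule ideal_inD(3)[OF subring ideal_place])

lemma one_notin_place: "\<one> \<notin> P"
  using one_notin_nonunits place_eq by simp

lemma zero_in_place: "\<zero> \<in> P"
  using zero_nonunit place_eq by simp

lemma inv_mem_place: "z \<in> F \<Longrightarrow> z \<notin> \<O> F P \<Longrightarrow> inv z \<in> P"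
  using inv_nonunit_of_notin[of z] place_eq by simp

lemma carrier_subset: "P \<subseteq> carrier R"
  using place_subset ring_carrier by (rule subset_trans)

lemma one_in_field: "\<one> \<in> F"
  using subringE(3)[OF field_subring] .

lemma exists_uniformizer: "\<exists>t\<in>P. t \<noteq> \<zero> \<and> P = t <# \<O> F P"
proof -
  let ?i = "\<lambda>t. index (\<O> F P) (t <# \<O> F P)"
  obtain z where z: "z \<in> F" "z \<notin> \<O> F P" using proper ring_subset by blast
  then have "z \<noteq> \<zero>" using subringE(2)[OF subring] by auto
  then have "inv z \<in> P \<and> inv z \<noteq> \<zero>" using inv_mem_place[OF z] subfield_inv(2)[OF subfield z(1)] by simp
  then obtain t where t: "t \<in> P" "t \<noteq> \<zero>"
    and minimal: "\<And>s. s \<in> P \<and> s \<noteq> \<zero> \<Longrightarrow> ?i t \<le> ?i s"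
    using ex_has_least_nat[of "\<lambda>t. t \<in> P \<and> t \<noteq> \<zero>" "inv z" ?i] by blast
  have coset: "additive_subgroup (s <# \<O> F P) R" "s <# \<O> F P \<subseteq> \<O> F P" if "s \<in> P" for s
    using ideal_inD(1,2)[OF subring ideal_in_l_coset[OF subring]] that place_subset by blast+
  have tO: "t \<in> \<O> F P" "t \<in> F" "t \<in> carrier R"
    using t(1) place_subset ring_subset ring_carrier by auto
  have "P \<subseteq> t <# \<O> F P"
  proof (rule subsetI, rule ccontr)
    fix z assume z: "z \<in> P" "z \<notin> t <# \<O> F P"
    have zF: "z \<in> F" "z \<in> carrier R" using z(1) place_subset ring_subset ring_carrier by auto
    have "t \<in> z <# \<O> F P" using divides_total[OF zF(1) tO(2)] z(2) by blast
    then have sub: "t <# \<O> F P \<subset> z <# \<O> F P"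
      using l_coset_subset[OF subring zF(2)] l_coset_self[OF subring zF(2)] z(2) by blast
    have "z \<noteq> \<zero>" using z(2) additive_subgroup.zero_closed[OF coset(1)[OF t(1)]] by blast
    moreover have "?i z < ?i t"
      using index_less[OF coset(1)[OF t(1)] coset(1)[OF z(1)] subring_additive_subgroup[OF subring]
          sub coset(2)[OF z(1)] finite_quotient[OF tO(1) t(2)]] .
    ultimately show False using minimal[of z] z(1) by simp
  qed
  moreover have "t <# \<O> F P \<subseteq> P"
    using ideal_in_r_closed[OF subring ideal_place _ t(1)] by (auto simp: l_coset_mem)
  ultimately show ?thesis using t by blast
qed

lemma Units_local_ring: "Units (local_ring R F P) = \<O> F P - P"
proof -
  have "u \<notin> P" if "u \<in> \<O> F P" "x \<in> \<O> F P" "x \<otimes> u = \<one>" for u x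
    using place_mult[OF that(2), of u] that(3) one_notin_place by auto
  moreover have "inv u \<in> \<O> F P \<and> u \<otimes> inv u = \<one> \<and> inv u \<otimes> u = \<one>" if "u \<in> \<O> F P" "u \<notin> P" for u
    using inv_nonzero[of u] that ring_carrier place_iff by auto
  ultimately show ?thesis by (auto simp: Units_def)
qed

lemma unitE:
  assumes "u \<in> Units (local_ring R F P)"
  shows "u \<in> \<O> F P" "u \<notin> P" "u \<in> carrier R" "u \<noteq> \<zero>" "inv u \<in> \<O> F P"
  using assms ring_carrier place_iff zero_in_place by (auto simp: Units_local_ring)

lemma unit_mult:
  assumes u: "u \<in> Units (local_ring R F P)" and w: "w \<in> Units (local_ring R F P)"
  shows "u \<otimes> w \<in> Units (local_ring R F P)"
proof -
  have "inv u \<otimes> (u \<otimes> w) = w"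
    using inv_nonzero[OF unitE(3,4)[OF u]] unitE(3)[OF u] unitE(3)[OF w]
    by (simp add: m_assoc[symmetric])
  then have "u \<otimes> w \<notin> P" using place_mult[OF unitE(5)[OF u], of "u \<otimes> w"] unitE(2)[OF w] by auto
  then show ?thesis
    using subringE(6)[OF subring unitE(1)[OF u] unitE(1)[OF w]] by (simp add: Units_local_ring)
qed

lemma unit_inv:
  assumes u: "u \<in> Units (local_ring R F P)"
  shows "inv u \<in> Units (local_ring R F P)"
  using unitE[OF u] inv_nonzero[OF unitE(3,4)[OF u]] place_iff[of "inv u"]
  by (auto simp: Units_local_ring)

lemma unit_int_pow:
  assumes u: "u \<in> Units (local_ring R F P)"
  shows "u [^] (n::int) \<in> Units (local_ring R F P)"
proof -
  have nat_pow: "u [^] (m::nat) \<in> Units (local_ring R F P)" for m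
  proof (induction m)
    case 0
    show ?case using subringE(3)[OF subring] one_notin_place by (simp add: Units_local_ring)
  qed (use unit_mult u in simp)
  show ?thesis
  proof (cases "n < 0")
    case True
    show ?thesis unfolding int_pow_def2 if_P[OF True] by (rule unit_inv[OF nat_pow])
  next
    case False
    show ?thesis unfolding int_pow_def2 if_not_P[OF False] by (rule nat_pow)
  qed
qed

lemma prime_element_iff: "prime_element R F P t \<longleftrightarrow> t \<in> P \<and> P = t <# \<O> F P"
proof -
  have "PIdl\<^bsub>local_ring R F P\<^esub> t = t <# \<O> F P" if "t \<in> P"
  proof -
    have "x \<otimes> t = t \<otimes> x" if "x \<in> \<O> F P" for x
      using that \<open>t \<in> P\<close> carrier_subset ring_carrier by (intro m_comm) auto
    then show ?thesis unfolding cgenideal_def l_coset_def by force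
  qed
  then show ?thesis by (auto simp: prime_element_def)
qed

lemma prime_elementE:
  assumes "prime_element R F P t"
  shows "t \<in> P" "P = t <# \<O> F P" "t \<in> F" "t \<in> \<O> F P" "t \<in> carrier R" "t \<noteq> \<zero>"
proof -
  show t: "t \<in> P" "P = t <# \<O> F P" using assms prime_element_iff by blast+
  then show "t \<in> F" "t \<in> \<O> F P" "t \<in> carrier R" using place_subset ring_subset ring_carrier by blast+
  show "t \<noteq> \<zero>"
  proof
    assume "t = \<zero>"
    obtain s where s: "s \<in> P" "s \<noteq> \<zero>" using exists_uniformizer by blast
    then have "s \<in> t <# \<O> F P" using t(2) by blast
    then show False using s(2) \<open>t = \<zero>\<close> ring_carrier by (auto simp: l_coset_mem subset_iff)
  qed
qed

lemma exists_prime_element: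
  obtains t where "prime_element R F P t"
  using exists_uniformizer prime_element_iff by blast

lemma index_l_coset_prime_mult_less:
  assumes t: "prime_element R F P t" and w: "w \<in> \<O> F P" "w \<noteq> \<zero>"
  shows "index (\<O> F P) (w <# \<O> F P) < index (\<O> F P) (t \<otimes> w <# \<O> F P)"
proof -
  note t_facts = prime_elementE[OF t] and ideal = ideal_inD[OF subring ideal_in_l_coset[OF subring]]
  have wR: "w \<in> carrier R" using w(1) ring_carrier by blast
  have z: "t \<otimes> w \<in> \<O> F P" "t \<otimes> w \<noteq> \<zero>"
    using subringE(6)[OF subring t_facts(4) w(1)] integral[of t w] t_facts(5,6) wR w(2) by auto
  have "t \<otimes> w = w \<otimes> t" using wR t_facts(5) by (simp add: m_comm)
  then have "t \<otimes> w \<in> w <# \<O> F P" using t_facts(4) unfolding l_coset_mem by blast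
  then have "t \<otimes> w <# \<O> F P \<subseteq> w <# \<O> F P" by (rule l_coset_subset[OF subring wR])
  moreover have "w \<notin> t \<otimes> w <# \<O> F P"
  proof
    assume "w \<in> t \<otimes> w <# \<O> F P"
    then obtain a where a: "a \<in> \<O> F P" "w = t \<otimes> w \<otimes> a" by (auto simp: l_coset_mem)
    have aR: "a \<in> carrier R" using a(1) ring_carrier by blast
    have "w \<otimes> \<one> = w \<otimes> (a \<otimes> t)" using a(2) wR aR t_facts(5) by (simp add: m_ac)
    then have "\<one> = a \<otimes> t" using m_lcancel[OF w(2) wR, of \<one> "a \<otimes> t"] aR t_facts(5) by simp
    then show False using place_mult[OF a(1) t_facts(1)] one_notin_place by simp
  qed
  ultimately have "t \<otimes> w <# \<O> F P \<subset> w <# \<O> F P" using l_coset_self[OF subring wR] by blast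
  then show ?thesis
    using index_less[OF ideal(1)[OF z(1)] ideal(1)[OF w(1)] subring_additive_subgroup[OF subring]]
      ideal(2)[OF w(1)] finite_quotient[OF z] by blast
qed

lemma eq_nat_pow_mult_unit:
  assumes t: "prime_element R F P t" and z: "z \<in> \<O> F P" "z \<noteq> \<zero>"
  shows "\<exists>n u. u \<in> Units (local_ring R F P) \<and> z = t [^] (n::nat) \<otimes> u"
  using z
proof (induction "index (\<O> F P) (z <# \<O> F P)" arbitrary: z rule: less_induct)
  case less
  note t_facts = prime_elementE[OF t]
  have zR: "z \<in> carrier R" using less(2) ring_carrier by blast
  show ?case
  proof (cases "z \<in> P")
    case False
    then have "z \<in> Units (local_ring R F P)" using less(2) by (simp add: Units_local_ring)
    moreover have "z = t [^] (0::nat) \<otimes> z" using zR by simp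
    ultimately show ?thesis by blast
  next
    case True
    then obtain w where w: "w \<in> \<O> F P" "z = t \<otimes> w"
      using t_facts(2) unfolding l_coset_def by blast
    have w0: "w \<noteq> \<zero>" using less(3) w(2) t_facts(5) by auto
    have "index (\<O> F P) (w <# \<O> F P) < index (\<O> F P) (z <# \<O> F P)"
      using index_l_coset_prime_mult_less[OF t w(1) w0] unfolding w(2) .
    then obtain n u where u: "u \<in> Units (local_ring R F P)" "w = t [^] (n::nat) \<otimes> u"
      using less(1)[OF _ w(1) w0] by blast
    have "z = t [^] Suc n \<otimes> u" unfolding w(2) u(2) using unitE(3)[OF u(1)] t_facts(5) by (simp add: m_ac)
    then show ?thesis using u(1) by blast
  qed
qed

lemma associated_prime_elements:
  assumes t: "prime_element R F P t" and s: "prime_element R F P s"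
  obtains a where "a \<in> Units (local_ring R F P)" "s = t \<otimes> a"
proof -
  note t_facts = prime_elementE[OF t] and s_facts = prime_elementE[OF s]
  have "s \<in> t <# \<O> F P" "t \<in> s <# \<O> F P" using t_facts(1,2) s_facts(1,2) by auto
  then obtain a b where ab: "a \<in> \<O> F P" "s = t \<otimes> a" "b \<in> \<O> F P" "t = s \<otimes> b"
    by (auto simp: l_coset_mem)
  have R: "a \<in> carrier R" "b \<in> carrier R" using ab ring_carrier by auto
  have "t \<otimes> (a \<otimes> b) = s \<otimes> b" unfolding ab(2) using R t_facts(5) by (simp add: m_assoc)
  then have "t \<otimes> (b \<otimes> a) = t \<otimes> \<one>" using ab(4)[symmetric] R t_facts(5) by (simp add: m_comm)
  then have "b \<otimes> a = \<one>" using m_lcancel[OF t_facts(6,5), of "b \<otimes> a" \<one>] R by simp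
  then have "a \<notin> P" using place_mult[OF ab(3), of a] one_notin_place by auto
  then show ?thesis using that ab(1,2) by (simp add: Units_local_ring)
qed

lemma int_pow_mult_unit_exponent_le:
  fixes i j :: int
  assumes t: "prime_element R F P t" and eq: "t [^] i \<otimes> u = t [^] j \<otimes> w"
    and u: "u \<in> Units (local_ring R F P)" and w: "w \<in> Units (local_ring R F P)"
  shows "j \<le> i"
proof (rule ccontr)
  note t_facts = prime_elementE[OF t] and pow = nonzero_int_pow[OF prime_elementE(5,6)[OF t]]
  assume "\<not> j \<le> i"
  then obtain n where n: "j = i + int (Suc n)" using zless_iff_Suc_zadd[of i j] by auto
  have "t [^] j = t [^] i \<otimes> t [^] Suc n"
    unfolding n pow(3) by (simp only: int_pow_int)
  then have "t [^] i \<otimes> u = t [^] i \<otimes> (t [^] n \<otimes> w \<otimes> t)"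
    using eq pow(1)[of i] t_facts(5) unitE(3)[OF w] by (simp add: m_ac)
  then have "u = t [^] n \<otimes> w \<otimes> t"
    using m_lcancel[OF pow(2,1)[of i], of u "t [^] n \<otimes> w \<otimes> t"] t_facts(5) unitE(3)[OF u] unitE(3)[OF w]
    by simp
  moreover have "t [^] n \<otimes> w \<in> \<O> F P"
    using subringE(6)[OF subring subring_nat_pow_closed[OF subring t_facts(4)] unitE(1)[OF w]] .
  ultimately show False using place_mult[OF _ t_facts(1)] unitE(2)[OF u] by simp
qed

lemma int_pow_mult_unit_exponent_unique:
  fixes n m :: int
  assumes t: "prime_element R F P t" and s: "prime_element R F P s"
    and u: "u \<in> Units (local_ring R F P)" and w: "w \<in> Units (local_ring R F P)"
    and eq: "t [^] n \<otimes> u = s [^] m \<otimes> w"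
  shows "n = m"
proof -
  note t_facts = prime_elementE[OF t] and s_facts = prime_elementE[OF s]
  obtain a where a: "a \<in> Units (local_ring R F P)" "s = t \<otimes> a"
    by (rule associated_prime_elements[OF t s])
  note a_facts = unitE[OF a(1)]
  interpret M: comm_group "Multiplicative_Group.mult_of R"
    using field_mult_group m_comm by (intro group.group_comm_groupI) auto
  have "s [^] m = t [^] m \<otimes> a [^] m"
    using M.int_pow_distrib[of t a m] t_facts s_facts a_facts a(2) int_pow_mult_of by simp
  then have eq': "t [^] n \<otimes> u = t [^] m \<otimes> (a [^] m \<otimes> w)"
    using eq nonzero_int_pow(1)[OF t_facts(5,6)] unitE(3)[OF unit_int_pow[OF a(1)]] unitE(3)[OF w]
    by (simp add: m_assoc)
  have "a [^] m \<otimes> w \<in> Units (local_ring R F P)" using unit_mult unit_int_pow a(1) w by blast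
  then show ?thesis
    using int_pow_mult_unit_exponent_le[OF t eq' u]
      int_pow_mult_unit_exponent_le[OF t eq'[symmetric] _ u] by simp
qed

lemma val_eqI:
  assumes "prime_element R F P t" "u \<in> Units (local_ring R F P)" "z = t [^] (n::int) \<otimes> u"
  shows "val F P z = n"
  unfolding place_valuation_def
proof (rule the_equality)
  show "\<exists>t u. prime_element R F P t \<and> u \<in> Units (local_ring R F P) \<and> z = t [^] n \<otimes> u"
    using assms by blast
  fix m assume "\<exists>t u. prime_element R F P t \<and> u \<in> Units (local_ring R F P) \<and> z = t [^] (m::int) \<otimes> u"
  then show "m = n" using int_pow_mult_unit_exponent_unique assms by metis
qed

lemma eq_int_pow_val_mult_unit:
  assumes t: "prime_element R F P t" and z: "z \<in> F" "z \<noteq> \<zero>"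
  obtains u where "u \<in> Units (local_ring R F P)" "z = t [^] val F P z \<otimes> u"
proof -
  note t_facts = prime_elementE[OF t]
  have "\<exists>(n::int) u. u \<in> Units (local_ring R F P) \<and> z = t [^] n \<otimes> u"
  proof (cases "z \<in> \<O> F P")
    case True
    then show ?thesis using eq_nat_pow_mult_unit[OF t True z(2)] int_pow_int by metis
  next
    case False
    have zR: "z \<in> carrier R" using z(1) field_carrier by blast
    have "inv z \<in> \<O> F P" "inv z \<noteq> \<zero>"
      using inv_mem_place[OF z(1) False] place_subset inv_nonzero(2)[OF zR z(2)] by auto
    then obtain n u where u: "u \<in> Units (local_ring R F P)" "inv z = t [^] int n \<otimes> u"
      using eq_nat_pow_mult_unit[OF t] int_pow_int by metis
    have "z = inv (t [^] int n \<otimes> u)" using u(2) inv_nonzero(5)[OF zR z(2)] by simp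
    also have "\<dots> = t [^] (- int n) \<otimes> inv u"
      using inv_mult_nonzero nonzero_int_pow[OF t_facts(5,6)] unitE(3,4)[OF u(1)] by simp
    finally show ?thesis using unit_inv[OF u(1)] by blast
  qed
  then obtain n :: int and u where "u \<in> Units (local_ring R F P)" "z = t [^] n \<otimes> u" by blast
  then show ?thesis using that val_eqI[OF t] by metis
qed

lemma val_mult:
  assumes z: "z \<in> F" "z \<noteq> \<zero>" and y: "y \<in> F" "y \<noteq> \<zero>"
  shows "val F P (z \<otimes> y) = val F P z + val F P y"
proof -
  obtain t where t: "prime_element R F P t" by (rule exists_prime_element)
  note pow = nonzero_int_pow[OF prime_elementE(5,6)[OF t]]
  obtain u where u: "u \<in> Units (local_ring R F P)" "z = t [^] val F P z \<otimes> u"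
    by (rule eq_int_pow_val_mult_unit[OF t z])
  obtain w where w: "w \<in> Units (local_ring R F P)" "y = t [^] val F P y \<otimes> w"
    by (rule eq_int_pow_val_mult_unit[OF t y])
  define n m where "n = val F P z" and "m = val F P y"
  have "z \<otimes> y = (t [^] n \<otimes> u) \<otimes> (t [^] m \<otimes> w)" using u(2) w(2) by (simp add: n_def m_def)
  also have "\<dots> = t [^] (n + m) \<otimes> (u \<otimes> w)"
    using pow(1,3) unitE(3)[OF u(1)] unitE(3)[OF w(1)] by (simp add: m_ac)
  finally show ?thesis using val_eqI[OF t unit_mult[OF u(1) w(1)]] by (simp add: n_def m_def)
qed

lemma val_one: "val F P \<one> = 0"
  using val_mult[of \<one> \<one>] one_in_field by simp

lemma val_inv:
  assumes "z \<in> F" "z \<noteq> \<zero>"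
  shows "val F P (inv z) = - val F P z"
  using val_mult[OF assms, of "inv z"] subfield_inv[OF subfield assms] val_one by simp

lemma val_prime_element:
  assumes t: "prime_element R F P t"
  shows "val F P t = 1"
proof (rule val_eqI[OF t])
  show "\<one> \<in> Units (local_ring R F P)"
    using subringE(3)[OF subring] one_notin_place by (simp add: Units_local_ring)
  show "t = t [^] (1::int) \<otimes> \<one>" using prime_elementE(5)[OF t] int_pow_int[of R t 1] by simp
qed

lemma mult_nonzero:
  assumes "z \<in> F" "z \<noteq> \<zero>" "y \<in> F" "y \<noteq> \<zero>"
  shows "z \<otimes> y \<in> F" "z \<otimes> y \<noteq> \<zero>"
  using assms subringE(6)[OF field_subring] integral[of z y] field_carrier by auto

lemma val_nat_pow:
  assumes z: "z \<in> F" "z \<noteq> \<zero>"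
  shows "z [^] (n::nat) \<in> F" "z [^] n \<noteq> \<zero>" "val F P (z [^] n) = int n * val F P z"
proof -
  have "z [^] n \<in> F \<and> z [^] n \<noteq> \<zero> \<and> val F P (z [^] n) = int n * val F P z"
  proof (induction n)
    case (Suc n)
    then have "val F P (z [^] n \<otimes> z) = int n * val F P z + val F P z" using val_mult z by simp
    then show ?case using Suc mult_nonzero z by (simp add: distrib_right)
  qed (simp add: val_one one_in_field)
  then show "z [^] n \<in> F" "z [^] n \<noteq> \<zero>" "val F P (z [^] n) = int n * val F P z" by auto
qed

lemma val_int_pow:
  assumes z: "z \<in> F" "z \<noteq> \<zero>"
  shows "z [^] (n::int) \<in> F" "z [^] n \<noteq> \<zero>" "val F P (z [^] n) = n * val F P z"
proof -
  have zR: "z \<in> carrier R" using z(1) field_carrier by blast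
  have "z [^] n \<in> F \<and> z [^] n \<noteq> \<zero> \<and> val F P (z [^] n) = n * val F P z"
  proof (cases n)
    case (nonneg m)
    then have "z [^] n = z [^] m" by (simp only: int_pow_int)
    then show ?thesis using val_nat_pow[OF z, of m] nonneg by simp
  next
    case (neg m)
    note pow = val_nat_pow[OF z, of "Suc m"]
    have eq: "z [^] n = inv (z [^] Suc m)"
      unfolding neg nonzero_int_pow(4)[OF zR z(2)] int_pow_int ..
    have "val F P (z [^] n) = - (int (Suc m) * val F P z)"
      unfolding eq val_inv[OF pow(1,2)] pow(3) ..
    also have "\<dots> = n * val F P z" unfolding neg by (simp only: mult_minus_left)
    finally have "val F P (z [^] n) = n * val F P z" .
    moreover have "z [^] n \<in> F" "z [^] n \<noteq> \<zero>"
      unfolding eq using subfield_inv(1,2)[OF subfield pow(1,2)] by blast+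
    ultimately show ?thesis by blast
  qed
  then show "z [^] n \<in> F" "z [^] n \<noteq> \<zero>" "val F P (z [^] n) = n * val F P z" by auto
qed

lemma exists_val:
  obtains z where "z \<in> F" "z \<noteq> \<zero>" "val F P z = n"
proof -
  obtain t where t: "prime_element R F P t" by (rule exists_prime_element)
  show ?thesis
    using that[of "t [^] n"] val_int_pow[OF prime_elementE(3,6)[OF t]] val_prime_element[OF t] by simp
qed

lemma ring_iff_val_nonneg:
  assumes z: "z \<in> F" "z \<noteq> \<zero>"
  shows "z \<in> \<O> F P \<longleftrightarrow> 0 \<le> val F P z"
proof -
  obtain t where t: "prime_element R F P t" by (rule exists_prime_element)
  show ?thesis
  proof
    assume "z \<in> \<O> F P"
    then obtain n u where "u \<in> Units (local_ring R F P)" "z = t [^] int n \<otimes> u"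
      using eq_nat_pow_mult_unit[OF t _ z(2)] int_pow_int by metis
    then show "0 \<le> val F P z" using val_eqI[OF t] by simp
  next
    assume "0 \<le> val F P z"
    then obtain n where n: "val F P z = int n" by (metis nonneg_int_cases)
    obtain u where u: "u \<in> Units (local_ring R F P)" "z = t [^] val F P z \<otimes> u"
      by (rule eq_int_pow_val_mult_unit[OF t z])
    have "t [^] n \<in> \<O> F P" using subring_nat_pow_closed[OF subring prime_elementE(4)[OF t]] .
    then show "z \<in> \<O> F P"
      using u(2) subringE(6)[OF subring _ unitE(1)[OF u(1)]] unfolding n int_pow_int by simp
  qed
qed

lemma place_iff_val_pos:
  assumes z: "z \<in> F" "z \<noteq> \<zero>"
  shows "z \<in> P \<longleftrightarrow> 1 \<le> val F P z"
  using place_iff[of z] ring_iff_val_nonneg[OF z] ring_iff_val_nonneg[of "inv z"]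
    subfield_inv[OF subfield z] val_inv[OF z] z(2) by auto

lemma val_ge_carrier: "val_ge F P n \<subseteq> carrier R"
  using field_carrier by (auto simp: val_ge_def)

lemma val_ge_antimono: "n \<le> m \<Longrightarrow> val_ge F P m \<subseteq> val_ge F P n"
  by (auto simp: val_ge_def)

lemma val_ge_0: "val_ge F P 0 = \<O> F P"
  using ring_iff_val_nonneg ring_subset subringE(2)[OF subring] subringE(2)[OF field_subring]
  by (auto simp: val_ge_def)

lemma val_ge_1: "val_ge F P 1 = P"
  using place_iff_val_pos place_subset ring_subset zero_in_place subringE(2)[OF field_subring]
  by (auto simp: val_ge_def)

lemma val_ge_mult:
  assumes x: "x \<in> val_ge F P n" and y: "y \<in> val_ge F P m"
  shows "x \<otimes> y \<in> val_ge F P (n + m)"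
proof (cases "x = \<zero> \<or> y = \<zero>")
  case True
  moreover have "x \<in> carrier R" "y \<in> carrier R" using x y val_ge_carrier by blast+
  ultimately have "x \<otimes> y = \<zero>" by auto
  then show ?thesis using subringE(2)[OF field_subring] by (simp add: val_ge_def)
next
  case False
  then show ?thesis using x y val_mult[of x y] mult_nonzero[of x y] by (auto simp: val_ge_def)
qed

lemma l_coset_val_ge:
  assumes s: "s \<in> F" "s \<noteq> \<zero>"
  shows "s <# val_ge F P n = val_ge F P (val F P s + n)"
proof (intro equalityI subsetI)
  have s_mem: "s \<in> val_ge F P (val F P s)" using s by (simp add: val_ge_def)
  fix x
  show "x \<in> val_ge F P (val F P s + n)" if "x \<in> s <# val_ge F P n"
    using that val_ge_mult[OF s_mem] by (auto simp: l_coset_mem)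
  assume x: "x \<in> val_ge F P (val F P s + n)"
  note inv_s = subfield_inv[OF subfield s]
  have "inv s \<in> val_ge F P (- val F P s)" using inv_s val_inv[OF s] by (simp add: val_ge_def)
  then have "inv s \<otimes> x \<in> val_ge F P n" using val_ge_mult[OF _ x] by fastforce
  moreover have "x = s \<otimes> (inv s \<otimes> x)"
    using inv_s x s field_carrier val_ge_carrier by (simp add: m_assoc[symmetric] subset_iff)
  ultimately show "x \<in> s <# val_ge F P n" unfolding l_coset_mem by blast
qed

lemma val_ge_subgroup: "additive_subgroup (val_ge F P n) R"
proof -
  obtain s where s: "s \<in> F" "s \<noteq> \<zero>" "val F P s = n" by (rule exists_val)
  then have "val_ge F P n = s <# \<O> F P" using l_coset_val_ge[of s 0] val_ge_0 by simp
  then show ?thesis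
    using additive_subgroup_l_coset[OF subring_additive_subgroup[OF subring]] s(1) field_carrier by auto
qed

lemmas val_ge_zero = additive_subgroup.zero_closed[OF val_ge_subgroup]
lemmas val_ge_add = additive_subgroup.a_closed[OF val_ge_subgroup]
lemmas val_ge_minus = additive_subgroup_minus_closed[OF val_ge_subgroup]

lemma index_val_ge:
  "finite_index (\<O> F P) (val_ge F P (int n))"
  "index (\<O> F P) (val_ge F P (int n)) = residue_order F P ^ n"
proof -
  note O = subring_additive_subgroup[OF subring]
  obtain t where t: "prime_element R F P t" by (rule exists_prime_element)
  note t_facts = prime_elementE[OF t]
  have "finite_index (\<O> F P) (val_ge F P (int n)) \<and>
    index (\<O> F P) (val_ge F P (int n)) = residue_order F P ^ n"
  proof (induction n)
    case 0
    then show ?case using index_self[OF O] val_ge_0 by simp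
  next
    case (Suc n)
    have sub: "val_ge F P (int n) \<subseteq> \<O> F P" "val_ge F P (int (Suc n)) \<subseteq> P"
      using val_ge_antimono[of 0 "int n"] val_ge_antimono[of 1 "int (Suc n)"] val_ge_0 val_ge_1 by auto
    have coset: "t <# \<O> F P = P" "t <# val_ge F P (int n) = val_ge F P (int (Suc n))"
      using t_facts(2) l_coset_val_ge[OF t_facts(3,6), of "int n"] val_prime_element[OF t] by auto
    have step: "finite_index P (val_ge F P (int (Suc n)))"
      "index P (val_ge F P (int (Suc n))) = residue_order F P ^ n"
      using index_l_coset[OF val_ge_subgroup[of "int n"] O _ t_facts(5,6)] Suc unfolding coset by auto
    have fin: "finite_index (\<O> F P) P"
      using finite_quotient[OF t_facts(4,6)] unfolding coset(1) .
    show ?case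
      using index_tower[OF val_ge_subgroup place_subgroup O sub(2) place_subset fin step(1)] step(2)
      by (simp add: residue_order_def)
  qed
  then show "finite_index (\<O> F P) (val_ge F P (int n))"
    "index (\<O> F P) (val_ge F P (int n)) = residue_order F P ^ n" by auto
qed

lemma finite_index_place: "finite_index (\<O> F P) P"
  using index_val_ge(1)[of 1] val_ge_1 by simp

lemma val_add_dominant:
  assumes z: "z \<in> F" "z \<noteq> \<zero>" and y: "y \<in> val_ge F P (val F P z + 1)"
  shows "z \<oplus> y \<noteq> \<zero>" "val F P (z \<oplus> y) = val F P z"
proof -
  let ?n = "val F P z"
  have R: "z \<in> carrier R" "y \<in> carrier R" using z y field_carrier val_ge_carrier by auto
  have z_mem: "z \<notin> val_ge F P (?n + 1)" "z \<in> val_ge F P ?n" using z by (auto simp: val_ge_def)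
  have sum_notin: "z \<oplus> y \<notin> val_ge F P (?n + 1)"
  proof
    assume "z \<oplus> y \<in> val_ge F P (?n + 1)"
    then have "(z \<oplus> y) \<ominus> y \<in> val_ge F P (?n + 1)" using val_ge_minus y by blast
    moreover have "(z \<oplus> y) \<ominus> y = z" using R by algebra
    ultimately show False using z_mem by simp
  qed
  have sum_in: "z \<oplus> y \<in> val_ge F P ?n"
    using val_ge_add[OF z_mem(2)] y val_ge_antimono[of ?n "?n + 1"] by auto
  show "z \<oplus> y \<noteq> \<zero>" using sum_notin val_ge_zero by metis
  then show "val F P (z \<oplus> y) = ?n" using sum_notin sum_in by (auto simp: val_ge_def)
qed

lemma val_add_less:
  assumes "z \<in> F" "z \<noteq> \<zero>" "y \<in> F" "val F P z < val F P y"
  shows "z \<oplus> y \<noteq> \<zero>" "val F P (z \<oplus> y) = val F P z"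
  using val_add_dominant[OF assms(1,2), of y] assms(3,4) by (auto simp: val_ge_def)

lemma val_add_nat_pow_negative:
  assumes y: "y \<in> F" "y \<noteq> \<zero>" and z: "z \<in> F" "z \<noteq> \<zero>" and r: "0 < r" "- int r < val F P y"
    and "val F P y < 0 \<or> val F P z < 0"
  shows "y \<oplus> z [^] r \<noteq> \<zero>" "val F P (y \<oplus> z [^] r) < 0"
proof -
  note pow = val_nat_pow[OF z, of r]
  have comm: "y \<oplus> z [^] r = z [^] r \<oplus> y" using y(1) pow(1) field_carrier by (intro a_comm) auto
  have "y \<oplus> z [^] r \<noteq> \<zero> \<and> val F P (y \<oplus> z [^] r) < 0"
  proof (cases "val F P z < 0")
    case True
    then have "int r * val F P z \<le> int r * (- 1)" by (intro mult_left_mono) auto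
    then have "val F P (z [^] r) < val F P y" "val F P (z [^] r) < 0" using r pow(3) by linarith+
    then show ?thesis using val_add_less[OF pow(1,2) y(1)] comm by simp
  next
    case False
    then have "0 \<le> val F P (z [^] r)" unfolding pow(3) by (intro mult_nonneg_nonneg) auto
    then have "val F P y < 0 \<and> val F P y < val F P (z [^] r)" using False assms(7) by simp
    then show ?thesis using val_add_less[OF y pow(1)] by simp
  qed
  then show "y \<oplus> z [^] r \<noteq> \<zero>" "val F P (y \<oplus> z [^] r) < 0" by auto
qed

lemma maximal:
  assumes W: "val_ring R F W" "\<O> F P \<subseteq> W" "W \<noteq> F"
  shows "W = \<O> F P"
proof (rule ccontr)
  interpret W: val_ring R F W by (rule W(1))
  assume "W \<noteq> \<O> F P"
  then obtain z where z: "z \<in> W" "z \<notin> \<O> F P" using W(2) by blast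
  have zF: "z \<in> F" "z \<noteq> \<zero>" using z W.ring_subset subringE(2)[OF subring] by auto
  have val_z: "val F P z \<le> - 1" using ring_iff_val_nonneg[OF zF] z(2) by simp
  have "y \<in> W" if y: "y \<in> F" "y \<noteq> \<zero>" for y
  proof -
    define n where "n = nat \<bar>val F P y\<bar>"
    note pow = val_nat_pow[OF zF, of n]
    note inv_pow = subfield_inv[OF subfield pow(1,2)]
    have "int n * val F P z \<le> int n * (- 1)" using val_z by (intro mult_left_mono) auto
    then have "0 \<le> val F P (y \<otimes> inv (z [^] n))"
      using val_mult[OF y inv_pow(1,2)] val_inv[OF pow(1,2)] pow(3) by (simp add: n_def)
    then have "y \<otimes> inv (z [^] n) \<in> W"
      using ring_iff_val_nonneg mult_nonzero[OF y inv_pow(1,2)] W(2) by blast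
    then have "y \<otimes> inv (z [^] n) \<otimes> z [^] n \<in> W"
      using subringE(6)[OF W.subring] subring_nat_pow_closed[OF W.subring z(1)] by blast
    moreover have "y \<otimes> inv (z [^] n) \<otimes> z [^] n = y"
      using y(1) pow(1) inv_pow field_carrier by (simp add: m_assoc subset_iff)
    ultimately show ?thesis by simp
  qed
  then have "F \<subseteq> W" using subringE(2)[OF W.subring] by blast
  then show False using W(3) W.ring_subset by blast
qed

end

section \<open>Approximation\<close>

context field
begin

lemma distinct_places_separated:
  assumes "discrete_place R E P" "discrete_place R E Q" "P \<noteq> Q"
  obtains z where "z \<in> E" "z \<noteq> \<zero>" "0 < val E P z" "val E Q z < 0"
proof -
  interpret P: discrete_place R E P by fact
  interpret Q: discrete_place R E Q by fact
  have "\<O> E P \<noteq> \<O> E Q" using \<open>P \<noteq> Q\<close> P.place_eq Q.place_eq by metis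
  then have "\<not> \<O> E P \<subseteq> \<O> E Q" "\<not> \<O> E Q \<subseteq> \<O> E P"
    using P.maximal[OF Q.val_ring_axioms] Q.maximal[OF P.val_ring_axioms] P.proper Q.proper by auto
  then obtain a b where ab: "a \<in> \<O> E P" "a \<notin> \<O> E Q" "b \<in> \<O> E Q" "b \<notin> \<O> E P" by blast
  have a: "a \<in> E" "a \<noteq> \<zero>" and b: "b \<in> E" "b \<noteq> \<zero>"
    using ab P.ring_subset Q.ring_subset subringE(2)[OF P.subring] subringE(2)[OF Q.subring] by auto
  note inv_b = subfield_inv[OF P.subfield b]
  show ?thesis
  proof (rule that[of "a \<otimes> inv b"])
    show "a \<otimes> inv b \<in> E" "a \<otimes> inv b \<noteq> \<zero>" using P.mult_nonzero[OF a inv_b(1,2)] by auto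
    show "0 < val E P (a \<otimes> inv b)"
      using P.val_mult[OF a inv_b(1,2)] P.val_inv[OF b] P.ring_iff_val_nonneg[OF a]
        P.ring_iff_val_nonneg[OF b] ab by simp
    show "val E Q (a \<otimes> inv b) < 0"
      using Q.val_mult[OF a inv_b(1,2)] Q.val_inv[OF b] Q.ring_iff_val_nonneg[OF a]
        Q.ring_iff_val_nonneg[OF b] ab by simp
  qed
qed

lemma exists_positive_negative:
  assumes "discrete_place R E P" and "finite S" "\<And>Q. Q \<in> S \<Longrightarrow> discrete_place R E Q \<and> Q \<noteq> P"
  shows "\<exists>u\<in>E. u \<noteq> \<zero> \<and> 0 < val E P u \<and> (\<forall>Q\<in>S. val E Q u < 0)"
  using assms(2,3)
proof (induction S rule: finite_induct)
  case empty
  interpret P: discrete_place R E P by fact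
  obtain t where "t \<in> E" "t \<noteq> \<zero>" "val E P t = 1" by (rule P.exists_val)
  then show ?case by auto
next
  case (insert Q S)
  interpret P: discrete_place R E P by fact
  obtain y where y: "y \<in> E" "y \<noteq> \<zero>" "0 < val E P y" "\<And>T. T \<in> S \<Longrightarrow> val E T y < 0"
    using insert by auto
  obtain z where z: "z \<in> E" "z \<noteq> \<zero>" "0 < val E P z" "val E Q z < 0"
    using distinct_places_separated[of E P Q] insert(4)[of Q] assms(1) by auto
  have "finite ((\<lambda>T. nat \<bar>val E T y\<bar>) ` insert Q S)" using insert(1) by simp
  then obtain r where "\<forall>n\<in>(\<lambda>T. nat \<bar>val E T y\<bar>) ` insert Q S. n < r"
    unfolding finite_nat_set_iff_bounded by blast
  then have r: "- int r < val E T y" "0 < r" if "T \<in> insert Q S" for T using that by force+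
  have negative: "y \<oplus> z [^] r \<noteq> \<zero> \<and> val E T (y \<oplus> z [^] r) < 0"
    if T: "T \<in> insert Q S" and "val E T y < 0 \<or> val E T z < 0" for T
  proof -
    interpret T: discrete_place R E T using insert(4) T by blast
    show ?thesis using T.val_add_nat_pow_negative[OF y(1,2) z(1,2) r(2,1)[OF T] that(2)] by blast
  qed
  show ?case
  proof (cases "val E Q y < 0")
    case True
    then show ?thesis using y by auto
  next
    case False
    have "0 < int r * val E P z" using r(2) z(3) by (intro mult_pos_pos) auto
    then have "y \<in> val_ge E P 1" "z [^] r \<in> val_ge E P 1"
      using y(1,3) P.val_nat_pow[OF z(1,2), of r] by (auto simp: val_ge_def)
    then have "y \<oplus> z [^] r \<in> val_ge E P 1" by (rule P.val_ge_add)
    moreover have "y \<oplus> z [^] r \<noteq> \<zero> \<and> (\<forall>T\<in>insert Q S. val E T (y \<oplus> z [^] r) < 0)"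
      using negative y(4) z(4) by auto
    ultimately show ?thesis by (auto simp: val_ge_def)
  qed
qed

lemma exists_approximate_idempotent:
  assumes "discrete_place R E P" and S: "finite S" "\<And>Q. Q \<in> S \<Longrightarrow> discrete_place R E Q \<and> Q \<noteq> P"
  shows "\<exists>w\<in>E. w \<ominus> \<one> \<in> val_ge E P n \<and> (\<forall>Q\<in>S. w \<in> val_ge E Q n)"
proof -
  interpret P: discrete_place R E P by fact
  obtain u where u: "u \<in> E" "u \<noteq> \<zero>" "0 < val E P u" "\<And>Q. Q \<in> S \<Longrightarrow> val E Q u < 0"
    using exists_positive_negative[OF assms(1) S] by blast
  define r where "r = Suc (nat n)"
  have r: "1 \<le> r" "n \<le> int r" by (auto simp: r_def)
  have pow: "u [^] r \<in> E" "u [^] r \<noteq> \<zero>" using P.val_nat_pow[OF u(1,2)] by auto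
  have pow_P: "int r \<le> val E P (u [^] r)"
    using P.val_nat_pow(3)[OF u(1,2), of r] u(3) mult_left_mono[of 1 "val E P u" "int r"] by simp
  let ?c = "\<one> \<oplus> u [^] r"
  have c0: "?c \<noteq> \<zero>" and val_P: "val E P ?c = 0"
    using P.val_add_less[OF P.one_in_field one_not_zero pow(1)] pow_P r(1) P.val_one by auto
  have cE: "?c \<in> E" using subringE(7)[OF P.field_subring P.one_in_field pow(1)] .
  note inv_c = subfield_inv[OF P.subfield cE c0]
  have R: "u [^] r \<in> carrier R" "inv ?c \<in> carrier R" using pow(1) inv_c(1) P.field_carrier by auto
  have "inv ?c \<in> val_ge E P 0" using inv_c P.val_inv[OF cE c0] val_P by (simp add: val_ge_def)
  moreover have "u [^] r \<in> val_ge E P n" using pow pow_P r(2) by (simp add: val_ge_def)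
  ultimately have "u [^] r \<otimes> inv ?c \<in> val_ge E P n" using P.val_ge_mult[of "u [^] r" n _ 0] by simp
  then have "\<ominus> (u [^] r \<otimes> inv ?c) \<in> val_ge E P n"
    by (rule additive_subgroup.a_inv_closed[OF P.val_ge_subgroup])
  moreover have "inv ?c \<ominus> \<one> = \<ominus> (u [^] r \<otimes> inv ?c)"
  proof -
    have "inv ?c \<ominus> ?c \<otimes> inv ?c = \<ominus> (u [^] r \<otimes> inv ?c)" using R by algebra
    then show ?thesis using inv_c(3) by simp
  qed
  moreover have "inv ?c \<in> val_ge E Q n" if Q: "Q \<in> S" for Q
  proof -
    interpret Q: discrete_place R E Q using S(2) Q by blast
    have pow_Q: "val E Q (u [^] r) \<le> - int r"
      using Q.val_nat_pow(3)[OF u(1,2), of r] u(4)[OF Q] mult_left_mono[of "val E Q u" "- 1" "int r"]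
      by simp
    then have "val E Q (u [^] r \<oplus> \<one>) = val E Q (u [^] r)"
      using Q.val_add_less[OF pow P.one_in_field] Q.val_one r(1) by simp
    moreover have "u [^] r \<oplus> \<one> = ?c" using R by (simp add: a_comm)
    ultimately show ?thesis using Q.val_inv[OF cE c0] pow_Q r(2) inv_c(1) by (simp add: val_ge_def)
  qed
  ultimately show ?thesis using inv_c(1) by (intro bexI[of _ "inv ?c"]) auto
qed

lemma exists_common_val_bound:
  assumes "finite S" and g: "\<And>Q. Q \<in> S \<Longrightarrow> g Q \<in> E"
  obtains N where "\<And>Q T. Q \<in> S \<Longrightarrow> T \<in> S \<Longrightarrow> g Q \<in> val_ge E T (- int N)"
proof -
  have "finite ((\<lambda>(Q, T). nat \<bar>val E T (g Q)\<bar>) ` (S \<times> S))" using assms(1) by simp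
  then obtain N where "\<forall>n\<in>(\<lambda>(Q, T). nat \<bar>val E T (g Q)\<bar>) ` (S \<times> S). n < N"
    unfolding finite_nat_set_iff_bounded by blast
  then have "- int N \<le> val E T (g Q)" if "Q \<in> S" "T \<in> S" for Q T using that by force
  then show ?thesis using that[of N] g by (simp add: val_ge_def)
qed

theorem weak_approximation:
  assumes S: "finite S" "\<And>Q. Q \<in> S \<Longrightarrow> discrete_place R E Q" and E: "subfield E R"
    and g: "\<And>Q. Q \<in> S \<Longrightarrow> g Q \<in> E"
  shows "\<exists>c\<in>E. \<forall>Q\<in>S. c \<ominus> g Q \<in> val_ge E Q n"
proof -
  note Er = subfieldE(1)[OF E] and ER = subfieldE(3)[OF E]
  obtain N where N: "\<And>Q T. Q \<in> S \<Longrightarrow> T \<in> S \<Longrightarrow> g Q \<in> val_ge E T (- int N)"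
    using exists_common_val_bound[of S g E, OF S(1) g] by blast
  have "\<forall>Q\<in>S. \<exists>w\<in>E. w \<ominus> \<one> \<in> val_ge E Q (n + int N) \<and> (\<forall>T\<in>S - {Q}. w \<in> val_ge E T (n + int N))"
    using exists_approximate_idempotent[of E _ "S - {_}"] S by auto
  then obtain w where w: "\<And>Q. Q \<in> S \<Longrightarrow> w Q \<in> E" "\<And>Q. Q \<in> S \<Longrightarrow> w Q \<ominus> \<one> \<in> val_ge E Q (n + int N)"
      "\<And>Q T. Q \<in> S \<Longrightarrow> T \<in> S \<Longrightarrow> T \<noteq> Q \<Longrightarrow> w Q \<in> val_ge E T (n + int N)" by (metis DiffI singletonD)
  let ?c = "\<Oplus>Q\<in>S. w Q \<otimes> g Q"
  have wgE: "w Q \<otimes> g Q \<in> E" if "Q \<in> S" for Q using subringE(6)[OF Er w(1) g] that by blast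
  have "?c \<ominus> g T \<in> val_ge E T n" if T: "T \<in> S" for T
  proof -
    interpret T: discrete_place R E T using S(2) T by blast
    have R: "w T \<in> carrier R" "g T \<in> carrier R" using w(1) g T ER by auto
    have others: "(\<Oplus>Q\<in>S - {T}. w Q \<otimes> g Q) \<in> val_ge E T n" (is "?s \<in> _")
    proof (rule additive_subgroup_finsum_closed[OF T.val_ge_subgroup])
      fix Q assume "Q \<in> S - {T}"
      then have Q: "Q \<in> S" "T \<noteq> Q" by auto
      show "w Q \<otimes> g Q \<in> val_ge E T n"
        using T.val_ge_mult[OF w(3)[OF Q(1) T Q(2)] N[OF Q(1) T]] by simp
    qed
    have sR: "?s \<in> carrier R" using others T.val_ge_carrier by blast
    have "?c = w T \<otimes> g T \<oplus> ?s"
    proof -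
      have "(\<Oplus>Q\<in>insert T (S - {T}). w Q \<otimes> g Q) = w T \<otimes> g T \<oplus> ?s"
        using S(1) R wgE ER by (intro finsum_insert) auto
      then show ?thesis using T by (simp add: insert_absorb)
    qed
    moreover have "(w T \<otimes> g T \<oplus> s) \<ominus> g T = (w T \<ominus> \<one>) \<otimes> g T \<oplus> s" if "s \<in> carrier R" for s
      using R that by algebra
    ultimately have "?c \<ominus> g T = (w T \<ominus> \<one>) \<otimes> g T \<oplus> ?s" using sR by simp
    moreover have "(w T \<ominus> \<one>) \<otimes> g T \<in> val_ge E T n" using T.val_ge_mult[OF w(2) N] T by simp
    ultimately show ?thesis using T.val_ge_add others by simp
  qed
  moreover have "?c \<in> E" using additive_subgroup_finsum_closed[OF subring_additive_subgroup[OF Er] wgE] .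
  ultimately show ?thesis by blast
qed

definition semilocal_ring :: "'a set \<Rightarrow> 'a set set \<Rightarrow> 'a set"
  where "semilocal_ring E S = {z \<in> E. \<forall>Q\<in>S. z \<in> \<O> E Q}"

lemma subring_semilocal_ring:
  assumes S: "\<And>Q. Q \<in> S \<Longrightarrow> discrete_place R E Q" and E: "subfield E R"
  shows "subring (semilocal_ring E S) R"
proof -
  have "subring (\<O> E Q) R" if "Q \<in> S" for Q
  proof -
    interpret Q: discrete_place R E Q by (rule S[OF that])
    show ?thesis by (rule Q.subring)
  qed
  then have "subring (\<Inter>(insert E (\<O> E ` S))) R" using subfieldE(1)[OF E] by (intro subring_Inter) auto
  moreover have "semilocal_ring E S = \<Inter>(insert E (\<O> E ` S))" by (auto simp: semilocal_ring_def)
  ultimately show ?thesis by simp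
qed

lemma semilocal_approximation:
  assumes S: "finite S" "\<And>Q. Q \<in> S \<Longrightarrow> discrete_place R E Q" and E: "subfield E R"
    and g: "\<And>Q. Q \<in> S \<Longrightarrow> g Q \<in> \<O> E Q"
  shows "\<exists>c\<in>semilocal_ring E S. \<forall>Q\<in>S. c \<ominus> g Q \<in> val_ge E Q (int (e Q))"
proof -
  define n where "n = (\<Sum>Q\<in>S. int (e Q))"
  have n: "0 \<le> n" "int (e Q) \<le> n" if "Q \<in> S" for Q
    using that S(1) by (auto simp: n_def intro: sum_nonneg member_le_sum)
  have gE: "g Q \<in> E" if "Q \<in> S" for Q using g[OF that] by (simp add: ring_of_place_def)
  obtain c where c: "c \<in> E" "\<And>Q. Q \<in> S \<Longrightarrow> c \<ominus> g Q \<in> val_ge E Q n"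
    using weak_approximation[OF S E, of g n] gE by blast
  have "c \<in> \<O> E Q \<and> c \<ominus> g Q \<in> val_ge E Q (int (e Q))" if Q: "Q \<in> S" for Q
  proof -
    interpret Q: discrete_place R E Q by (rule S(2)[OF Q])
    have near: "c \<ominus> g Q \<in> val_ge E Q (int (e Q))" "c \<ominus> g Q \<in> val_ge E Q 0"
      using c(2)[OF Q] Q.val_ge_antimono n[OF Q] by blast+
    have "(c \<ominus> g Q) \<oplus> g Q = c"
      using c(1) gE[OF Q] Q.field_carrier by (simp add: a_minus_def a_assoc l_neg subset_iff)
    then have "c \<in> \<O> E Q" using Q.val_ge_add[OF near(2), of "g Q"] g[OF Q] Q.val_ge_0 by simp
    then show ?thesis using near(1) by blast
  qed
  then show ?thesis using c(1) by (auto simp: semilocal_ring_def)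
qed

lemma exists_separating_element:
  assumes S: "finite S" "\<And>Q. Q \<in> S \<Longrightarrow> discrete_place R E Q" and Q: "Q \<in> S"
  shows "\<exists>s\<in>semilocal_ring E S. s \<noteq> \<zero> \<and> val E Q s = 1 \<and> (\<forall>T\<in>S. T \<noteq> Q \<longrightarrow> val E T s = 0)"
proof -
  interpret Q: discrete_place R E Q by (rule S(2)[OF Q])
  obtain t where t: "prime_element R E Q t" by (rule Q.exists_prime_element)
  note t_facts = Q.prime_elementE[OF t]
  define g where "g T = (if T = Q then t else \<one>)" for T
  have g: "g T \<in> E" "g T \<noteq> \<zero>" "val E T (g T) = (if T = Q then 1 else 0)" if "T \<in> S" for T
    using t_facts Q.one_in_field Q.val_prime_element[OF t] discrete_place.val_one[OF S(2)[OF that]]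
    by (auto simp: g_def)
  obtain s where s: "s \<in> E" "\<And>T. T \<in> S \<Longrightarrow> s \<ominus> g T \<in> val_ge E T 2"
    using weak_approximation[OF S Q.subfield, of g 2] g(1) by blast
  have val_s: "s \<noteq> \<zero> \<and> val E T s = (if T = Q then 1 else 0)" if T: "T \<in> S" for T
  proof -
    interpret T: discrete_place R E T by (rule S(2)[OF T])
    have "val E T (g T) + 1 \<le> 2" using g(3)[OF T] by simp
    then have "s \<ominus> g T \<in> val_ge E T (val E T (g T) + 1)" using s(2)[OF T] T.val_ge_antimono by blast
    from T.val_add_dominant[OF g(1,2)[OF T] this]
    have "g T \<oplus> (s \<ominus> g T) \<noteq> \<zero> \<and> val E T (g T \<oplus> (s \<ominus> g T)) = val E T (g T)" by blast
    moreover have "g T \<oplus> (s \<ominus> g T) = s"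
    proof -
      have "s \<in> carrier R" "g T \<in> carrier R" using s(1) g(1)[OF T] Q.field_carrier by auto
      then show ?thesis by algebra
    qed
    ultimately show ?thesis using g(3)[OF T] by simp
  qed
  have "s \<in> \<O> E T" if "T \<in> S" for T
    using discrete_place.ring_iff_val_nonneg[OF S(2)[OF that] s(1)] val_s[OF that] by simp
  then have "s \<in> semilocal_ring E S" using s(1) by (simp add: semilocal_ring_def)
  then show ?thesis using val_s[OF Q] val_s by (intro bexI[of _ s]) auto
qed

lemma semilocal_divides:
  assumes S: "\<And>Q. Q \<in> S \<Longrightarrow> discrete_place R E Q" and E: "subfield E R"
    and c: "c \<in> E" "c \<noteq> \<zero>" and a: "a \<in> E" "\<And>Q. Q \<in> S \<Longrightarrow> a \<in> val_ge E Q (val E Q c)"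
  shows "\<exists>b\<in>semilocal_ring E S. a = c \<otimes> b"
proof (intro bexI)
  note inv_c = subfield_inv[OF E c] and ER = subfieldE(3)[OF E]
  show "a = c \<otimes> (inv c \<otimes> a)" using c a(1) inv_c ER by (simp add: m_assoc[symmetric] subset_iff)
  have "inv c \<otimes> a \<in> \<O> E Q" if Q: "Q \<in> S" for Q
  proof -
    interpret Q: discrete_place R E Q by (rule S[OF Q])
    have "inv c \<in> val_ge E Q (- val E Q c)" using inv_c Q.val_inv[OF c] by (simp add: val_ge_def)
    then have "inv c \<otimes> a \<in> val_ge E Q 0" using Q.val_ge_mult[OF _ a(2)[OF Q]] by fastforce
    then show ?thesis unfolding Q.val_ge_0 .
  qed
  then show "inv c \<otimes> a \<in> semilocal_ring E S"
    using subringE(6)[OF subfieldE(1)[OF E] inv_c(1) a(1)] by (simp add: semilocal_ring_def)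
qed

end

section \<open>Places of function fields are discrete\<close>

context field
begin

definition fractions :: "'a set \<Rightarrow> 'a set"
  where "fractions S = {g \<otimes> inv h | g h. g \<in> S \<and> h \<in> S \<and> h \<noteq> \<zero>}"

lemma fractionsI: "g \<in> S \<Longrightarrow> h \<in> S \<Longrightarrow> h \<noteq> \<zero> \<Longrightarrow> g \<otimes> inv h \<in> fractions S"
  by (auto simp: fractions_def)

lemma fractionsE:
  assumes S: "subring S R" and a: "a \<in> fractions S"
  obtains g h where "g \<in> S" "h \<in> S" "h \<noteq> \<zero>" "a = g \<otimes> inv h" "g \<in> carrier R" "h \<in> carrier R"
    "inv h \<in> carrier R" "h \<otimes> inv h = \<one>" "a \<otimes> h = g"
proof -
  obtain g h where gh: "g \<in> S" "h \<in> S" "h \<noteq> \<zero>" "a = g \<otimes> inv h" using a by (auto simp: fractions_def)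
  have R: "g \<in> carrier R" "h \<in> carrier R" using gh subringE(1)[OF S] by auto
  note inv_h = inv_nonzero[OF R(2) gh(3)]
  have "a \<otimes> h = g" unfolding gh(4) using R inv_h by (simp add: m_assoc)
  then show ?thesis using that gh R inv_h by blast
qed

lemma fractions_add_mult:
  assumes S: "subring S R" and a: "a \<in> fractions S" and b: "b \<in> fractions S"
  shows "a \<oplus> b \<in> fractions S" "a \<otimes> b \<in> fractions S"
proof -
  obtain g h where g: "g \<in> S" "h \<in> S" "h \<noteq> \<zero>" "a = g \<otimes> inv h" "g \<in> carrier R" "h \<in> carrier R"
    "inv h \<in> carrier R" "h \<otimes> inv h = \<one>" by (rule fractionsE[OF S a])
  obtain g' h' where g': "g' \<in> S" "h' \<in> S" "h' \<noteq> \<zero>" "b = g' \<otimes> inv h'" "g' \<in> carrier R" "h' \<in> carrier R"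
    "inv h' \<in> carrier R" "h' \<otimes> inv h' = \<one>" by (rule fractionsE[OF S b])
  have denominator: "h \<otimes> h' \<in> S" "h \<otimes> h' \<noteq> \<zero>" "inv (h \<otimes> h') = inv h \<otimes> inv h'"
    using g g' subringE(6)[OF S] integral inv_mult_nonzero by auto
  have "a \<otimes> b = (g \<otimes> g') \<otimes> inv (h \<otimes> h')"
    unfolding denominator(3) g(4) g'(4) using g(5-7) g'(5-7) by (simp add: m_ac)
  then show "a \<otimes> b \<in> fractions S"
    using fractionsI[OF subringE(6)[OF S g(1) g'(1)] denominator(1,2)] by simp
  have "(g \<otimes> h' \<oplus> g' \<otimes> h) \<otimes> (inv h \<otimes> inv h')
      = g \<otimes> inv h \<otimes> (h' \<otimes> inv h') \<oplus> g' \<otimes> inv h' \<otimes> (h \<otimes> inv h)"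
    using g(5-7) g'(5-7) by (simp add: l_distr r_distr m_ac)
  then have "a \<oplus> b = (g \<otimes> h' \<oplus> g' \<otimes> h) \<otimes> inv (h \<otimes> h')"
    unfolding denominator(3) using g g' by simp
  moreover have "g \<otimes> h' \<oplus> g' \<otimes> h \<in> S" using g g' subringE(6,7)[OF S] by simp
  ultimately show "a \<oplus> b \<in> fractions S" using fractionsI denominator(1,2) by simp
qed

lemma subset_fractions:
  assumes S: "subring S R"
  shows "S \<subseteq> fractions S"
proof
  fix a assume a: "a \<in> S"
  then have "a = a \<otimes> inv \<one>" using subringE(1)[OF S] by auto
  then show "a \<in> fractions S" using fractionsI[OF a subringE(3)[OF S] one_not_zero] by simp
qed

lemma subfield_fractions:
  assumes S: "subring S R"
  shows "subfield (fractions S) R"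
proof (rule subfieldI')
  show "subring (fractions S) R"
  proof (rule subringI)
    show "fractions S \<subseteq> carrier R"
    proof
      fix a assume "a \<in> fractions S"
      then show "a \<in> carrier R" by (rule fractionsE[OF S]) simp
    qed
    show "\<one> \<in> fractions S" using subset_fractions[OF S] subringE(3)[OF S] by blast
    show "\<ominus> a \<in> fractions S" if a: "a \<in> fractions S" for a
    proof (rule fractionsE[OF S a])
      fix g h assume g: "g \<in> S" "h \<in> S" "h \<noteq> \<zero>" "a = g \<otimes> inv h" "g \<in> carrier R" "inv h \<in> carrier R"
      then have "\<ominus> a = (\<ominus> g) \<otimes> inv h" by (simp add: l_minus)
      then show "\<ominus> a \<in> fractions S" using fractionsI[OF subringE(5)[OF S g(1)] g(2,3)] by simp
    qed
  qed (use fractions_add_mult[OF S] in auto)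
  fix a assume a: "a \<in> fractions S - {\<zero>}"
  then have "a \<in> fractions S" by simp
  then show "inv a \<in> fractions S"
  proof (rule fractionsE[OF S])
    fix g h assume g: "g \<in> S" "h \<in> S" "h \<noteq> \<zero>" "a = g \<otimes> inv h" "g \<in> carrier R" "h \<in> carrier R"
    then have g0: "g \<noteq> \<zero>" using a inv_nonzero(1)[of h] by auto
    have "inv a = h \<otimes> inv g"
      unfolding g(4) using inv_mult_nonzero[of g "inv h"] inv_nonzero[of h] inv_nonzero[of g] g g0
      by (simp add: m_comm)
    then show "inv a \<in> fractions S" using fractionsI[OF g(2,1) g0] by simp
  qed
qed

lemma generate_field_subset_fractions:
  assumes k: "subfield k R" and w: "w \<in> carrier R"
  shows "generate_field R (insert w k) \<subseteq> fractions (simple_extension k w)"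
proof (rule generate_field_min_subfield1)
  note S = simple_extension_is_subring[OF subfieldE(1)[OF k] w]
  show "insert w k \<subseteq> carrier R" using subfieldE(3)[OF k] w by simp
  show "subfield (fractions (simple_extension k w)) R" by (rule subfield_fractions[OF S])
  show "insert w k \<subseteq> fractions (simple_extension k w)"
    using subset_fractions[OF S] simple_extension_incl[OF subfieldE(3)[OF k] w]
      simple_extension_mem[OF subfieldE(1)[OF k] w] by auto
qed

lemma subfield_generate_insert:
  assumes "subfield k R" "x \<in> carrier R"
  shows "subfield (generate_field R (insert x k)) R"
  using generate_field_is_subfield[of "insert x k"] subfieldE(3)[OF assms(1)] assms(2) by simp

lemma generate_insert_subset:
  assumes "subfield F R" "k \<subseteq> F" "x \<in> F"
  shows "generate_field R (insert x k) \<subseteq> F"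
proof (rule generate_field_min_subfield1[OF _ assms(1)])
  show "insert x k \<subseteq> carrier R" "insert x k \<subseteq> F" using subfieldE(3)[OF assms(1)] assms(2,3) by auto
qed

lemma generate_insert_mem: "k \<subseteq> generate_field R (insert x k)" "x \<in> generate_field R (insert x k)"
  by (auto intro: generate_field.incl)

lemma generate_insert_inv:
  assumes k: "subfield k R" and x: "x \<in> carrier R" "x \<noteq> \<zero>"
  shows "generate_field R (insert (inv x) k) = generate_field R (insert x k)"
proof -
  have sub: "generate_field R (insert (inv y) k) \<subseteq> generate_field R (insert y k)"
    if y: "y \<in> carrier R" "y \<noteq> \<zero>" for y
  proof (rule generate_insert_subset)
    show field: "subfield (generate_field R (insert y k)) R"
      by (rule subfield_generate_insert[OF k y(1)])
    show "inv y \<in> generate_field R (insert y k)"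
      using subfield_inv(1)[OF field generate_insert_mem(2) y(2)] .
  qed (rule generate_insert_mem(1))
  show ?thesis using sub[OF x] sub[OF inv_nonzero(1,2)[OF x]] inv_nonzero(5)[OF x] by simp
qed

lemma simple_extensionE:
  assumes k: "subring k R" and x: "x \<in> carrier R" and g: "g \<in> simple_extension k x"
  obtains h b where "h \<in> simple_extension k x" "b \<in> k" "g = h \<otimes> x \<oplus> b"
  using g
proof (cases rule: simple_extension.cases)
  case zero
  then have "g = \<zero> \<otimes> x \<oplus> \<zero>" using x by simp
  then show ?thesis using that simple_extension.zero subringE(2)[OF k] by blast
qed (use that in blast)

lemma finite_dimension_larger_base:
  assumes K: "subfield K R" and K': "subfield K' R" and sub: "K \<subseteq> K'" "K' \<subseteq> F" and F: "subring F R"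
    and fin: "finite_dimension K F"
  shows "finite_dimension K' F"
proof -
  obtain n where "dimension n K F" using fin by auto
  then obtain Us where Us: "set Us \<subseteq> carrier R" "Span K Us = F" using exists_base[OF K] by blast
  have "subalgebra K' F R"
    using subringE(6)[OF F] sub(2) subring.axioms(1)[OF F]
    by (auto simp: subalgebra_def subalgebra_axioms_def intro: subgroup.intro)
  moreover have "set Us \<subseteq> F" using Span_base_incl[OF K Us(1)] Us(2) by simp
  ultimately have "Span K' Us \<subseteq> F" using subalgebra_Span_incl[OF K'] by blast
  moreover have "Span K Us \<subseteq> Span K' Us"
    using Span_mem_iff_length_version[OF K Us(1)] Span_mem_iff_length_version[OF K' Us(1)] sub(1)
    by blast
  ultimately have "Span K' Us = F" using Us(2) by blast
  then show ?thesis using Span_finite_dimension[OF K' Us(1)] by simp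
qed

lemma algebraic_over_simple_extension_element:
  assumes k: "subfield k R" and w: "w \<in> carrier R" and x: "x \<in> simple_extension k w" "x \<notin> k"
    and K: "subfield K R" "k \<subseteq> K" "x \<in> K"
  shows "(algebraic over K) w"
proof -
  note kR = subfieldE(3)[OF k]
  obtain p where p: "p \<in> carrier (k[X])" "eval p w = x"
    using x(1) simple_extension_as_eval_img[OF kR w] by auto
  then have pk: "set p \<subseteq> k" "p \<noteq> [] \<Longrightarrow> lead_coeff p \<noteq> \<zero>"
    by (auto simp: univ_poly_carrier[symmetric] polynomial_def)
  have "p \<noteq> []" using p(2) x(2) subringE(2)[OF subfieldE(1)[OF k]] by auto
  then obtain p0 b where split: "p = p0 @ [b]" by (metis rev_exhaust)
  have b: "b \<in> k" "b \<in> carrier R" "b \<in> K" using split pk(1) kR K(2) by auto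
  have p0R: "set p0 \<subseteq> carrier R" "eval p0 w \<in> carrier R"
    using split pk(1) kR eval_in_carrier[of p0 w] w by auto
  have xR: "x \<in> carrier R" using K subfieldE(3)[OF K(1)] by blast
  have p0: "p0 \<noteq> []" using p(2) split b(1,2) x(2) by auto
  have coeffs: "set (p0 @ [b \<ominus> x]) \<subseteq> K"
    using split pk(1) b(3) K(2,3) subring_minus_closed[OF subfieldE(1)[OF K(1)]] by auto
  have "lead_coeff (p0 @ [b \<ominus> x]) \<noteq> \<zero>" using pk(2) split p0 by auto
  then have "p0 @ [b \<ominus> x] \<in> carrier (K[X])"
    unfolding univ_poly_carrier[symmetric] polynomial_def using coeffs by blast
  moreover have "eval (p0 @ [b \<ominus> x]) w = \<zero>"
  proof -
    have "x = eval p0 w \<otimes> w \<oplus> b" using p(2) eval_append_aux[OF p0R(1) b(2) w] by (simp add: split)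
    moreover have "a \<otimes> w \<oplus> (b \<ominus> (a \<otimes> w \<oplus> b)) = \<zero>" if "a \<in> carrier R" for a using that b(2) w by algebra
    ultimately show ?thesis using eval_append_aux[OF p0R(1) _ w] b(2) xR p0R(2) by simp
  qed
  ultimately show ?thesis by (intro algebraicI) auto
qed

lemma finite_dimension_over_nonconstant:
  assumes k: "subfield k R" and F: "subfield F R" "k \<subseteq> F" and w: "w \<in> F"
    and fin: "finite_dimension (generate_field R (insert w k)) F"
    and x: "x \<in> simple_extension k w" "x \<notin> k"
  shows "finite_dimension (generate_field R (insert x k)) F"
proof -
  let ?Kw = "generate_field R (insert w k)" and ?Kx = "generate_field R (insert x k)"
  let ?Kxw = "simple_extension ?Kx w"
  have xF: "x \<in> F" using simple_extension_subring_incl[OF subfieldE(1)[OF F(1)] F(2) w] x(1) by blast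
  have R: "w \<in> carrier R" "x \<in> carrier R" using w xF subfieldE(3)[OF F(1)] by auto
  note Kw = subfield_generate_insert[OF k R(1)] and Kx = subfield_generate_insert[OF k R(2)]
  have algebraic: "(algebraic over ?Kx) w"
    by (rule algebraic_over_simple_extension_element[OF k R(1) x Kx generate_insert_mem])
  have Kxw: "subfield ?Kxw R" using simple_extension_is_subfield[OF Kx R(1)] algebraic by simp
  have "insert w ?Kx \<subseteq> ?Kxw"
    using simple_extension_incl[OF subfieldE(3)[OF Kx] R(1)]
      simple_extension_mem[OF subfieldE(1)[OF Kx] R(1)] by simp
  moreover have "k \<subseteq> ?Kx" by (rule generate_insert_mem)
  ultimately have "?Kw \<subseteq> ?Kxw" by (intro generate_insert_subset[OF Kxw]) auto
  moreover have "?Kxw \<subseteq> F"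
    using simple_extension_subring_incl[OF subfieldE(1)[OF F(1)] generate_insert_subset[OF F xF] w] .
  ultimately have "finite_dimension ?Kxw F"
    using finite_dimension_larger_base[OF Kw Kxw _ _ subfieldE(1)[OF F(1)] fin] by blast
  moreover have "finite_dimension ?Kx ?Kxw"
    using finite_dimension_simple_extension[OF Kx R(1)] algebraic by simp
  ultimately show ?thesis using telescopic_base_dim(1)[OF Kx Kxw] by blast
qed

end

context val_ring
begin

lemma scaled_eval_inv_nonunit:
  assumes z: "z \<in> V" "z \<noteq> \<zero>" and p: "set p \<subseteq> carrier R" "\<And>a. a \<in> set p \<Longrightarrow> a \<otimes> z \<in> nonunits V"
  shows "z [^] length p \<otimes> eval p (inv z) \<in> nonunits V"
  using p
proof (induction p)
  case Nil
  then show ?case using zero_nonunit by simp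
next
  case (Cons a p)
  have zR: "z \<in> carrier R" using z(1) ring_carrier by blast
  note inv_z = inv_nonzero[OF zR z(2)]
  have R: "a \<in> carrier R" "eval p (inv z) \<in> carrier R"
    using Cons(2) eval_in_carrier[of p "inv z"] inv_z by auto
  have pow: "z [^] length p \<otimes> inv z [^] length p = \<one>"
    using nat_pow_distrib[of z "inv z" "length p"] zR inv_z by simp
  have "z [^] length (a # p) \<otimes> eval (a # p) (inv z)
      = z \<otimes> (a \<otimes> (z [^] length p \<otimes> inv z [^] length p) \<oplus> z [^] length p \<otimes> eval p (inv z))"
    using zR inv_z R by (simp add: r_distr m_ac)
  also have "\<dots> = a \<otimes> z \<oplus> z \<otimes> (z [^] length p \<otimes> eval p (inv z))"
    unfolding pow using zR R by (simp add: r_distr m_comm)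
  also have "\<dots> \<in> nonunits V"
    using additive_subgroup.a_closed[OF nonunits_subgroup Cons(3) nonunits_mult[OF z(1)]] Cons by simp
  finally show ?case .
qed

text \<open>Multiplied by \<open>z\<^sup>n\<close>, a monic equation of degree \<open>n\<close> for \<open>z\<inverse>\<close> would present \<open>-1\<close> as a nonunit.\<close>

lemma eval_monic_inv_nonzero:
  assumes z: "z \<in> V" "z \<noteq> \<zero>" and p: "set p \<subseteq> carrier R" "\<And>a. a \<in> set p \<Longrightarrow> a \<otimes> z \<in> nonunits V"
  shows "eval (\<one> # p) (inv z) \<noteq> \<zero>"
proof
  assume zero: "eval (\<one> # p) (inv z) = \<zero>"
  let ?v = "z [^] length p \<otimes> eval p (inv z)"
  have zR: "z \<in> carrier R" using z(1) ring_carrier by blast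
  note inv_z = inv_nonzero[OF zR z(2)]
  have vR: "eval p (inv z) \<in> carrier R" using p(1) eval_in_carrier[of p "inv z"] inv_z by auto
  have pow: "z [^] length p \<otimes> inv z [^] length p = \<one>"
    using nat_pow_distrib[of z "inv z" "length p"] zR inv_z by simp
  have "\<zero> = z [^] length p \<otimes> (inv z [^] length p \<oplus> eval p (inv z))" using zero inv_z zR by simp
  also have "\<dots> = \<one> \<oplus> ?v" using zR inv_z vR pow by (simp add: r_distr)
  finally have "\<ominus> ?v = \<one>" using minus_equality[of \<one> ?v] zR vR by simp
  moreover have "\<ominus> ?v \<in> nonunits V"
    by (rule additive_subgroup.a_inv_closed[OF nonunits_subgroup scaled_eval_inv_nonunit[OF z p]])
  ultimately show False using one_notin_nonunits by simp
qed

lemma integral_in_ring: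
  assumes z: "z \<in> F" and p: "set p \<subseteq> V" "p \<noteq> []" "lead_coeff p = \<one>" "eval p z = \<zero>"
  shows "z \<in> V"
proof (rule ccontr)
  assume "z \<notin> V"
  then have inv_z: "inv z \<in> nonunits V" and z0: "z \<noteq> \<zero>"
    using inv_nonunit_of_notin[OF z] subringE(2)[OF subring] by auto
  have zR: "z \<in> carrier R" using z field_carrier by blast
  obtain q where q: "p = \<one> # q" using p(2,3) by (cases p) auto
  have "eval (\<one> # q) (inv (inv z)) \<noteq> \<zero>"
  proof (rule eval_monic_inv_nonzero)
    show "inv z \<in> V" "inv z \<noteq> \<zero>" using inv_z nonunits_subset inv_nonzero(2)[OF zR z0] by auto
    show "set q \<subseteq> carrier R" using p(1) q ring_carrier by auto
    show "a \<otimes> inv z \<in> nonunits V" if "a \<in> set q" for a using nonunits_mult[OF _ inv_z] that p(1) q by auto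
  qed
  then show False using p(4) q inv_nonzero(5)[OF zR z0] by simp
qed

lemma algebraic_nonunit_divides_base:
  assumes K: "subfield K R" "K \<subseteq> F" and z: "z \<in> nonunits V" "z \<noteq> \<zero>" "(algebraic over K) (inv z)"
  shows "\<exists>c\<in>K. c \<noteq> \<zero> \<and> c \<in> z <# V"
proof (rule ccontr)
  assume no_multiple: "\<not> ?thesis"
  have zV: "z \<in> V" "z \<in> F" "z \<in> carrier R" using z(1) nonunits_subset ring_subset ring_carrier by auto
  note inv_z = inv_nonzero[OF zV(3) z(2)] and KR = subfieldE(3)[OF K(1)]
  note irr = IrrE[OF K(1) inv_z(1) z(3)]
  define p where "p = Irr K (inv z)"
  have pK: "set p \<subseteq> K" using irr(1) by (auto simp: p_def univ_poly_carrier[symmetric] polynomial_def)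
  have "p \<noteq> []" using irr(2) by (auto simp: p_def ring_irreducible_def univ_poly_zero)
  then obtain q where q: "p = \<one> # q" using irr(3) by (cases p) (auto simp: p_def)
  have "a \<otimes> z \<in> nonunits V" if a: "a \<in> set q" for a
  proof (cases "a = \<zero>")
    case True
    then show ?thesis using zero_nonunit zV(3) by simp
  next
    case False
    have aK: "a \<in> K" "a \<in> F" "a \<in> carrier R" using a q pK K(2) KR by auto
    note inv_a = subfield_inv[OF K(1) aK(1) False]
    have "inv a = z \<otimes> inv (a \<otimes> z)"
      using inv_mult_nonzero[OF aK(3) False zV(3) z(2)] inv_z zV(3) inv_a(1) KR
        m_lcomm[of z "inv a" "inv z"] by auto
    then have "inv (a \<otimes> z) \<notin> V" using no_multiple inv_a(1,2) unfolding l_coset_mem by blast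
    moreover have "a \<otimes> z \<in> F" using subringE(6)[OF field_subring aK(2) zV(2)] .
    moreover have "a \<otimes> z \<noteq> \<zero>" using False z(2) aK(3) zV(3) integral by blast
    ultimately show ?thesis using nonunitI by blast
  qed
  moreover have "set q \<subseteq> carrier R" using q pK KR by auto
  ultimately have "eval p (inv z) \<noteq> \<zero>" unfolding q by (intro eval_monic_inv_nonzero[OF zV(1) z(2)])
  then show False using irr(4) by (simp add: p_def)
qed

lemma polynomial_fraction_reduced:
  assumes k: "subfield k R" "k \<subseteq> V" and x: "x \<in> nonunits V" "x \<noteq> \<zero>" and u: "u \<in> V"
    and h: "h \<in> simple_extension k x" "h \<noteq> \<zero>" "u \<otimes> h \<in> simple_extension k x"
  shows "\<exists>g\<in>simple_extension k x. \<exists>d\<in>k. d \<noteq> \<zero> \<and> u \<otimes> (g \<otimes> x \<oplus> d) \<in> simple_extension k x"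
  using h
proof (induction h rule: simple_extension.induct)
  case (lin h b)
  have xV: "x \<in> V" "x \<in> carrier R" using x(1) nonunits_subset ring_carrier by auto
  note kr = subfieldE(1)[OF k(1)]
  have SV: "simple_extension k x \<subseteq> V" using simple_extension_subring_incl[OF subring k(2) xV(1)] .
  show ?case
  proof (cases "b = \<zero>")
    case False
    then show ?thesis using lin by blast
  next
    case True
    obtain g c where g: "g \<in> simple_extension k x" "c \<in> k" "u \<otimes> (h \<otimes> x \<oplus> b) = g \<otimes> x \<oplus> c"
      by (rule simple_extensionE[OF kr xV(2) lin(5)])
    have V: "h \<in> V" "g \<in> V" "c \<in> V" using lin(1) g(1,2) SV k(2) by auto
    have R: "u \<in> carrier R" "h \<in> carrier R" "g \<in> carrier R" "c \<in> carrier R"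
      using V u ring_carrier by auto
    have ux: "(u \<otimes> h) \<otimes> x = g \<otimes> x \<oplus> c" using g(3) True R xV(2) by (simp add: m_assoc)
    have "c = (u \<otimes> h \<ominus> g) \<otimes> x"
    proof -
      have "(u \<otimes> h \<ominus> g) \<otimes> x = (u \<otimes> h) \<otimes> x \<ominus> g \<otimes> x" using R xV(2) by algebra
      also have "\<dots> = c" unfolding ux using R xV(2) by algebra
      finally show ?thesis by simp
    qed
    moreover have "u \<otimes> h \<ominus> g \<in> V"
      using subring_minus_closed[OF subring] subringE(6)[OF subring u] V by blast
    ultimately have "c = \<zero>" using meets_nonunits_trivially[OF k g(2)] nonunits_mult[OF _ x(1)] by simp
    then have "x \<otimes> (u \<otimes> h) = x \<otimes> g" using ux R xV(2) by (simp add: m_comm)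
    then have "u \<otimes> h = g" using m_lcancel[OF x(2) xV(2)] R by simp
    moreover have "h \<noteq> \<zero>" using lin(4) True xV(2) by auto
    ultimately show ?thesis using lin.IH g(1) by simp
  qed
qed simp

lemma rational_residue:
  assumes k: "subfield k R" "k \<subseteq> V" and x: "x \<in> nonunits V" "x \<noteq> \<zero>"
    and u: "u \<in> V \<inter> generate_field R (insert x k)" (is "_ \<in> ?W")
  shows "\<exists>b\<in>k. u \<ominus> b \<in> x <# ?W"
proof -
  have xV: "x \<in> V" "x \<in> carrier R" using x(1) nonunits_subset ring_carrier by auto
  note kr = subfieldE(1)[OF k(1)] and kR = subfieldE(3)[OF k(1)]
  note Sr = simple_extension_is_subring[OF kr xV(2)]
  note Kr = subfieldE(1)[OF subfield_generate_insert[OF k(1) xV(2)]]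
  have W: "subring ?W R" using subring_inter[OF subring Kr] .
  have kW: "k \<subseteq> ?W" and SW: "simple_extension k x \<subseteq> ?W"
    using simple_extension_subring_incl[OF W] k(2) xV(1) generate_insert_mem by auto
  have "u \<in> fractions (simple_extension k x)"
    using generate_field_subset_fractions[OF k(1) xV(2)] u by blast
  then obtain g0 h0 where "g0 \<in> simple_extension k x" "h0 \<in> simple_extension k x" "h0 \<noteq> \<zero>" "u \<otimes> h0 = g0"
    by (rule fractionsE[OF Sr])
  then obtain h d where h: "h \<in> simple_extension k x" "d \<in> k" "d \<noteq> \<zero>"
      "u \<otimes> (h \<otimes> x \<oplus> d) \<in> simple_extension k x"
    using polynomial_fraction_reduced[OF k x] u by blast
  obtain g b where g: "g \<in> simple_extension k x" "b \<in> k" "u \<otimes> (h \<otimes> x \<oplus> d) = g \<otimes> x \<oplus> b"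
    by (rule simple_extensionE[OF kr xV(2) h(4)])
  note inv_d = subfield_inv[OF k(1) h(2,3)]
  have R: "u \<in> carrier R" "g \<in> carrier R" "h \<in> carrier R" "b \<in> carrier R" "d \<in> carrier R" "inv d \<in> carrier R"
    using u g(1,2) h(1,2) inv_d(1) SW kR ring_carrier by auto
  have "u \<otimes> (d \<otimes> inv d) \<ominus> b \<otimes> inv d = ((u \<otimes> (h \<otimes> x \<oplus> d) \<ominus> b) \<ominus> u \<otimes> h \<otimes> x) \<otimes> inv d"
    using R xV(2) by algebra
  also have "\<dots> = x \<otimes> ((g \<ominus> u \<otimes> h) \<otimes> inv d)" unfolding g(3) using R xV(2) by algebra
  finally have "u \<ominus> b \<otimes> inv d = x \<otimes> ((g \<ominus> u \<otimes> h) \<otimes> inv d)" using inv_d(3) R by simp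
  moreover have "(g \<ominus> u \<otimes> h) \<otimes> inv d \<in> ?W"
  proof -
    have mem: "g \<in> ?W" "h \<in> ?W" "inv d \<in> ?W" using g(1) h(1) inv_d(1) kW SW by auto
    have "g \<ominus> u \<otimes> h \<in> ?W" by (rule subring_minus_closed[OF W mem(1) subringE(6)[OF W u mem(2)]])
    then show ?thesis using subringE(6)[OF W] mem(3) by blast
  qed
  moreover have "b \<otimes> inv d \<in> k" using subringE(6)[OF kr g(2) inv_d(1)] .
  ultimately show ?thesis unfolding l_coset_mem by blast
qed

lemma nonunits_rational:
  assumes k: "subfield k R" "k \<subseteq> V" and x: "x \<in> nonunits V" "x \<noteq> \<zero>"
  defines "W \<equiv> V \<inter> generate_field R (insert x k)"
  shows "val_ring R (generate_field R (insert x k)) W" "nonunits W = x <# W"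
proof -
  have xV: "x \<in> V" "x \<in> F" "x \<in> carrier R" using x(1) nonunits_subset ring_subset ring_carrier by auto
  note K = subfield_generate_insert[OF k(1) xV(3)]
  have "generate_field R (insert x k) \<subseteq> F"
    using generate_insert_subset[OF subfield _ xV(2)] k(2) ring_subset by blast
  then show W: "val_ring R (generate_field R (insert x k)) W"
    unfolding W_def by (rule val_ring_inter_subfield[OF K])
  interpret W: val_ring R "generate_field R (insert x k)" W by (rule W)
  have xW: "x \<in> nonunits W"
    using x(1) xV(1) generate_insert_mem(2) by (auto simp: nonunits_def W_def)
  have kW: "k \<subseteq> W" using k(2) generate_insert_mem(1) by (auto simp: W_def)
  have sub: "x <# W \<subseteq> nonunits W"
    using ideal_in_r_closed[OF W.subring W.ideal_nonunits _ xW] by (auto simp: l_coset_mem)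
  have "z \<in> x <# W" if z: "z \<in> nonunits W" for z
  proof -
    have zW: "z \<in> W" "z \<in> carrier R" using z W.nonunits_subset W.ring_carrier by auto
    obtain b where b: "b \<in> k" "z \<ominus> b \<in> x <# W"
      using rational_residue[OF k x, of z] zW(1) unfolding W_def by blast
    have bR: "b \<in> carrier R" using b(1) subfieldE(3)[OF k(1)] by blast
    have "z \<ominus> (z \<ominus> b) \<in> nonunits W"
      using additive_subgroup_minus_closed[OF W.nonunits_subgroup z] sub b(2) by blast
    moreover have "z \<ominus> (z \<ominus> b) = b" using zW(2) bR by algebra
    ultimately have "b = \<zero>" using W.meets_nonunits_trivially[OF k(1) kW b(1)] by simp
    then show ?thesis using b(2) zW(2) by (simp add: a_minus_def)
  qed
  then show "nonunits W = x <# W" using sub by blast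
qed

lemma finite_index_over_rational:
  assumes k: "subfield k R" "finite k" "k \<subseteq> V" and x: "x \<in> nonunits V" "x \<noteq> \<zero>"
    and fin: "finite_dimension (generate_field R (insert x k)) F"
  shows "finite_index V (x <# V)"
proof -
  let ?K = "generate_field R (insert x k)"
  note rational = nonunits_rational[OF k(1,3) x]
  interpret W: val_ring R ?K "V \<inter> ?K" by (rule rational(1))
  have xW: "x \<in> V \<inter> ?K" using x(1) nonunits_subset generate_insert_mem(2) by auto
  have xR: "x \<in> carrier R" using xW W.ring_carrier by blast
  have "finite_index (V \<inter> ?K) (x <# (V \<inter> ?K))"
    using index_le_cover(1)[OF additive_subgroup_l_coset[OF subring_additive_subgroup[OF W.subring] xR]
        W.ring_carrier k(2) subfieldE(3)[OF k(1)]] rational_residue[OF k(1,3) x] by blast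
  then have "finite_index (V \<inter> ?K) (nonunits (V \<inter> ?K))" unfolding rational(2) .
  moreover obtain m where "dimension m ?K F" using fin by auto
  ultimately show ?thesis
    using W.index_le_dimension(1)[OF xW rational(2) _ subring _ ring_subset] by blast
qed

lemma nonunit_divides_polynomial:
  assumes k: "subfield k R" "k \<subseteq> V" and w: "w \<in> V" and fin: "finite_dimension (generate_field R (insert w k)) F"
    and z: "z \<in> nonunits V" "z \<noteq> \<zero>"
  shows "\<exists>g\<in>simple_extension k w. g \<noteq> \<zero> \<and> g \<in> z <# V"
proof -
  let ?K = "generate_field R (insert w k)"
  have wF: "w \<in> F" "w \<in> carrier R" and zV: "z \<in> V" "z \<in> F"
    using w z(1) nonunits_subset ring_subset ring_carrier by auto
  note Sr = simple_extension_is_subring[OF subfieldE(1)[OF k(1)] wF(2)]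
  have SV: "simple_extension k w \<subseteq> V" using simple_extension_subring_incl[OF subring k(2) w] .
  have K: "subfield ?K R" "?K \<subseteq> F"
    using subfield_generate_insert[OF k(1) wF(2)] generate_insert_subset[OF subfield _ wF(1)] k(2) ring_subset
    by auto
  have "(algebraic over ?K) (inv z)"
    using finite_dimension_imp_algebraic[OF K(1) field_subring fin] subfield_inv(1)[OF subfield zV(2) z(2)] .
  then obtain c where c: "c \<in> ?K" "c \<noteq> \<zero>" "c \<in> z <# V"
    using algebraic_nonunit_divides_base[OF K z] by blast
  have "c \<in> fractions (simple_extension k w)"
    using c(1) generate_field_subset_fractions[OF k(1) wF(2)] by blast
  then obtain g h where g: "g \<in> simple_extension k w" "h \<in> simple_extension k w" "h \<noteq> \<zero>" "c \<otimes> h = g"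
      "h \<in> carrier R"
    by (rule fractionsE[OF Sr])
  have "g \<noteq> \<zero>" using c(1,2) g(3-5) subfieldE(3)[OF K(1)] integral by blast
  moreover have "g \<in> z <# V"
    using ideal_in_r_closed[OF subring ideal_in_l_coset[OF subring zV(1)] _ c(3)] g(2,4) SV by blast
  ultimately show ?thesis using g(1) by blast
qed

lemma finite_index_principal:
  assumes k: "subfield k R" "finite k" "k \<subseteq> V" and w: "w \<in> V"
    and fin: "finite_dimension (generate_field R (insert w k)) F" and z: "z \<in> V" "z \<noteq> \<zero>"
  shows "finite_index V (z <# V)"
proof -
  note V = subring_additive_subgroup[OF subring] and ideal = ideal_in_l_coset[OF subring]
  have zR: "z \<in> carrier R" using z(1) ring_carrier by blast
  show ?thesis
  proof (cases "z \<in> nonunits V")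
    case False
    then have "\<one> \<in> z <# V"
      using z inv_nonzero(3)[OF zR z(2)] unfolding nonunits_def l_coset_mem by fastforce
    then have "z <# V = V" using ideal.one_imp_carrier[OF ideal[OF z(1)]] by simp
    then show ?thesis using index_self(1)[OF V] by simp
  next
    case True
    obtain g where g: "g \<in> simple_extension k w" "g \<noteq> \<zero>" "g \<in> z <# V"
      using nonunit_divides_polynomial[OF k(1,3) w fin True z(2)] by blast
    have "z <# V \<subseteq> nonunits V"
      using ideal_in_r_closed[OF subring ideal_nonunits _ True] by (auto simp: l_coset_mem)
    then have g_nonunit: "g \<in> nonunits V" "g \<in> V" "g \<in> carrier R"
      using g(3) nonunits_subset ring_carrier by auto
    then have "g \<notin> k" using meets_nonunits_trivially[OF k(1,3)] g(2) by blast
    then have "finite_dimension (generate_field R (insert g k)) F"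
      using finite_dimension_over_nonconstant[OF k(1) subfield _ _ fin g(1)] k(3) w ring_subset by blast
    then have "finite_index V (g <# V)" by (rule finite_index_over_rational[OF k g_nonunit(1) g(2)])
    moreover have "g <# V \<subseteq> z <# V" using l_coset_subset[OF subring zR g(3)] .
    ultimately show ?thesis
      using finite_index_antimono[OF ideal_inD(1)[OF subring ideal[OF g_nonunit(2)]]
          ideal_inD(1)[OF subring ideal[OF z(1)]] ring_carrier] by blast
  qed
qed

end

theorem (in field) function_field_place_discrete:
  assumes F: "function_field R k F" and fin: "finite k" and P: "P \<in> places R k F"
  shows "discrete_place R F P"
proof -
  let ?V = "ring_of_place R F P"
  have k: "subfield k R" and Ff: "subfield F R" using F by (auto simp: function_field_def)
  obtain x where x: "x \<in> F" "transcendental k x" "finite_dimension (generate_field R (insert x k)) F"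
    using F by (auto simp: function_field_def)
  note place = valuation_ring_of_place[OF Ff P]
  have V: "val_ring R F ?V" "k \<subseteq> ?V" "?V \<noteq> F" using place(1) valuation_ring_iff[OF Ff] by auto
  interpret V: val_ring R F ?V by (rule V(1))
  have xR: "x \<in> carrier R" using x(1) V.field_carrier by blast
  have x0: "x \<noteq> \<zero>" using x(2) zero_is_algebraic[OF subfieldE(1)[OF k]] by (auto simp: over_def)
  obtain w where w: "w \<in> ?V" "generate_field R (insert w k) = generate_field R (insert x k)"
    using V.total[OF x(1) x0] generate_insert_inv[OF k xR x0] by blast
  show ?thesis
  proof (intro discrete_place.intro discrete_place_axioms.intro V(1,3) place(2))
    show "finite_index ?V (z <# ?V)" if "z \<in> ?V" "z \<noteq> \<zero>" for z
      using V.finite_index_principal[OF k fin V(2) w(1) _ that] x(3) w(2) by simp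
  qed
qed

section \<open>Spans over subrings\<close>

context cring
begin

lemma Span_Cons_iff: "x \<in> Span J (u # Us) \<longleftrightarrow> (\<exists>a\<in>J. \<exists>v\<in>Span J Us. x = a \<otimes> u \<oplus> v)"
  by (simp add: line_extension_mem_iff)

lemma Span_subgroup:
  assumes J: "additive_subgroup J R" and Us: "set Us \<subseteq> carrier R"
  shows "additive_subgroup (Span J Us) R"
  using Us
proof (induction Us)
  case Nil
  show ?case by (intro additive_subgroup_minusI) auto
next
  case (Cons u Us)
  then have IH: "additive_subgroup (Span J Us) R" and uR: "u \<in> carrier R" by auto
  note subset = subsetD[OF additive_subgroup.a_subset[OF J]] subsetD[OF additive_subgroup.a_subset[OF IH]]
  show ?case
  proof (rule additive_subgroup_minusI)
    show "Span J (u # Us) \<subseteq> carrier R"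
    proof
      fix x assume "x \<in> Span J (u # Us)"
      then obtain a v where "a \<in> J" "v \<in> Span J Us" "x = a \<otimes> u \<oplus> v" unfolding Span_Cons_iff by blast
      then show "x \<in> carrier R" using subset uR by simp
    qed
    have "\<zero> = \<zero> \<otimes> u \<oplus> \<zero>" using uR by simp
    then show "\<zero> \<in> Span J (u # Us)"
      using additive_subgroup.zero_closed[OF J] additive_subgroup.zero_closed[OF IH]
      unfolding Span_Cons_iff by blast
    fix x y assume "x \<in> Span J (u # Us)" "y \<in> Span J (u # Us)"
    then obtain a v b w where x: "a \<in> J" "v \<in> Span J Us" "x = a \<otimes> u \<oplus> v"
        and y: "b \<in> J" "w \<in> Span J Us" "y = b \<otimes> u \<oplus> w"
      unfolding Span_Cons_iff by blast
    then have "a \<in> carrier R" "v \<in> carrier R" "b \<in> carrier R" "w \<in> carrier R" using subset by auto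
    then have "x \<ominus> y = (a \<ominus> b) \<otimes> u \<oplus> (v \<ominus> w)" unfolding x(3) y(3) using uR by algebra
    then show "x \<ominus> y \<in> Span J (u # Us)"
      using additive_subgroup_minus_closed[OF J x(1) y(1)] additive_subgroup_minus_closed[OF IH x(2) y(2)]
      unfolding Span_Cons_iff by blast
  qed
qed

lemma Span_mult:
  assumes V: "V \<subseteq> carrier R" and s: "s \<in> carrier R" "\<And>a. a \<in> V \<Longrightarrow> s \<otimes> a \<in> J"
    and Us: "set Us \<subseteq> carrier R" and x: "x \<in> Span V Us"
  shows "s \<otimes> x \<in> Span J Us"
  using Us x
proof (induction Us arbitrary: x)
  case (Cons u Us)
  then have uR: "u \<in> carrier R" "set Us \<subseteq> carrier R" by auto
  obtain a v where x: "a \<in> V" "v \<in> Span V Us" "x = a \<otimes> u \<oplus> v"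
    using Cons(3) unfolding Span_Cons_iff by blast
  have "a \<in> carrier R" "v \<in> carrier R" using x(1,2) V Span_in_carrier[OF V uR(2)] by auto
  then have "s \<otimes> x = (s \<otimes> a) \<otimes> u \<oplus> s \<otimes> v" unfolding x(3) using uR(1) s(1) by (simp add: r_distr m_assoc)
  then show ?case using s(2)[OF x(1)] Cons.IH[OF uR(2) x(2)] unfolding Span_Cons_iff by blast
qed (use s in simp)

lemma Span_iff_combine:
  "x \<in> Span V Us \<longleftrightarrow> (\<exists>as. set as \<subseteq> V \<and> length as = length Us \<and> x = combine as Us)"
proof (induction Us arbitrary: x)
  case (Cons u Us)
  show ?case
  proof
    assume "x \<in> Span V (u # Us)"
    then obtain a v where x: "a \<in> V" "v \<in> Span V Us" "x = a \<otimes> u \<oplus> v" unfolding Span_Cons_iff by blast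
    then obtain as where "set as \<subseteq> V" "length as = length Us" "v = combine as Us" using Cons.IH by blast
    then show "\<exists>as. set as \<subseteq> V \<and> length as = length (u # Us) \<and> x = combine as (u # Us)"
      using x by (intro exI[of _ "a # as"]) simp
  next
    assume "\<exists>as. set as \<subseteq> V \<and> length as = length (u # Us) \<and> x = combine as (u # Us)"
    then obtain a as where "a \<in> V" "set as \<subseteq> V" "length as = length Us" "x = a \<otimes> u \<oplus> combine as Us"
      by (auto simp: length_Suc_conv)
    then show "x \<in> Span V (u # Us)" using Cons.IH unfolding Span_Cons_iff by blast
  qed
qed simp

lemma Span_mono: "V \<subseteq> W \<Longrightarrow> Span V Us \<subseteq> Span W Us"
  unfolding Span_iff_combine subset_iff by blast

lemma Span_subset:
  assumes M: "additive_subgroup M R" and mult: "\<And>a u. a \<in> V \<Longrightarrow> u \<in> set Us \<Longrightarrow> a \<otimes> u \<in> M"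
  shows "Span V Us \<subseteq> M"
proof
  fix x assume "x \<in> Span V Us"
  then obtain as where "set as \<subseteq> V" "x = combine as Us" unfolding Span_iff_combine by blast
  then show "x \<in> M" using combine_mem[OF M mult] by blast
qed

lemma mem_Span:
  assumes V: "subring V R" and Us: "set Us \<subseteq> carrier R"
  shows "set Us \<subseteq> Span V Us"
  using Us
proof (induction Us)
  case (Cons u Us)
  note zero = subringE(2)[OF V] and Span_Us = Span_subgroup[OF subring_additive_subgroup[OF V], of Us]
  have "u = \<one> \<otimes> u \<oplus> \<zero>" "\<zero> \<in> Span V Us" using Cons additive_subgroup.zero_closed[OF Span_Us] by auto
  then have "u \<in> Span V (u # Us)" using subringE(3)[OF V] unfolding Span_Cons_iff by blast
  moreover have "x \<in> Span V (u # Us)" if "x \<in> Span V Us" for x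
  proof -
    have "x = \<zero> \<otimes> u \<oplus> x" using that Cons(2) additive_subgroup.a_subset[OF Span_Us] by auto
    then show ?thesis using zero that unfolding Span_Cons_iff by blast
  qed
  ultimately have "insert u (set Us) \<subseteq> Span V (u # Us)" using Cons by auto
  then show ?case by (simp only: list.set)
qed simp

lemma additive_subgroup_mult_vimage:
  assumes M: "additive_subgroup M R" and x: "x \<in> carrier R"
  shows "additive_subgroup {y \<in> carrier R. x \<otimes> y \<in> M} R"
proof (rule additive_subgroup_minusI)
  show "\<zero> \<in> {y \<in> carrier R. x \<otimes> y \<in> M}" using additive_subgroup.zero_closed[OF M] x by simp
  fix y z assume yz: "y \<in> {y \<in> carrier R. x \<otimes> y \<in> M}" "z \<in> {y \<in> carrier R. x \<otimes> y \<in> M}"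
  then have "x \<otimes> (y \<ominus> z) = x \<otimes> y \<ominus> x \<otimes> z" using x by (simp add: a_minus_def r_distr r_minus)
  then show "y \<ominus> z \<in> {y \<in> carrier R. x \<otimes> y \<in> M}" using yz additive_subgroup_minus_closed[OF M] by auto
qed auto

lemma subring_Span:
  assumes V: "subring V R" and Us: "set Us \<subseteq> carrier R" and one: "\<one> \<in> Span V Us"
    and mult: "\<And>u v. u \<in> set Us \<Longrightarrow> v \<in> set Us \<Longrightarrow> u \<otimes> v \<in> Span V Us"
  shows "subring (Span V Us) R"
proof -
  note VR = subringE(1)[OF V]
  note Span = Span_subgroup[OF subring_additive_subgroup[OF V] Us]
  note SpanR = additive_subgroup.a_subset[OF Span]
  have scale: "a \<otimes> x \<in> Span V Us" if "a \<in> V" "x \<in> Span V Us" for a x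
    using Span_mult[OF VR _ subringE(6)[OF V that(1)] Us that(2)] that(1) VR by blast
  have mult_left: "x \<otimes> y \<in> Span V Us"
    if x: "x \<in> carrier R" and xu: "\<And>u. u \<in> set Us \<Longrightarrow> x \<otimes> u \<in> Span V Us" and y: "y \<in> Span V Us" for x y
  proof -
    have "a \<otimes> u \<in> {y \<in> carrier R. x \<otimes> y \<in> Span V Us}" if "a \<in> V" "u \<in> set Us" for a u
    proof -
      have R: "a \<in> carrier R" "u \<in> carrier R" using that VR Us by auto
      then have "x \<otimes> (a \<otimes> u) = a \<otimes> (x \<otimes> u)" using x by (simp add: m_lcomm)
      then show ?thesis using R scale[OF that(1) xu[OF that(2)]] by simp
    qed
    then show ?thesis using Span_subset[OF additive_subgroup_mult_vimage[OF Span x]] y by blast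
  qed
  have "x \<otimes> u \<in> Span V Us" if "x \<in> Span V Us" "u \<in> set Us" for x u
  proof -
    have R: "x \<in> carrier R" "u \<in> carrier R" using that SpanR Us by auto
    then show ?thesis using mult_left[OF R(2) mult[OF that(2)] that(1)] by (simp add: m_comm)
  qed
  then have "x \<otimes> y \<in> Span V Us" if "x \<in> Span V Us" "y \<in> Span V Us" for x y
    using mult_left that SpanR by blast
  then show ?thesis
    using SpanR one additive_subgroup.a_closed[OF Span] additive_subgroup.a_inv_closed[OF Span]
    by (intro subringI)
qed

end

section \<open>Extension of places\<close>

context cring
begin

lemmas Span_exp_base_subgroup = Span_subgroup[OF _ exp_base_closed]
lemmas Span_exp_base_carrier = subsetD[OF additive_subgroup.a_subset[OF Span_exp_base_subgroup]]
lemmas Span_exp_base_zero = additive_subgroup.zero_closed[OF Span_exp_base_subgroup]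

lemma Span_exp_base_Suc:
  "x \<in> Span J (exp_base z (Suc n)) \<longleftrightarrow> (\<exists>a\<in>J. \<exists>v\<in>Span J (exp_base z n). x = a \<otimes> z [^] n \<oplus> v)"
  unfolding exp_base_def by (simp add: line_extension_mem_iff)

lemma Span_exp_base_mono:
  assumes J: "additive_subgroup J R" and z: "z \<in> carrier R" and "n \<le> m"
  shows "Span J (exp_base z n) \<subseteq> Span J (exp_base z m)"
  using \<open>n \<le> m\<close>
proof (induction m rule: dec_induct)
  case (step m)
  have "v \<in> Span J (exp_base z (Suc m))" if v: "v \<in> Span J (exp_base z m)" for v
  proof -
    have "v \<in> carrier R" using Span_exp_base_carrier[OF J z v] .
    then have "v = \<zero> \<otimes> z [^] m \<oplus> v" using z by simp
    then show ?thesis using v additive_subgroup.zero_closed[OF J] unfolding Span_exp_base_Suc by blast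
  qed
  then show ?case using step.IH by blast
qed simp

lemma power_mem_Span_exp_base:
  assumes J: "additive_subgroup J R" and z: "z \<in> carrier R" and a: "a \<in> J" and less: "i < n"
  shows "a \<otimes> z [^] i \<in> Span J (exp_base z n)"
proof -
  have "a \<in> carrier R" using a additive_subgroup.a_subset[OF J] by blast
  then have "a \<otimes> z [^] i = a \<otimes> z [^] i \<oplus> \<zero>" using z by simp
  moreover have "\<zero> \<in> Span J (exp_base z i)" by (rule Span_exp_base_zero[OF J z])
  ultimately have "a \<otimes> z [^] i \<in> Span J (exp_base z (Suc i))"
    using a unfolding Span_exp_base_Suc by blast
  then show ?thesis using Span_exp_base_mono[OF J z, of "Suc i" n] less by auto
qed

lemma mult_mem_Span_exp_base:
  assumes J: "additive_subgroup J R" and z: "z \<in> carrier R"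
  shows "v \<in> Span J (exp_base z n) \<Longrightarrow> v \<otimes> z \<in> Span J (exp_base z (Suc n))"
proof (induction n arbitrary: v)
  case 0
  then have "v \<otimes> z = \<zero>" using z by (simp add: exp_base_def)
  then show ?case using Span_exp_base_zero[OF J z, of "Suc 0"] by simp
next
  case (Suc n)
  obtain a w where v: "a \<in> J" "w \<in> Span J (exp_base z n)" "v = a \<otimes> z [^] n \<oplus> w"
    using Suc.prems unfolding Span_exp_base_Suc by blast
  have "w \<in> carrier R" "a \<in> carrier R"
    using v(1) Span_exp_base_carrier[OF J z v(2)] additive_subgroup.a_subset[OF J] by auto
  then have "v \<otimes> z = a \<otimes> z [^] Suc n \<oplus> w \<otimes> z" unfolding v(3) using z by (simp add: l_distr m_assoc)
  then show ?case using v(1) Suc.IH[OF v(2)] unfolding Span_exp_base_Suc[of _ J z "Suc n"] by blast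
qed

lemma ideal_in_ideal_prod:
  assumes S: "subring S R" and I: "I \<subseteq> S" "\<zero> \<in> I"
  shows "ideal_in (I \<cdot> S) S"
proof (rule ideal_in_minusI[OF S])
  note SR = subringE(1)[OF S]
  show sub: "I \<cdot> S \<subseteq> S"
  proof
    fix x assume "x \<in> I \<cdot> S"
    then show "x \<in> S" by (induction x rule: ideal_prod.induct) (use I(1) subringE(6,7)[OF S] in auto)
  qed
  have "\<zero> \<otimes> \<zero> \<in> I \<cdot> S" using ideal_prod.prod[OF I(2) subringE(2)[OF S]] .
  then show "\<zero> \<in> I \<cdot> S" by simp
  show mult: "a \<otimes> x \<in> I \<cdot> S" if a: "a \<in> S" and x: "x \<in> I \<cdot> S" for a x
    using x
  proof (induction x rule: ideal_prod.induct)
    case (prod i j)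
    have "a \<otimes> (i \<otimes> j) = i \<otimes> (a \<otimes> j)" using prod a I(1) SR by (intro m_lcomm) auto
    then show ?case using ideal_prod.prod[OF prod(1) subringE(6)[OF S a prod(2)], of R] by simp
  next
    case (sum x y)
    have "a \<otimes> (x \<oplus> y) = a \<otimes> x \<oplus> a \<otimes> y" using sum(1,2) a sub SR by (intro r_distr) auto
    then show ?case using ideal_prod.sum[OF sum(3,4)] by simp
  qed
  fix x y assume xy: "x \<in> I \<cdot> S" "y \<in> I \<cdot> S"
  have "\<ominus> \<one> \<otimes> y \<in> I \<cdot> S" using mult[OF _ xy(2)] subringE(3,5)[OF S] by blast
  moreover have "\<ominus> \<one> \<otimes> y = \<ominus> y" using xy(2) sub SR by (auto simp: l_minus)
  ultimately show "x \<ominus> y \<in> I \<cdot> S" using ideal_prod.sum[OF xy(1)] by (simp add: a_minus_def)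
qed

lemma ideal_prod_subset_ideal:
  assumes "subring S R" "ideal_in I S"
  shows "I \<cdot> S \<subseteq> I"
proof
  fix x assume "x \<in> I \<cdot> S"
  then show "x \<in> I"
    by (induction x rule: ideal_prod.induct)
      (use ideal_inD[OF assms] ideal_in_r_closed[OF assms] additive_subgroup.a_closed in auto)
qed

lemma subring_Union_chain:
  assumes "subset.chain \<A> \<C>" "\<C> \<noteq> {}" and \<A>: "\<And>S. S \<in> \<A> \<Longrightarrow> subring S R"
  shows "subring (\<Union>\<C>) R"
proof (rule subringI)
  have C: "subring S R" if "S \<in> \<C>" for S using that assms(1) \<A> by (auto simp: subset.chain_def)
  obtain S where "S \<in> \<C>" using assms(2) by blast
  then show "\<one> \<in> \<Union>\<C>" using subringE(3)[OF C] by blast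
  show "\<Union>\<C> \<subseteq> carrier R" using subringE(1)[OF C] by blast
  show "\<ominus> a \<in> \<Union>\<C>" if "a \<in> \<Union>\<C>" for a using that subringE(5)[OF C] by blast
  fix a b assume "a \<in> \<Union>\<C>" "b \<in> \<Union>\<C>"
  then obtain S T where "S \<in> \<C>" "a \<in> S" "T \<in> \<C>" "b \<in> T" by blast
  moreover from this have "S \<subseteq> T \<or> T \<subseteq> S" using assms(1) by (auto simp: subset.chain_def)
  ultimately obtain T where T: "T \<in> \<C>" "a \<in> T" "b \<in> T" by blast
  show "a \<oplus> b \<in> \<Union>\<C>" "a \<otimes> b \<in> \<Union>\<C>" using subringE(6,7)[OF C[OF T(1)] T(2,3)] T(1) by blast+
qed

lemma ideal_prod_Union_chain:
  assumes chain: "subset.chain \<A> \<C>" and x: "x \<in> I \<cdot> \<Union>\<C>"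
  shows "\<exists>S\<in>\<C>. x \<in> I \<cdot> S"
  using x
proof (induction x rule: ideal_prod.induct)
  case (prod i j)
  then show ?case using ideal_prod.prod by fast
next
  case (sum x y)
  then obtain S T where ST: "S \<in> \<C>" "x \<in> I \<cdot> S" "T \<in> \<C>" "y \<in> I \<cdot> T" by blast
  have mono: "x \<in> I \<cdot> S \<Longrightarrow> S \<subseteq> T \<Longrightarrow> x \<in> I \<cdot> T" for x S T
    by (induction x rule: ideal_prod.induct) (auto intro: ideal_prod.intros)
  have "S \<subseteq> T \<or> T \<subseteq> S" using ST(1,3) chain by (auto simp: subset.chain_def)
  then obtain U where "U \<in> \<C>" "x \<in> I \<cdot> U" "y \<in> I \<cdot> U" using ST mono by metis
  then show ?case using ideal_prod.sum by metis
qed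

end

context field
begin

lemma ideal_prod_simple_extension:
  assumes S: "subring S R" and I: "I \<subseteq> S" "ideal_in (I \<cdot> S) S" and z: "z \<in> carrier R"
    and x: "x \<in> I \<cdot> simple_extension S z"
  shows "\<exists>n. x \<in> Span (I \<cdot> S) (exp_base z n)"
  using x
proof (induction x rule: ideal_prod.induct)
  note J = ideal_inD(1)[OF S I(2)] and SR = subringE(1)[OF S]
  note add = additive_subgroup.a_closed[OF Span_exp_base_subgroup[OF J z]]
  {
    case (prod i s)
    have iR: "i \<in> carrier R" using prod(1) I(1) SR by blast
    from prod(2) show ?case
    proof (induction s rule: simple_extension.induct)
      case zero
      then show ?case using iR Span_exp_base_zero[OF J z] by auto
    next
      case (lin h b)
      obtain n where n: "i \<otimes> h \<in> Span (I \<cdot> S) (exp_base z n)" using lin(3) by blast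
      have R: "h \<in> carrier R" "b \<in> carrier R"
        using lin(1,2) SR subringE(1)[OF simple_extension_is_subring[OF S z]] by auto
      have "i \<otimes> b \<otimes> z [^] (0::nat) \<in> Span (I \<cdot> S) (exp_base z (Suc n))"
        using power_mem_Span_exp_base[OF J z] ideal_prod.prod[OF prod(1) lin(2)] by blast
      then have "i \<otimes> h \<otimes> z \<oplus> i \<otimes> b \<in> Span (I \<cdot> S) (exp_base z (Suc n))"
        using add[OF mult_mem_Span_exp_base[OF J z n]] iR R by simp
      moreover have "i \<otimes> (h \<otimes> z \<oplus> b) = i \<otimes> h \<otimes> z \<oplus> i \<otimes> b" using iR R z by (simp add: r_distr m_assoc)
      ultimately show ?case by auto
    qed
  next
    case (sum x y)
    then obtain n m where "x \<in> Span (I \<cdot> S) (exp_base z n)" "y \<in> Span (I \<cdot> S) (exp_base z m)" by blast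
    then have "x \<in> Span (I \<cdot> S) (exp_base z (max n m))" "y \<in> Span (I \<cdot> S) (exp_base z (max n m))"
      using Span_exp_base_mono[OF J z max.cobounded1] Span_exp_base_mono[OF J z max.cobounded2] by blast+
    then show ?case using add by blast
  }
qed

lemma Span_exp_base_inv:
  assumes J: "additive_subgroup J R" and z: "z \<in> carrier R" "z \<noteq> \<zero>"
    and v: "v \<in> Span J (exp_base (inv z) n)" and n: "n \<le> Suc j"
  shows "\<exists>b\<in>J. v \<otimes> z [^] j \<ominus> b \<otimes> z [^] j \<in> Span J (exp_base z j)"
  using v n
proof (induction n arbitrary: v)
  case 0
  then have "v \<otimes> z [^] j \<ominus> \<zero> \<otimes> z [^] j = \<zero>" using z(1) by (simp add: exp_base_def)
  then show ?case using Span_exp_base_zero[OF J z(1)] additive_subgroup.zero_closed[OF J] by metis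
next
  case (Suc n)
  note JR = additive_subgroup.a_subset[OF J] and inv_z = inv_nonzero[OF z]
  obtain a w where v: "a \<in> J" "w \<in> Span J (exp_base (inv z) n)" "v = a \<otimes> inv z [^] n \<oplus> w"
    using Suc.prems(1) unfolding Span_exp_base_Suc by blast
  obtain b where b: "b \<in> J" "w \<otimes> z [^] j \<ominus> b \<otimes> z [^] j \<in> Span J (exp_base z j)"
    using Suc.IH[OF v(2)] Suc.prems(2) by auto
  have R: "a \<in> carrier R" "b \<in> carrier R" "w \<in> carrier R"
    using v(1) b(1) JR Span_exp_base_carrier[OF J inv_z(1) v(2)] by auto
  show ?case
  proof (cases n)
    case 0
    then have "w = \<zero>" "v = a" using v(2,3) R by (auto simp: exp_base_def)
    then have "v \<otimes> z [^] j \<ominus> a \<otimes> z [^] j = \<zero>" using R z(1) by (simp add: a_minus_def r_neg)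
    then show ?thesis using v(1) Span_exp_base_zero[OF J z(1)] by metis
  next
    case (Suc i)
    have "z [^] j = z [^] n \<otimes> z [^] (j - n)"
      using nat_pow_mult[OF z(1), of n "j - n"] Suc.prems(2) by simp
    moreover have "inv z [^] n \<otimes> z [^] n = \<one>" using nat_pow_distrib[of "inv z" z n] inv_z z(1) by simp
    ultimately have "inv z [^] n \<otimes> z [^] j = z [^] (j - n)"
      using inv_z(1) z(1) by (simp add: m_assoc[symmetric])
    then have "v \<otimes> z [^] j \<ominus> b \<otimes> z [^] j = a \<otimes> z [^] (j - n) \<oplus> (w \<otimes> z [^] j \<ominus> b \<otimes> z [^] j)"
      unfolding v(3) using R inv_z(1) z(1) by (simp add: l_distr m_assoc a_assoc a_minus_def)
    moreover have "a \<otimes> z [^] (j - n) \<in> Span J (exp_base z j)"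
      using power_mem_Span_exp_base[OF J z(1) v(1)] Suc Suc.prems(2) by simp
    ultimately show ?thesis
      using b additive_subgroup.a_closed[OF Span_exp_base_subgroup[OF J z(1)]] by metis
  qed
qed

lemma one_in_Span_exp_base_reduce:
  assumes S: "subring S R" and J: "ideal_in J S" "\<one> \<notin> J" and z: "z \<in> carrier R" "z \<noteq> \<zero>"
    and n: "\<one> \<in> Span J (exp_base z n)" and m: "\<one> \<in> Span J (exp_base (inv z) m)" "m \<le> n"
  shows "\<exists>i<n. \<one> \<in> Span J (exp_base z i)"
proof -
  note J_facts = ideal_inD[OF S J(1)]
  note JR = additive_subgroup.a_subset[OF J_facts(1)] and SR = subringE(1)[OF S]
  have "n \<noteq> 0"
  proof
    assume "n = 0"
    then show False using n by (simp add: exp_base_def)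
  qed
  then obtain i where i: "n = Suc i" using not0_implies_Suc by blast
  note add = additive_subgroup.a_closed[OF Span_exp_base_subgroup[OF J_facts(1) z(1)]]
  have mult: "s \<otimes> x \<in> Span J (exp_base z i)" if "s \<in> S" "x \<in> Span J (exp_base z i)" for s x
    using Span_mult[OF JR _ J_facts(3) exp_base_closed[OF z(1)] that(2)] that(1) SR by blast
  obtain a v where a: "a \<in> J" "v \<in> Span J (exp_base z i)" "\<one> = a \<otimes> z [^] i \<oplus> v"
    using n unfolding i Span_exp_base_Suc by blast
  obtain b where b: "b \<in> J" "\<one> \<otimes> z [^] i \<ominus> b \<otimes> z [^] i \<in> Span J (exp_base z i)"
    using Span_exp_base_inv[OF J_facts(1) z m(1)] m(2) unfolding i by blast
  have R: "a \<in> carrier R" "b \<in> carrier R" "v \<in> carrier R"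
    using a b JR Span_exp_base_carrier[OF J_facts(1) z(1)] by auto
  have "i \<noteq> 0"
  proof
    assume "i = 0"
    then have "\<one> = a" using a(2,3) R by (simp add: exp_base_def)
    then show False using a(1) J(2) by simp
  qed
  then have b_mem: "b \<in> Span J (exp_base z i)"
    using power_mem_Span_exp_base[OF J_facts(1) z(1) b(1), of 0 i] R by simp
  have "\<one> = (\<one> \<ominus> b) \<otimes> (a \<otimes> z [^] i \<oplus> v) \<oplus> b"
    unfolding a(3)[symmetric] using R by algebra
  also have "\<dots> = (a \<otimes> (\<one> \<otimes> z [^] i \<ominus> b \<otimes> z [^] i) \<oplus> (\<one> \<ominus> b) \<otimes> v) \<oplus> b"
  proof -
    have "z [^] i \<in> carrier R" using z(1) by simp
    then show ?thesis using R by algebra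
  qed
  also have "\<dots> \<in> Span J (exp_base z i)"
  proof -
    have "a \<in> S" "b \<in> S" using a(1) b(1) J_facts(2) by auto
    moreover from this(2) have "\<one> \<ominus> b \<in> S" by (rule subring_minus_closed[OF S subringE(3)[OF S]])
    ultimately show ?thesis by (intro add mult a(2) b(2) b_mem)
  qed
  finally show ?thesis unfolding i by blast
qed

lemma one_notin_Span_exp_base_inv:
  assumes S: "subring S R" and J: "ideal_in J S" "\<one> \<notin> J" and z: "z \<in> carrier R" "z \<noteq> \<zero>"
    and n: "\<one> \<in> Span J (exp_base z n)"
  shows "\<one> \<notin> Span J (exp_base (inv z) m)"
proof
  let ?P = "\<lambda>n. \<one> \<in> Span J (exp_base z n)" and ?Q = "\<lambda>m. \<one> \<in> Span J (exp_base (inv z) m)"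
  assume "?Q m"
  then have Least: "?P (Least ?P)" "?Q (Least ?Q)" using n by (auto intro: LeastI)
  note inv_z = inv_nonzero[OF z]
  consider (left) "Least ?Q \<le> Least ?P" | (right) "Least ?P \<le> Least ?Q" by linarith
  then show False
  proof cases
    case left
    then obtain i where "i < Least ?P" "?P i" using one_in_Span_exp_base_reduce[OF S J z Least] by blast
    then show False using not_less_Least by blast
  next
    case right
    then obtain i where "i < Least ?Q" "?Q i"
      using one_in_Span_exp_base_reduce[OF S J inv_z(1,2) Least(2)] Least(1) inv_z(5) by auto
    then show False using not_less_Least by blast
  qed
qed

lemma maximal_subring_is_val_ring:
  assumes E: "subfield E R" and S: "subring S R" "S \<subseteq> E" and I: "I \<subseteq> S" "\<zero> \<in> I" "\<one> \<notin> I \<cdot> S"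
    and maximal: "\<And>T. subring T R \<Longrightarrow> S \<subseteq> T \<Longrightarrow> T \<subseteq> E \<Longrightarrow> \<one> \<notin> I \<cdot> T \<Longrightarrow> T = S"
  shows "val_ring R E S"
proof (intro val_ring.intro val_ring_axioms.intro field_axioms E S)
  note ideal = ideal_in_ideal_prod[OF S(1) I(1,2)] and ER = subfieldE(3)[OF E]
  have exists_eq: "\<exists>n. \<one> \<in> Span (I \<cdot> S) (exp_base z n)" if z: "z \<in> E" "z \<notin> S" for z
  proof -
    have zR: "z \<in> carrier R" using z(1) ER by blast
    have "simple_extension S z \<subseteq> E"
      using simple_extension_subring_incl[OF subfieldE(1)[OF E] S(2) z(1)] .
    moreover have "S \<subseteq> simple_extension S z" "z \<in> simple_extension S z"
      using simple_extension_incl[OF subringE(1)[OF S(1)] zR] simple_extension_mem[OF S(1) zR] by auto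
    ultimately have "\<one> \<in> I \<cdot> simple_extension S z"
      using maximal[OF simple_extension_is_subring[OF S(1) zR]] z(2) by blast
    then show ?thesis by (rule ideal_prod_simple_extension[OF S(1) I(1) ideal zR])
  qed
  fix z assume z: "z \<in> E" "z \<noteq> \<zero>"
  show "z \<in> S \<or> inv z \<in> S"
  proof (rule ccontr)
    assume "\<not> ?thesis"
    then obtain n m where "\<one> \<in> Span (I \<cdot> S) (exp_base z n)" "\<one> \<in> Span (I \<cdot> S) (exp_base (inv z) m)"
      using exists_eq z subfield_inv(1)[OF E z] by blast
    then show False using one_notin_Span_exp_base_inv[OF S(1) ideal I(3)] z ER by blast
  qed
qed

theorem chevalley_extension:
  assumes E: "subfield E R" and A: "subring A R" "A \<subseteq> E" and I: "ideal_in I A" "\<one> \<notin> I"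
  obtains V where "val_ring R E V" "A \<subseteq> V" "I \<subseteq> nonunits V"
proof -
  define \<A> where "\<A> = {S. subring S R \<and> A \<subseteq> S \<and> S \<subseteq> E \<and> \<one> \<notin> I \<cdot> S}"
  note I_facts = ideal_inD[OF A(1) I(1)]
  have "A \<in> \<A>" using A I(2) ideal_prod_subset_ideal[OF A(1) I(1)] by (auto simp: \<A>_def)
  moreover have "\<Union>\<C> \<in> \<A>" if "\<C> \<noteq> {}" "subset.chain \<A> \<C>" for \<C>
  proof -
    have "\<C> \<subseteq> \<A>" using that(2) by (simp add: subset.chain_def)
    then show ?thesis
      using subring_Union_chain[OF that(2,1)] ideal_prod_Union_chain[OF that(2), of \<one> I] that(1)
      unfolding \<A>_def by blast
  qed
  ultimately obtain S where S: "S \<in> \<A>" and maximal: "\<And>T. T \<in> \<A> \<Longrightarrow> S \<subseteq> T \<Longrightarrow> T = S"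
    using subset_Zorn_nonempty[of \<A>] by blast
  have S_facts: "subring S R" "A \<subseteq> S" "S \<subseteq> E" "\<one> \<notin> I \<cdot> S" using S by (auto simp: \<A>_def)
  have IS: "I \<subseteq> S" "\<zero> \<in> I" using I_facts S_facts(2) additive_subgroup.zero_closed by auto
  have "val_ring R E S"
    using maximal S_facts(2) unfolding \<A>_def
    by (intro maximal_subring_is_val_ring[OF E S_facts(1,3) IS S_facts(4)]) auto
  moreover have "I \<subseteq> nonunits S"
  proof
    fix a assume a: "a \<in> I"
    have "inv a \<notin> S" if "a \<noteq> \<zero>"
      using ideal_prod.prod[of a I "inv a" S R] inv_nonzero(3)[of a] that a S_facts(4)
        IS(1) subringE(1)[OF S_facts(1)] by auto
    then show "a \<in> nonunits S" using a IS(1) by (auto simp: nonunits_def)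
  qed
  ultimately show ?thesis using that S_facts(2) by blast
qed

end

section \<open>Extensions of function fields\<close>

lemma (in val_ring) nonunits_inter_subfield:
  assumes K: "subfield K R" "K \<subseteq> F"
  shows "nonunits (V \<inter> K) = nonunits V \<inter> K"
  using subfield_inv(1)[OF K(1)] by (auto simp: nonunits_def)

lemma (in ring) set_add_l_coset_mem:
  "x \<in> P <+> (w <# A) \<longleftrightarrow> (\<exists>p\<in>P. \<exists>a\<in>A. x = p \<oplus> w \<otimes> a)"
  by (auto simp: set_add_def' l_coset_def)

lemma (in field) ideal_in_simple_extension:
  assumes V: "subring V R" and P: "ideal_in P V" and w: "w \<in> carrier R"
  shows "ideal_in (P <+> (w <# simple_extension V w)) (simple_extension V w)"
proof -
  let ?A = "simple_extension V w" and ?I = "P <+>\<^bsub>R\<^esub> (w <# simple_extension V w)"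
  have A: "subring ?A R" using simple_extension_is_subring[OF V w] .
  have VR: "V \<subseteq> carrier R" and AR: "?A \<subseteq> carrier R" using subringE(1) V A by auto
  note P_facts = ideal_inD[OF V P]
  have VA: "V \<subseteq> ?A" and wA: "w \<in> ?A"
    using simple_extension_incl[OF VR w] simple_extension_mem[OF V w] by auto
  have memI: "p \<oplus> w \<otimes> a \<in> ?I" if "p \<in> P" "a \<in> ?A" for p a
    using that unfolding set_add_l_coset_mem by blast
  have memE: "\<exists>p\<in>P. \<exists>a\<in>?A. x = p \<oplus> w \<otimes> a" if "x \<in> ?I" for x
    using that unfolding set_add_l_coset_mem by blast
  have PA: "p \<in> ?A" "p \<in> carrier R" if "p \<in> P" for p using that P_facts(2) VA AR by auto
  show ?thesis
  proof (rule ideal_in_minusI[OF A])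
    show "?I \<subseteq> ?A" using memE PA(1) wA subringE(6,7)[OF A] by fast
    have "\<zero> = \<zero> \<oplus> w \<otimes> \<zero>" using w by simp
    then show "\<zero> \<in> ?I"
      using memI[OF additive_subgroup.zero_closed[OF P_facts(1)] subringE(2)[OF A]] by simp
    fix x assume "x \<in> ?I"
    then obtain p a where x: "p \<in> P" "a \<in> ?A" "x = p \<oplus> w \<otimes> a" using memE by blast
    note R = PA(2)[OF x(1)] subsetD[OF AR x(2)]
    show "s \<otimes> x \<in> ?I" if s: "s \<in> ?A" for s
    proof -
      obtain h b where h: "h \<in> ?A" "b \<in> V" "s = h \<otimes> w \<oplus> b" by (rule simple_extensionE[OF V w s])
      have "h \<in> carrier R" "b \<in> carrier R" using h(1,2) AR VR by auto
      then have "s \<otimes> x = b \<otimes> p \<oplus> w \<otimes> (h \<otimes> p \<oplus> s \<otimes> a)" unfolding x(3) h(3) using R w by algebra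
      moreover have "h \<otimes> p \<oplus> s \<otimes> a \<in> ?A" using h(1) s x(2) PA(1)[OF x(1)] subringE(6,7)[OF A] by blast
      ultimately show ?thesis using memI[OF P_facts(3)[OF h(2) x(1)]] by simp
    qed
    fix y assume "y \<in> ?I"
    then obtain q b where y: "q \<in> P" "b \<in> ?A" "y = q \<oplus> w \<otimes> b" using memE by blast
    note R' = PA(2)[OF y(1)] subsetD[OF AR y(2)]
    have "x \<ominus> y = (p \<ominus> q) \<oplus> w \<otimes> (a \<ominus> b)" unfolding x(3) y(3) using R R' w by algebra
    then show "x \<ominus> y \<in> ?I"
      using memI[OF additive_subgroup_minus_closed[OF P_facts(1) x(1) y(1)]
          subring_minus_closed[OF A x(2) y(2)]] by simp
  qed
qed

context field
begin

lemma scaled_simple_extension_inv: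
  assumes V: "subring V R" and z: "z \<in> carrier R" "z \<noteq> \<zero>" and s: "s \<in> simple_extension V (inv z)"
  shows "\<exists>q n. set q \<subseteq> V \<and> length q = Suc n \<and> z [^] n \<otimes> s = eval q z"
  using s
proof (induction s rule: simple_extension.induct)
  case zero
  have "z [^] (0::nat) \<otimes> \<zero> = eval [\<zero>] z" using z(1) by simp
  then show ?case using subringE(2)[OF V] by (intro exI[of _ "[\<zero>]"] exI[of _ "0::nat"]) simp
next
  case (lin h b)
  note inv_z = inv_nonzero[OF z]
  obtain q n where q: "set q \<subseteq> V" "length q = Suc n" "z [^] n \<otimes> h = eval q z" using lin.IH by blast
  have qR: "set q \<subseteq> carrier R" using q(1) subringE(1)[OF V] by blast
  have R: "h \<in> carrier R" "b \<in> carrier R"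
    using lin.hyps subringE(1)[OF V] subringE(1)[OF simple_extension_is_subring[OF V inv_z(1)]] by auto
  have "z [^] Suc n \<otimes> (h \<otimes> inv z \<oplus> b) = (z [^] n \<otimes> h) \<otimes> (z \<otimes> inv z) \<oplus> b \<otimes> z [^] Suc n"
    using z(1) R inv_z(1) by (simp add: r_distr m_ac)
  also have "\<dots> = eval (b # q) z"
    using q(2,3) inv_z(3) z(1) R eval_in_carrier[OF qR z(1)] by (simp add: a_comm)
  finally have "z [^] Suc n \<otimes> (h \<otimes> inv z \<oplus> b) = eval (b # q) z" .
  then show ?case using q lin.hyps(2) by (intro exI[of _ "b # q"] exI[of _ "Suc n"]) simp
qed

lemma mem_integral_closureI:
  assumes V: "subring V R" and z: "z \<in> E" "z \<in> carrier R" "z \<noteq> \<zero>" and mem: "z \<in> simple_extension V (inv z)"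
  shows "z \<in> integral_closure_in R V E"
proof -
  have "\<ominus> z \<in> simple_extension V (inv z)"
    using subringE(5)[OF simple_extension_is_subring[OF V inv_nonzero(1)[OF z(2,3)]] mem] .
  then obtain q n where q: "set q \<subseteq> V" "length q = Suc n" "z [^] n \<otimes> (\<ominus> z) = eval q z"
    using scaled_simple_extension_inv[OF V z(2,3)] by blast
  have "eval (\<one> # q) z = z [^] Suc n \<oplus> z [^] n \<otimes> (\<ominus> z)" using q z(2) by simp
  also have "\<dots> = \<zero>" using z(2) by (simp add: r_minus r_neg)
  finally have "eval (\<one> # q) z = \<zero>" .
  moreover have "polynomial V (\<one> # q)" using q(1) subringE(3)[OF V] by (simp add: polynomial_def)
  ultimately show ?thesis unfolding integral_closure_in_def using z(1) by force
qed

end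

lemma (in discrete_place) mem_simple_extension_of_unit_ideal:
  assumes w: "w \<in> carrier R" and z: "z \<in> carrier R" "z \<otimes> w = \<one>"
    and one: "\<one> \<in> P <+> (w <# simple_extension (\<O> F P) w)"
  shows "z \<in> simple_extension (\<O> F P) w"
proof -
  let ?A = "simple_extension (\<O> F P) w"
  note A = simple_extension_is_subring[OF subring w]
  obtain p s where p: "p \<in> P" and s: "s \<in> ?A" and eq: "\<one> = p \<oplus> w \<otimes> s"
    using one unfolding set_add_l_coset_mem by blast
  have R: "p \<in> carrier R" "s \<in> carrier R" using p s carrier_subset subringE(1)[OF A] by auto
  have "\<one> \<ominus> p \<notin> P"
  proof
    assume "\<one> \<ominus> p \<in> P"
    then have "(\<one> \<ominus> p) \<oplus> p \<in> P" using additive_subgroup.a_closed[OF place_subgroup _ p] by blast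
    moreover have "(\<one> \<ominus> p) \<oplus> p = \<one>" using R by algebra
    ultimately show False using one_notin_place by simp
  qed
  moreover have "\<one> \<ominus> p \<in> \<O> F P"
    using subring_minus_closed[OF subring subringE(3)[OF subring]] p place_subset by blast
  ultimately have "\<one> \<ominus> p \<in> Units (local_ring R F P)" by (simp add: Units_local_ring)
  note unit = unitE[OF this]
  note inv_unit = inv_nonzero[OF unit(3,4)]
  have "\<one> \<ominus> p = w \<otimes> s"
  proof -
    have "(p \<oplus> w \<otimes> s) \<ominus> p = w \<otimes> s" using R w by algebra
    then show ?thesis using eq by simp
  qed
  then have "z = z \<otimes> (inv (\<one> \<ominus> p) \<otimes> (w \<otimes> s))" using inv_unit(4) z(1) by simp
  also have "\<dots> = (z \<otimes> w) \<otimes> (inv (\<one> \<ominus> p) \<otimes> s)" using z(1) w inv_unit(1) R by (simp add: m_ac)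
  also have "\<dots> = inv (\<one> \<ominus> p) \<otimes> s" using z(2) inv_unit(1) R by simp
  also have "\<dots> \<in> ?A"
    using subringE(6)[OF A _ s] unit(5) simple_extension_incl[OF ring_carrier w] by blast
  finally show ?thesis .
qed

locale constant_field = field R for R (structure) +
  fixes k
  assumes subfield_constants: "subfield k R" and finite_constants: "finite k"
begin

abbreviation "ff \<equiv> function_field R k"
abbreviation "places_of \<equiv> places R k"
abbreviation "places_above \<equiv> places_over R k"
abbreviation "ram \<equiv> ramification_index R"
abbreviation "rel_deg \<equiv> relative_degree R"
abbreviation "deg_of \<equiv> place_degree R k"

lemma ff_subfield: "ff F \<Longrightarrow> subfield F R"
  and ff_constants: "ff F \<Longrightarrow> k \<subseteq> F"
  by (simp_all add: function_field_def)

lemma ff_discrete_place: "ff F \<Longrightarrow> P \<in> places_of F \<Longrightarrow> discrete_place R F P"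
  using function_field_place_discrete finite_constants by blast

lemma places_aboveD:
  assumes "Q \<in> places_above E P"
  shows "Q \<in> places_of E" "P \<subseteq> Q"
  using assms by (auto simp: places_over_def)

lemma constants_subset:
  assumes "ff F" "P \<in> places_of F"
  shows "k \<subseteq> \<O> F P"
  using valuation_ring_of_place(1)[OF ff_subfield[OF assms(1)] assms(2)]
  by (auto simp: valuation_ring_def)

lemma nonunits_in_places:
  assumes F: "ff F" and V: "val_ring R F V" "k \<subseteq> V" and a: "a \<in> nonunits V" "a \<noteq> \<zero>"
  shows "nonunits V \<in> places_of F"
proof -
  interpret V: val_ring R F V by (rule V(1))
  have "a \<notin> k" using V.meets_nonunits_trivially[OF subfield_constants V(2)] a by blast
  then have "k \<subset> V" using V(2) a(1) V.nonunits_subset by blast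
  moreover have "V \<noteq> F" using subfield_inv(1)[OF V.subfield _ a(2)] a by (auto simp: nonunits_def)
  ultimately show ?thesis using V(1) places_iff valuation_ring_iff V.subfield by blast
qed

lemma exists_place_containing_ideal:
  assumes E: "ff E" and A: "subring A R" "A \<subseteq> E" "k \<subseteq> A" and I: "ideal_in I A" "\<one> \<notin> I"
    and a: "a \<in> I" "a \<noteq> \<zero>"
  obtains Q where "Q \<in> places_of E" "I \<subseteq> Q"
proof -
  obtain V where V: "val_ring R E V" "A \<subseteq> V" "I \<subseteq> nonunits V"
    using chevalley_extension[OF ff_subfield[OF E] A(1,2) I] by blast
  have "nonunits V \<in> places_of E" using nonunits_in_places[OF E V(1), of a] V(2,3) A(3) a by blast
  then show ?thesis using that V val_ring.ring_of_place_nonunits[OF V(1)] by simp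
qed

end

locale function_field_extension = constant_field R k for R (structure) and k +
  fixes F E
  assumes ff_base: "ff F" and ff_ext: "ff E" and sub: "F \<subseteq> E"
begin

lemma restrict_place:
  assumes Q: "Q \<in> places_of E" and a: "a \<in> Q" "a \<in> F" "a \<noteq> \<zero>"
  shows "Q \<inter> F \<in> places_of F" and "\<O> F (Q \<inter> F) = \<O> E Q \<inter> F"
proof -
  interpret Q: discrete_place R E Q by (rule ff_discrete_place[OF ff_ext Q])
  note F = ff_subfield[OF ff_base]
  have V: "val_ring R F (\<O> E Q \<inter> F)" using Q.val_ring_inter_subfield[OF F sub] .
  have nonunits: "nonunits (\<O> E Q \<inter> F) = Q \<inter> F"
    using Q.nonunits_inter_subfield[OF F sub] Q.place_eq by simp
  have "k \<subseteq> \<O> E Q \<inter> F" using constants_subset[OF ff_ext Q] ff_constants[OF ff_base] by blast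
  then show "Q \<inter> F \<in> places_of F"
    using nonunits_in_places[OF ff_base V, of a] a unfolding nonunits by blast
  show "\<O> F (Q \<inter> F) = \<O> E Q \<inter> F" using val_ring.ring_of_place_nonunits[OF V] unfolding nonunits .
qed

end

locale place_extension = function_field_extension R k F E for R (structure) and k F E +
  fixes P
  assumes place: "P \<in> places_of F"

sublocale place_extension \<subseteq> P: discrete_place R F P
  by (rule ff_discrete_place[OF ff_base place])

context place_extension
begin

lemma discrete_place_above: "Q \<in> places_above E P \<Longrightarrow> discrete_place R E Q"
  using ff_discrete_place[OF ff_ext places_aboveD(1)] .

lemma above_inter:
  assumes Q: "Q \<in> places_above E P"
  shows "Q \<inter> F = P" and "\<O> E Q \<inter> F = \<O> F P"
proof -
  obtain t where t: "prime_element R F P t" by (rule P.exists_prime_element)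
  note t_facts = P.prime_elementE[OF t]
  note restrict = restrict_place[OF places_aboveD(1)[OF Q] _ t_facts(3,6)]
  have tQ: "t \<in> Q" using t_facts(1) places_aboveD(2)[OF Q] by blast
  interpret S: discrete_place R F "Q \<inter> F" by (rule ff_discrete_place[OF ff_base restrict(1)[OF tQ]])
  have "P \<subseteq> Q \<inter> F" using places_aboveD(2)[OF Q] P.place_subset P.ring_subset by blast
  then have "\<O> F (Q \<inter> F) \<subseteq> \<O> F P"
    using nonunits_antimono[OF P.val_ring_axioms S.val_ring_axioms] P.place_eq S.place_eq by simp
  then have eq: "\<O> F P = \<O> F (Q \<inter> F)" by (rule S.maximal[OF P.val_ring_axioms _ P.proper])
  then show "Q \<inter> F = P" using P.place_eq S.place_eq by simp
  show "\<O> E Q \<inter> F = \<O> F P" using eq restrict(2)[OF tQ] by simp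
qed

lemma local_ring_subset: "Q \<in> places_above E P \<Longrightarrow> \<O> F P \<subseteq> \<O> E Q"
  using above_inter(2) by blast

lemma above_inter_intermediate:
  assumes K: "ff K" "F \<subseteq> K" "K \<subseteq> E" and Q: "Q \<in> places_above E P"
  shows "Q \<inter> K \<in> places_above K P" and "Q \<in> places_above E (Q \<inter> K)"
proof -
  interpret KE: function_field_extension R k K E by unfold_locales (use K ff_ext in auto)
  obtain t where t: "prime_element R F P t" by (rule P.exists_prime_element)
  have "t \<in> Q" "t \<in> K" "t \<noteq> \<zero>" using P.prime_elementE[OF t] places_aboveD(2)[OF Q] K(2) by auto
  then have "Q \<inter> K \<in> places_of K" using KE.restrict_place(1)[OF places_aboveD(1)[OF Q]] by blast
  moreover have "P \<subseteq> Q \<inter> K" using places_aboveD(2)[OF Q] P.place_subset P.ring_subset K(2) by blast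
  ultimately show "Q \<inter> K \<in> places_above K P" "Q \<in> places_above E (Q \<inter> K)"
    using places_aboveD(1)[OF Q] by (auto simp: places_over_def)
qed

lemma ram_pos_and_val_above:
  assumes Q: "Q \<in> places_above E P"
  shows "1 \<le> ram F P E Q" and "x \<in> F \<Longrightarrow> x \<noteq> \<zero> \<Longrightarrow> val E Q x = int (ram F P E Q) * val F P x"
proof -
  interpret Q: discrete_place R E Q by (rule discrete_place_above[OF Q])
  obtain t where t: "prime_element R F P t" by (rule P.exists_prime_element)
  note t_facts = P.prime_elementE[OF t]
  have tE: "t \<in> E" "t \<in> Q" using t_facts sub places_aboveD(2)[OF Q] by auto
  have pos: "1 \<le> val E Q t" using Q.place_iff_val_pos[OF tE(1) t_facts(6)] tE(2) by simp
  have val_eq: "val E Q x = val E Q t * val F P x" if x: "x \<in> F" "x \<noteq> \<zero>" for x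
  proof -
    obtain u where u: "u \<in> Units (local_ring R F P)" "x = t [^] val F P x \<otimes> u"
      by (rule P.eq_int_pow_val_mult_unit[OF t x])
    have uO: "u \<in> \<O> E Q" "inv u \<in> \<O> E Q" using P.unitE(1,5)[OF u(1)] local_ring_subset[OF Q] by auto
    then have uE: "u \<in> E" "u \<noteq> \<zero>" "inv u \<in> E" "inv u \<noteq> \<zero>"
      using Q.ring_subset P.unitE(4)[OF u(1)] subfield_inv(2)[OF Q.subfield] by auto
    have "0 \<le> val E Q u" "0 \<le> val E Q (inv u)"
      using Q.ring_iff_val_nonneg[OF uE(1,2)] Q.ring_iff_val_nonneg[OF uE(3,4)] uO by auto
    then have "val E Q u = 0" using Q.val_inv[OF uE(1,2)] by simp
    moreover note pow = Q.val_int_pow[OF tE(1) t_facts(6), of "val F P x"]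
    have "val E Q x = val E Q (t [^] val F P x) + val E Q u"
      using Q.val_mult[OF pow(1,2) uE(1,2)] u(2) by simp
    ultimately show ?thesis using pow(3) by simp
  qed
  have "ram F P E Q = nat (val E Q t)"
    unfolding ramification_index_def
  proof (rule the_equality)
    show "\<forall>x\<in>F - {\<zero>}. val E Q x = int (nat (val E Q t)) * val F P x" using val_eq pos by simp
    fix e assume "\<forall>x\<in>F - {\<zero>}. val E Q x = int e * val F P x"
    then show "e = nat (val E Q t)" using t_facts(3,6) P.val_prime_element[OF t] by simp
  qed
  then show "1 \<le> ram F P E Q" "x \<in> F \<Longrightarrow> x \<noteq> \<zero> \<Longrightarrow> val E Q x = int (ram F P E Q) * val F P x"
    using pos val_eq by auto
qed

lemmas ram_pos = ram_pos_and_val_above(1)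
lemmas val_above = ram_pos_and_val_above(2)

lemma ram_intermediate:
  assumes K: "ff K" "F \<subseteq> K" "K \<subseteq> E" and S: "S \<in> places_above K P" and Q: "Q \<in> places_above E S"
  shows "ram F P E Q = ram K S E Q * ram F P K S"
proof -
  interpret FK: place_extension R k F K P by unfold_locales (use K ff_base place in auto)
  interpret KE: place_extension R k K E S by unfold_locales (use K ff_ext places_aboveD(1)[OF S] in auto)
  have QP: "Q \<in> places_above E P" using Q S by (auto simp: places_over_def)
  obtain t where t: "prime_element R F P t" by (rule P.exists_prime_element)
  note t_facts = P.prime_elementE[OF t]
  have "int (ram F P E Q) = int (ram K S E Q) * int (ram F P K S)"
    using val_above[OF QP t_facts(3,6)] KE.val_above[OF Q _ t_facts(6)] FK.val_above[OF S t_facts(3,6)]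
      P.val_prime_element[OF t] t_facts(3) K(2) by auto
  then show ?thesis by (metis of_nat_eq_iff of_nat_mult)
qed

text \<open>If \<open>z\<close> is regular above \<open>P\<close>, then no place contains \<open>P\<close> and \<open>z\<inverse>\<close>; by Chevalley's theorem the
  two generate the unit ideal of \<open>\<O>\<^sub>P[z\<inverse>]\<close>.\<close>

lemma mem_simple_extension_inv:
  assumes z: "z \<in> E" "z \<noteq> \<zero>" and regular: "\<And>Q. Q \<in> places_above E P \<Longrightarrow> z \<in> \<O> E Q"
  shows "z \<in> simple_extension (\<O> F P) (inv z)"
proof -
  let ?w = "inv z" and ?A = "simple_extension (\<O> F P) (inv z)"
  note E = ff_subfield[OF ff_ext]
  have zR: "z \<in> carrier R" using z(1) subfieldE(3)[OF E] by blast
  note w = inv_nonzero[OF zR z(2)] and A = simple_extension_is_subring[OF P.subring inv_nonzero(1)[OF zR z(2)]]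
  have wE: "?w \<in> E" using subfield_inv(1)[OF E z] .
  have AE: "?A \<subseteq> E" using simple_extension_subring_incl[OF subfieldE(1)[OF E] _ wE] P.ring_subset sub by blast
  have OA: "\<O> F P \<subseteq> ?A" by (rule simple_extension_incl[OF P.ring_carrier w(1)])
  have kA: "k \<subseteq> ?A" using constants_subset[OF ff_base place] OA by blast
  let ?I = "P <+>\<^bsub>R\<^esub> (?w <# ?A)"
  note I = ideal_in_simple_extension[OF P.subring P.ideal_place w(1)]
  have memI: "p \<oplus> ?w \<otimes> a \<in> ?I" if "p \<in> P" "a \<in> ?A" for p a
    using that unfolding set_add_l_coset_mem by blast
  have "\<zero> \<oplus> ?w \<otimes> \<one> = ?w" using w(1) by simp
  then have wI: "?w \<in> ?I" using memI[OF P.zero_in_place subringE(3)[OF A]] by simp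
  have "\<one> \<in> ?I"
  proof (rule ccontr)
    assume "\<one> \<notin> ?I"
    then obtain Q where Q: "Q \<in> places_of E" "?I \<subseteq> Q"
      by (rule exists_place_containing_ideal[OF ff_ext A AE kA I _ wI w(2)])
    have "p \<in> ?I" if "p \<in> P" for p
      using memI[OF that subringE(2)[OF A]] that P.carrier_subset w(1) by auto
    then have "Q \<in> places_above E P" using Q by (auto simp: places_over_def)
    then interpret Q: discrete_place R E Q by (rule discrete_place_above)
    have "z \<in> \<O> E Q" using regular \<open>Q \<in> places_above E P\<close> by blast
    moreover have "inv ?w \<notin> \<O> E Q" using wI Q(2) w(2) Q.place_iff[of ?w] by blast
    ultimately show False using w(5) by simp
  qed
  then show ?thesis by (rule P.mem_simple_extension_of_unit_ideal[OF w(1) zR w(3)])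
qed

theorem integral_closure_eq:
  "integral_closure_in R (\<O> F P) E = semilocal_ring E (places_above E P)"
proof (intro equalityI subsetI)
  fix z assume "z \<in> integral_closure_in R (\<O> F P) E"
  then obtain p where p: "z \<in> E" "p \<noteq> []" "polynomial (\<O> F P) p" "lead_coeff p = \<one>" "eval p z = \<zero>"
    by (auto simp: integral_closure_in_def)
  have "z \<in> \<O> E Q" if Q: "Q \<in> places_above E P" for Q
  proof -
    interpret Q: discrete_place R E Q by (rule discrete_place_above[OF Q])
    have "set p \<subseteq> \<O> E Q" using p(3) local_ring_subset[OF Q] by (auto simp: polynomial_def)
    then show ?thesis using Q.integral_in_ring p by blast
  qed
  then show "z \<in> semilocal_ring E (places_above E P)" using p(1) by (simp add: semilocal_ring_def)
next
  fix z assume "z \<in> semilocal_ring E (places_above E P)"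
  then have z: "z \<in> E" "\<And>Q. Q \<in> places_above E P \<Longrightarrow> z \<in> \<O> E Q" by (auto simp: semilocal_ring_def)
  show "z \<in> integral_closure_in R (\<O> F P) E"
  proof (cases "z = \<zero>")
    case True
    have "eval [\<one>, \<zero>] z = \<zero>" using True by simp
    moreover have "polynomial (\<O> F P) [\<one>, \<zero>]"
      using subringE(2,3)[OF P.subring] by (simp add: polynomial_def)
    ultimately show ?thesis unfolding integral_closure_in_def using z(1) by force
  next
    case False
    have "z \<in> carrier R" using z(1) subfieldE(3)[OF ff_subfield[OF ff_ext]] by blast
    then show ?thesis
      using mem_integral_closureI[OF P.subring z(1) _ False mem_simple_extension_inv[OF z(1) False z(2)]]
      by blast
  qed
qed

end

section \<open>Finite fields and the Frobenius map\<close>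

context field
begin

lemma card_eq_power_dim:
  assumes fin: "finite (carrier R)" and K: "subfield K R"
  shows "card (carrier R) = card K ^ dim K (carrier R)"
proof -
  obtain xs where xs: "set xs = carrier R" using finite_list[OF fin] by blast
  note KR = subfieldE(3)[OF K]
  have "Span K xs = carrier R"
    using Span_base_incl[OF K, of xs] Span_in_carrier[OF KR, of xs] xs by blast
  then have "finite_dimension K (carrier R)" using Span_finite_dimension[OF K, of xs] xs by simp
  then have "dimension (dim K (carrier R)) K (carrier R)"
    using finite_dimensionE[OF K] by (simp add: over_def)
  then obtain Vs where Vs: "set Vs \<subseteq> carrier R" "independent K Vs" "length Vs = dim K (carrier R)"
      "Span K Vs = carrier R"
    using exists_base[OF K] by blast
  let ?D = "{Ks. set Ks \<subseteq> K \<and> length Ks = length Vs}"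
  have "bij_betw (\<lambda>Ks. combine Ks Vs) ?D (carrier R)"
  proof (rule bij_betwI')
    fix Ks assume "Ks \<in> ?D"
    then show "combine Ks Vs \<in> carrier R" using KR Vs(1) by (auto intro!: combine_in_carrier)
  next
    fix y assume "y \<in> carrier R"
    then show "\<exists>Ks\<in>?D. y = combine Ks Vs" using Span_mem_iff_length_version[OF K Vs(1)] Vs(4) by blast
  next
    fix Ks Ls assume KLs: "Ks \<in> ?D" "Ls \<in> ?D"
    then have "combine Ks Vs \<in> Span K Vs" unfolding Span_mem_iff_length_version[OF K Vs(1)] by auto
    from unique_decomposition[OF K Vs(2) this] show "(combine Ks Vs = combine Ls Vs) = (Ks = Ls)"
      using KLs by auto
  qed
  then have "card (carrier R) = card ?D" by (rule bij_betw_same_card[symmetric])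
  also have "\<dots> = card K ^ length Vs"
    using card_lists_length_eq[of K "length Vs"] finite_subset[OF KR fin] by simp
  finally show ?thesis using Vs(3) by simp
qed

lemma finite_field_pow_card:
  assumes fin: "finite (carrier R)" and x: "x \<in> carrier R"
  shows "x [^] (card (carrier R) ^ n) = x"
proof (induction n)
  case (Suc n)
  have pos: "card (carrier R) > 0" using fin x by (auto simp: card_gt_0_iff)
  have "x [^] card (carrier R) = x"
  proof (cases "x = \<zero>")
    case True
    then show ?thesis using pos by (simp add: nat_pow_zero)
  next
    case False
    interpret M: group "Multiplicative_Group.mult_of R" by (rule field_mult_group)
    have "x [^] order (Multiplicative_Group.mult_of R) = \<one>"
      using M.pow_order_eq_1[of x] x False by (simp add: Multiplicative_Group.nat_pow_mult_of)
    then have "x [^] Suc (card (carrier R) - 1) = x"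
      using order_mult_of[OF fin] x by (simp add: order_def)
    then show ?thesis using pos by simp
  qed
  moreover have "x [^] (card (carrier R) ^ Suc n) = (x [^] (card (carrier R) ^ n)) [^] card (carrier R)"
    using x by (simp add: nat_pow_pow mult.commute)
  ultimately show ?case using Suc by simp
qed (use x in simp)

lemma card_le_of_pow_eq_self:
  assumes fin: "finite (carrier R)" and n: "1 < n" and pow: "\<And>x. x \<in> carrier R \<Longrightarrow> x [^] n = x"
  shows "card (carrier R) \<le> n"
proof -
  obtain m where m: "n = Suc m" "m \<noteq> 0" using n by (cases n) auto
  have "carrier R - {\<zero>} \<subseteq> {x \<in> carrier R. x [^] m = \<one>}"
  proof
    fix x assume x: "x \<in> carrier R - {\<zero>}"
    then have "x [^] m \<otimes> x = \<one> \<otimes> x" using pow[of x] m(1) by simp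
    then show "x \<in> {x \<in> carrier R. x [^] m = \<one>}" using m_rcancel[of x "x [^] m" \<one>] x by simp
  qed
  then have "card (carrier R - {\<zero>}) \<le> card {x \<in> carrier R. x [^] m = \<one>}"
    using fin by (intro card_mono) auto
  also have "\<dots> \<le> m" by (rule num_roots_le_deg[OF fin m(2)])
  finally show ?thesis using m(1) fin by simp
qed

end

lemma (in domain) characteristic_prime:
  assumes "add.ord \<one> \<noteq> 0"
  shows "normalization_semidom_class.prime (add.ord \<one>)"
proof (rule prime_natI)
  have char: "[n] \<cdot> \<one> = \<zero> \<longleftrightarrow> add.ord \<one> dvd n" for n :: nat using add.pow_eq_id[of \<one> n] by simp
  have "add.ord \<one> \<noteq> 1" using char[of 1] one_not_zero by simp
  then show "2 \<le> add.ord \<one>" using assms by simp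
  fix a b assume "add.ord \<one> dvd a * b"
  then have "[(b * a)] \<cdot> \<one> = \<zero>" unfolding char by (simp add: mult.commute)
  then have "\<zero> = [(b * a)] \<cdot> \<one>" by (rule sym)
  also have "\<dots> = [a] \<cdot> ([b] \<cdot> \<one>)" using add.nat_pow_pow[of \<one> a b] by simp
  also have "\<dots> = [a] \<cdot> \<one> \<otimes> [b] \<cdot> \<one>" using add_pow_ldistr[of \<one> "[b] \<cdot> \<one>" a] by simp
  finally show "add.ord \<one> dvd a \<or> add.ord \<one> dvd b" using integral[of "[a] \<cdot> \<one>" "[b] \<cdot> \<one>"] char by auto
qed

lemma (in cring) add_pow_eq_zero:
  assumes "[p] \<cdot> \<one> = \<zero>" "p dvd m" and x: "x \<in> carrier R"
  shows "[(m::nat)] \<cdot> x = \<zero>"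
proof -
  obtain j where j: "m = p * j" using assms(2) by auto
  have "[p] \<cdot> x = ([p] \<cdot> \<one>) \<otimes> x" using add_pow_ldistr[of \<one> x p] x by simp
  then have "[p] \<cdot> x = \<zero>" using assms(1) x by simp
  then show ?thesis using add.nat_pow_pow[OF x, of j p] j by simp
qed

lemma prime_power_of_unique_prime_divisor:
  assumes p: "normalization_semidom_class.prime p" and "n \<noteq> 0"
    and unique: "\<And>l. normalization_semidom_class.prime l \<Longrightarrow> l dvd n \<Longrightarrow> l = p"
  shows "\<exists>r. (n::nat) = p ^ r"
proof -
  have "\<not> is_unit p" using p not_prime_unit by blast
  then obtain m where m: "n = p ^ multiplicity p n * m" "\<not> p dvd m"
    by (rule multiplicity_decompose'[OF assms(2)])
  have "m = 1"
  proof (rule ccontr)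
    assume "m \<noteq> 1"
    then obtain l where l: "normalization_semidom_class.prime l" "l dvd m"
      using prime_factor_nat by blast
    then have "l = p" using unique m(1) by (metis dvd_mult)
    then show False using l m(2) by simp
  qed
  then show ?thesis using m(1) by auto
qed

text \<open>By Sylow's theorem the additive group has an element of order \<open>l\<close> for every prime divisor \<open>l\<close>
  of its order, and \<open>p = 0\<close> in the field forces \<open>l = p\<close>.\<close>

lemma (in field) finite_field_card_prime_power:
  assumes fin: "finite (carrier R)"
  obtains p r where "normalization_semidom_class.prime p" "[p] \<cdot> \<one> = \<zero>" "card (carrier R) = p ^ r"
proof -
  let ?p = "add.ord \<one>"
  have "?p \<noteq> 0" using add.ord_ge_1[OF _ one_closed] fin by simp
  then have p: "normalization_semidom_class.prime ?p" by (rule characteristic_prime)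
  have char: "[?p] \<cdot> \<one> = \<zero>" using add.pow_ord_eq_1[of \<one>] by simp
  have "l = ?p" if l: "normalization_semidom_class.prime l" "l dvd card (carrier R)" for l
  proof -
    obtain m where "card (carrier R) = l ^ 1 * m" using l(2) by auto
    then obtain H where H: "subgroup H (add_monoid R)" "card H = l ^ 1"
      using sylow_thm[OF l(1) add.is_group, of 1 m] fin by (auto simp: order_def)
    have "H \<noteq> {\<zero>}" using H(2) prime_ge_2_nat[OF l(1)] by auto
    then obtain x where x: "x \<in> H" "x \<noteq> \<zero>" using subgroup.one_closed[OF H(1)] by auto
    then have xR: "x \<in> carrier R" using subgroup.subset[OF H(1)] by auto
    interpret H: group "add_monoid R\<lparr>carrier := H\<rparr>"
      using subgroup.subgroup_is_group[OF H(1) add.is_group] .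
    have "[l] \<cdot> x = x [^]\<^bsub>add_monoid R\<lparr>carrier := H\<rparr>\<^esub> order (add_monoid R\<lparr>carrier := H\<rparr>)"
      using add.nat_pow_consistent[of l x H] H(2) by (simp add: add_pow_def order_def)
    then have "[l] \<cdot> x = \<zero>" using H.pow_order_eq_1[of x] x(1) by simp
    then have "add.ord x dvd l" "add.ord x dvd ?p"
      using add.pow_eq_id[OF xR] add_pow_eq_zero[OF char dvd_refl xR] by auto
    moreover have "add.ord x \<noteq> 1" using add.ord_eq_1[OF xR] x(2) by simp
    ultimately show ?thesis using l(1) p by (metis prime_nat_iff)
  qed
  moreover have "card (carrier R) \<noteq> 0" using fin one_closed by auto
  ultimately obtain r where "card (carrier R) = ?p ^ r"
    using prime_power_of_unique_prime_divisor[OF p] by blast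
  then show ?thesis using that[OF p char] by simp
qed

context cring
begin

lemma binomial_term_Suc_Suc:
  assumes a: "a \<in> carrier R" and b: "b \<in> carrier R" and i: "i \<le> n"
  shows "[(Suc n choose Suc i)] \<cdot> (a [^] Suc i \<otimes> b [^] (Suc n - Suc i)) =
    [(n choose i)] \<cdot> (a [^] i \<otimes> b [^] (n - i)) \<otimes> a \<oplus>
    [(n choose Suc i)] \<cdot> (a [^] Suc i \<otimes> b [^] (n - Suc i)) \<otimes> b"
proof -
  let ?x = "a [^] Suc i \<otimes> b [^] (n - i)"
  have xR: "?x \<in> carrier R" using a b by simp
  have "[(n choose i)] \<cdot> (a [^] i \<otimes> b [^] (n - i)) \<otimes> a = [(n choose i)] \<cdot> ?x"
    using add_pow_ldistr[of "a [^] i \<otimes> b [^] (n - i)" a "n choose i"] a b by (simp add: m_ac)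
  moreover have "[(n choose Suc i)] \<cdot> (a [^] Suc i \<otimes> b [^] (n - Suc i)) \<otimes> b = [(n choose Suc i)] \<cdot> ?x"
  proof (cases "i = n")
    case False
    then have "b [^] (n - i) = b [^] (n - Suc i) \<otimes> b"
      using i Suc_diff_Suc[of i n] by (metis le_neq_implies_less nat_pow_Suc)
    then show ?thesis
      using add_pow_ldistr[of "a [^] Suc i \<otimes> b [^] (n - Suc i)" b "n choose Suc i"] a b
      by (simp add: m_assoc)
  qed (use b in \<open>simp add: binomial_eq_0\<close>)
  ultimately show ?thesis using add.nat_pow_mult[OF xR, of "n choose i" "n choose Suc i"] by simp
qed

theorem binomial_expansion:
  assumes a: "a \<in> carrier R" and b: "b \<in> carrier R"
  shows "(a \<oplus> b) [^] n = (\<Oplus>i\<in>{..n}. [(n choose i)] \<cdot> (a [^] i \<otimes> b [^] (n - i)))"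
proof (induction n)
  case (Suc n)
  let ?t = "\<lambda>n i. [(n choose i)] \<cdot> (a [^] i \<otimes> b [^] (n - i))"
  have closed: "?t n \<in> {..m} \<rightarrow> carrier R" "(\<lambda>i. ?t n (Suc i)) \<in> {..m} \<rightarrow> carrier R" for n m
    using a b by auto
  have closed_mult: "(\<lambda>i. ?t n i \<otimes> a) \<in> {..n} \<rightarrow> carrier R" "(\<lambda>i. ?t n (Suc i) \<otimes> b) \<in> {..n} \<rightarrow> carrier R"
    using a b by auto
  note sums = finsum_closed[OF closed(1)[of n n]] finsum_closed[OF closed(2)[of n n]]
  have "finsum R (?t n) {..Suc n} = ?t n (Suc n) \<oplus> finsum R (?t n) {..n}"
    by (rule finsum_Suc[OF closed(1)])
  then have last: "finsum R (?t n) {..Suc n} = finsum R (?t n) {..n}"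
    using sums(1) by (simp add: binomial_eq_0)
  have "finsum R (?t (Suc n)) {..Suc n} = (\<Oplus>i\<in>{..n}. ?t (Suc n) (Suc i)) \<oplus> ?t (Suc n) 0"
    by (rule finsum_Suc2[OF closed(1)])
  also have "(\<Oplus>i\<in>{..n}. ?t (Suc n) (Suc i)) = (\<Oplus>i\<in>{..n}. ?t n i \<otimes> a \<oplus> ?t n (Suc i) \<otimes> b)"
    by (rule finsum_cong') (use binomial_term_Suc_Suc[OF a b] a b in auto)
  also have "\<dots> = (\<Oplus>i\<in>{..n}. ?t n i) \<otimes> a \<oplus> (\<Oplus>i\<in>{..n}. ?t n (Suc i)) \<otimes> b"
    using finsum_addf[OF closed_mult] finsum_ldistr[OF _ a closed(1)] finsum_ldistr[OF _ b closed(2)]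
    by simp
  also have "?t (Suc n) 0 = ?t n 0 \<otimes> b" using b by simp
  also have "(\<Oplus>i\<in>{..n}. ?t n i) \<otimes> a \<oplus> (\<Oplus>i\<in>{..n}. ?t n (Suc i)) \<otimes> b \<oplus> ?t n 0 \<otimes> b
      = (\<Oplus>i\<in>{..n}. ?t n i) \<otimes> a \<oplus> ((\<Oplus>i\<in>{..n}. ?t n (Suc i)) \<oplus> ?t n 0) \<otimes> b"
    using sums a b by (simp add: l_distr a_assoc)
  also have "\<dots> = (a \<oplus> b) [^] n \<otimes> a \<oplus> (a \<oplus> b) [^] n \<otimes> b"
    using finsum_Suc2[OF closed(1), of n n] last Suc by simp
  also have "\<dots> = (a \<oplus> b) [^] Suc n" using a b by (simp add: r_distr)
  finally show ?case by simp
qed (use b in simp)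

lemma frobenius:
  assumes p: "normalization_semidom_class.prime (p::nat)" "[p] \<cdot> \<one> = \<zero>"
    and a: "a \<in> carrier R" and b: "b \<in> carrier R"
  shows "(a \<oplus> b) [^] p = a [^] p \<oplus> b [^] p"
proof -
  let ?t = "\<lambda>i. [(p choose i)] \<cdot> (a [^] i \<otimes> b [^] (p - i))"
  obtain r where r: "p = Suc (Suc r)" using prime_ge_2_nat[OF p(1)] by (metis add_2_eq_Suc le_Suc_ex)
  have closed: "?t \<in> {..Suc (Suc r)} \<rightarrow> carrier R" "?t \<in> {..Suc r} \<rightarrow> carrier R" using a b by auto
  have "finsum R ?t {..Suc (Suc r)} = ?t (Suc (Suc r)) \<oplus> finsum R ?t {..Suc r}"
    by (rule finsum_Suc[OF closed(1)])
  also have "finsum R ?t {..Suc r} = (\<Oplus>i\<in>{..r}. ?t (Suc i)) \<oplus> ?t 0" by (rule finsum_Suc2[OF closed(2)])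
  also have "(\<Oplus>i\<in>{..r}. ?t (Suc i)) = (\<Oplus>i\<in>{..r}. \<zero>)"
  proof (rule finsum_cong')
    fix i assume "i \<in> {..r}"
    then have "p dvd (p choose Suc i)" using dvd_choose_prime[OF _ _ _ p(1), of "Suc i"] r by simp
    then show "?t (Suc i) = \<zero>" using add_pow_eq_zero[OF p(2)] a b by simp
  qed auto
  also have "?t (Suc (Suc r)) = a [^] p" using a r by simp
  also have "?t 0 = b [^] p" using b by simp
  finally show ?thesis using binomial_expansion[OF a b, of p] r a b by simp
qed

lemma frobenius_power:
  assumes p: "normalization_semidom_class.prime (p::nat)" "[p] \<cdot> \<one> = \<zero>"
    and a: "a \<in> carrier R" and b: "b \<in> carrier R"
  shows "(a \<oplus> b) [^] (p ^ n) = a [^] (p ^ n) \<oplus> b [^] (p ^ n)"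
proof (induction n)
  case (Suc n)
  have "(a \<oplus> b) [^] (p ^ Suc n) = ((a \<oplus> b) [^] (p ^ n)) [^] p"
    using a b by (simp add: nat_pow_pow mult.commute)
  also have "\<dots> = (a [^] (p ^ n)) [^] p \<oplus> (b [^] (p ^ n)) [^] p"
    unfolding Suc using frobenius[OF p] a b by simp
  finally show ?case using a b by (simp add: nat_pow_pow mult.commute)
qed (use a b in simp)

end

context constant_field
begin

lemma frobenius_constants:
  assumes a: "a \<in> carrier R" and b: "b \<in> carrier R"
  shows "(a \<oplus> b) [^] (card k ^ n) = a [^] (card k ^ n) \<oplus> b [^] (card k ^ n)"
proof -
  interpret K: field "R\<lparr>carrier := k\<rparr>" using subfield_iff(2)[OF subfield_constants] .
  obtain p r where p: "normalization_semidom_class.prime p" "[p] \<cdot>\<^bsub>R\<lparr>carrier := k\<rparr>\<^esub> \<one> = \<zero>" "card k = p ^ r"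
    using K.finite_field_card_prime_power finite_constants by auto
  have "[n] \<cdot>\<^bsub>R\<lparr>carrier := k\<rparr>\<^esub> \<one> = [n] \<cdot> \<one>" for n :: nat
    by (induction n) (simp_all add: add_pow_def nat_pow_def)
  then have "[p] \<cdot> \<one> = \<zero>" using p(2) by simp
  then show ?thesis using frobenius_power[OF p(1) _ a b, of "r * n"] p(3) by (simp add: power_mult)
qed

lemma frobenius_constants_minus:
  assumes a: "a \<in> carrier R" and b: "b \<in> carrier R"
  shows "(a \<ominus> b) [^] (card k ^ n) = a [^] (card k ^ n) \<ominus> b [^] (card k ^ n)"
proof -
  have "a [^] (card k ^ n) = ((a \<ominus> b) \<oplus> b) [^] (card k ^ n)"
  proof -
    have "(a \<ominus> b) \<oplus> b = a" using a b by algebra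
    then show ?thesis by simp
  qed
  also have "\<dots> = (a \<ominus> b) [^] (card k ^ n) \<oplus> b [^] (card k ^ n)" using frobenius_constants a b by simp
  finally show ?thesis using a b by (simp add: a_minus_def a_assoc r_neg)
qed

end

section \<open>Residue fields and degrees\<close>

context discrete_place
begin

lemma maximalideal_place: "maximalideal P (local_ring R F P)"
  using maximalideal_nonunits place_eq by simp

lemma coset_local_ring: "P +>\<^bsub>local_ring R F P\<^esub> a = P +> a"
  by (simp add: a_r_coset_def r_coset_def)

lemma field_residue_field: "field (residue_field R F P)"
proof -
  have "cring (local_ring R F P)" using subring_is_domain[OF subring] by (simp add: domain_def)
  then show ?thesis unfolding residue_field_def by (rule maximalideal.quotient_is_field[OF maximalideal_place])
qed

lemma residue_hom: "ring_hom_ring (local_ring R F P) (residue_field R F P) (\<lambda>a. P +> a)"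
proof -
  interpret M: maximalideal P "local_ring R F P" by (rule maximalideal_place)
  have "(\<lambda>a. P +>\<^bsub>local_ring R F P\<^esub> a) = (\<lambda>a. P +> a)" by (rule ext) (rule coset_local_ring)
  then show ?thesis using M.rcos_ring_hom_ring unfolding residue_field_def by metis
qed

lemma carrier_residue_field: "carrier (residue_field R F P) = (\<lambda>a. P +> a) ` \<O> F P"
  unfolding residue_field_def FactRing_def A_RCOSETS_def RCOSETS_def
  using coset_local_ring by (auto simp: a_r_coset_def)

lemma finite_residue_field: "finite (carrier (residue_field R F P))"
  using finite_index_place by (simp add: finite_index_def carrier_residue_field)

lemma card_residue_field: "card (carrier (residue_field R F P)) = residue_order F P"
  by (simp add: carrier_residue_field residue_order_def index_def)

lemma residue_eq_iff: "a \<in> \<O> F P \<Longrightarrow> b \<in> \<O> F P \<Longrightarrow> P +> a = P +> b \<longleftrightarrow> a \<ominus> b \<in> P"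
  using coset_eq_iff[OF place_subgroup] ring_carrier by blast

lemma subfield_residue_image:
  assumes B: "subring B R" "B \<subseteq> \<O> F P" and inv: "\<And>b. b \<in> B \<Longrightarrow> b \<notin> P \<Longrightarrow> inv b \<in> B"
  shows "subfield ((\<lambda>a. P +> a) ` B) (residue_field R F P)"
proof -
  interpret K: field "residue_field R F P" by (rule field_residue_field)
  interpret H: ring_hom_ring "local_ring R F P" "residue_field R F P" "\<lambda>a. P +> a" by (rule residue_hom)
  have "subring B (local_ring R F P)" using H.R.subring_iff[of B] B(2) subring_is_ring[OF B(1)] by simp
  then show ?thesis
  proof (rule K.subfieldI'[OF H.img_is_subring])
    fix x assume x: "x \<in> (\<lambda>a. P +> a) ` B - {\<zero>\<^bsub>residue_field R F P\<^esub>}"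
    then obtain b where b: "b \<in> B" "x = P +> b" by blast
    have bO: "b \<in> \<O> F P" using b(1) B(2) by blast
    have "b \<notin> P"
    proof
      assume "b \<in> P"
      then have "P +> b = P +> \<zero>"
        using residue_eq_iff[OF bO subringE(2)[OF subring]] ring_carrier bO by (auto simp: a_minus_def)
      then show False using x b(2) H.hom_zero by simp
    qed
    then have inv_b: "inv b \<in> B" "inv b \<in> \<O> F P" and b0: "b \<noteq> \<zero>"
      using inv[OF b(1)] B(2) zero_in_place by auto
    have "b \<otimes> inv b = \<one>" using inv_nonzero(3)[OF _ b0] bO ring_carrier by blast
    then have "(P +> b) \<otimes>\<^bsub>residue_field R F P\<^esub> (P +> inv b) = \<one>\<^bsub>residue_field R F P\<^esub>"
      using H.hom_mult[of b "inv b"] H.hom_one bO inv_b(2) by simp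
    then have "inv\<^bsub>residue_field R F P\<^esub> x = P +> inv b"
      using K.comm_inv_char[of x "P +> inv b"] H.hom_closed bO inv_b(2) b(2) by simp
    then show "inv\<^bsub>residue_field R F P\<^esub> x \<in> (\<lambda>a. P +> a) ` B" using inv_b(1) by blast
  qed
qed

lemma residue_order_eq_power_dim:
  assumes B: "subring B R" "B \<subseteq> \<O> F P" and inv: "\<And>b. b \<in> B \<Longrightarrow> b \<notin> P \<Longrightarrow> inv b \<in> B"
  shows "residue_order F P =
    index B P ^ ring.dim (residue_field R F P) (residue_image R F P B) (carrier (residue_field R F P))"
proof -
  interpret K: field "residue_field R F P" by (rule field_residue_field)
  have "residue_image R F P B = (\<lambda>a. P +> a) ` B" using coset_local_ring by (simp add: residue_image_def)
  then show ?thesis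
    using K.card_eq_power_dim[OF finite_residue_field subfield_residue_image[OF assms]] card_residue_field
    by (simp add: index_def)
qed

lemma residue_nat_pow:
  assumes a: "a \<in> \<O> F P"
  shows "P +> a [^] (n::nat) = (P +> a) [^]\<^bsub>residue_field R F P\<^esub> n"
proof (induction n)
  interpret H: ring_hom_ring "local_ring R F P" "residue_field R F P" "\<lambda>a. P +> a" by (rule residue_hom)
  {
    case 0
    then show ?case using H.hom_one by simp
  next
    case (Suc n)
    then show ?case using H.hom_mult[of "a [^] n" a] subring_nat_pow_closed[OF subring a] a by simp
  }
qed

lemma pow_residue_order:
  assumes a: "a \<in> \<O> F P"
  shows "a [^] (residue_order F P ^ n) \<ominus> a \<in> P"
proof -
  interpret K: field "residue_field R F P" by (rule field_residue_field)
  have "P +> a \<in> carrier (residue_field R F P)" using a carrier_residue_field by blast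
  then have "P +> a [^] (residue_order F P ^ n) = P +> a"
    using K.finite_field_pow_card[OF finite_residue_field] residue_nat_pow[OF a]
    unfolding card_residue_field by simp
  then show ?thesis using residue_eq_iff[OF subring_nat_pow_closed[OF subring a] a] by blast
qed

lemma residue_order_le:
  assumes n: "1 < n" and pow: "\<And>a. a \<in> \<O> F P \<Longrightarrow> a [^] n \<ominus> a \<in> P"
  shows "residue_order F P \<le> n"
proof -
  interpret K: field "residue_field R F P" by (rule field_residue_field)
  have "x [^]\<^bsub>residue_field R F P\<^esub> n = x" if x: "x \<in> carrier (residue_field R F P)" for x
  proof -
    obtain a where a: "a \<in> \<O> F P" "x = P +> a" using x carrier_residue_field by blast
    then show ?thesis
      using residue_nat_pow[OF a(1)] residue_eq_iff[OF subring_nat_pow_closed[OF subring a(1)] a(1)] pow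
      by simp
  qed
  then show ?thesis using K.card_le_of_pow_eq_self[OF finite_residue_field n] card_residue_field by simp
qed

end

context constant_field
begin

lemma card_constants_ge_2: "2 \<le> card k"
proof -
  have "{\<zero>, \<one>} \<subseteq> k" using subringE(2,3)[OF subfieldE(1)[OF subfield_constants]] by auto
  then have "card {\<zero>, \<one>} \<le> card k" by (rule card_mono[OF finite_constants])
  then show ?thesis using zero_not_one by simp
qed

lemma index_constants:
  assumes F: "ff F" and P: "P \<in> places_of F"
  shows "index k P = card k"
proof -
  interpret P: discrete_place R F P by (rule ff_discrete_place[OF F P])
  note kR = subfieldE(3)[OF subfield_constants]
  have separated: "a = b" if "a \<in> k" "b \<in> k" "a \<ominus> b \<in> P" for a b
  proof -
    have "a \<ominus> b \<in> k" using subring_minus_closed[OF subfieldE(1)[OF subfield_constants] that(1,2)] .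
    then have "a \<ominus> b = \<zero>"
      using P.meets_nonunits_trivially[OF subfield_constants constants_subset[OF F P]] that(3) P.place_eq
      by simp
    then show ?thesis using that(1,2) kR by (simp add: r_right_minus_eq subset_iff)
  qed
  have "x \<ominus> x \<in> P" if "x \<in> k" for x using that kR P.zero_in_place by (auto simp: a_minus_def r_neg)
  then have "transversal k P k" unfolding transversal_def using separated by blast
  then show ?thesis using index_transversal(2)[OF P.place_subgroup kR _ finite_constants] by blast
qed

lemma residue_order_eq_power_deg:
  assumes F: "ff F" and P: "P \<in> places_of F"
  shows "residue_order F P = card k ^ deg_of F P"
proof -
  interpret P: discrete_place R F P by (rule ff_discrete_place[OF F P])
  have "inv b \<in> k" if "b \<in> k" "b \<notin> P" for b
    using subfield_inv(1)[OF subfield_constants that(1)] that(2) P.zero_in_place by blast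
  then show ?thesis
    using P.residue_order_eq_power_dim[OF subfieldE(1)[OF subfield_constants] constants_subset[OF F P]]
      index_constants[OF F P] unfolding place_degree_def by simp
qed

lemma deg_pos:
  assumes F: "ff F" and P: "P \<in> places_of F"
  shows "1 \<le> deg_of F P"
proof (rule ccontr)
  interpret P: discrete_place R F P by (rule ff_discrete_place[OF F P])
  assume "\<not> 1 \<le> deg_of F P"
  then have "residue_order F P = 1" using residue_order_eq_power_deg[OF F P] by simp
  moreover have "card k \<le> residue_order F P"
    using index_mono(2)[OF P.finite_index_place constants_subset[OF F P]] index_constants[OF F P]
    by (simp add: residue_order_def)
  ultimately show False using card_constants_ge_2 by simp
qed

lemma residue_order_ge_2:
  assumes "ff F" "P \<in> places_of F"
  shows "2 \<le> residue_order F P"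
  using residue_order_eq_power_deg[OF assms] deg_pos[OF assms] card_constants_ge_2
    self_le_power[of "card k" "deg_of F P"] by linarith

lemma pow_card_constants:
  assumes F: "ff F" and P: "P \<in> places_of F" and a: "a \<in> \<O> F P" and n: "deg_of F P dvd n"
  shows "a [^] (card k ^ n) \<ominus> a \<in> P"
proof -
  obtain j where "n = deg_of F P * j" using n by auto
  then show ?thesis
    using discrete_place.pow_residue_order[OF ff_discrete_place[OF F P] a, of j]
    by (simp add: residue_order_eq_power_deg[OF F P] power_mult)
qed

lemma deg_le:
  assumes F: "ff F" and P: "P \<in> places_of F" and n: "1 \<le> n"
    and pow: "\<And>a. a \<in> \<O> F P \<Longrightarrow> a [^] (card k ^ n) \<ominus> a \<in> P"
  shows "deg_of F P \<le> n"
proof -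
  have "1 < card k ^ n" using card_constants_ge_2 n by (intro one_less_power) auto
  then have "card k ^ deg_of F P \<le> card k ^ n"
    using discrete_place.residue_order_le[OF ff_discrete_place[OF F P] _ pow] residue_order_eq_power_deg[OF F P]
    by simp
  then show ?thesis using card_constants_ge_2 by (simp add: power_increasing_iff)
qed

end

context place_extension
begin

lemma index_local_ring_above:
  assumes Q: "Q \<in> places_above E P"
  shows "index (\<O> F P) Q = residue_order F P"
proof -
  interpret Q: discrete_place R E Q by (rule discrete_place_above[OF Q])
  have "a \<ominus> b \<in> P \<longleftrightarrow> a \<ominus> b \<in> Q" if "a \<in> \<O> F P" "b \<in> \<O> F P" for a b
    using subring_minus_closed[OF P.subring that] P.ring_subset above_inter(1)[OF Q] by blast
  then show ?thesis
    using index_cong[OF P.place_subgroup P.finite_index_place Q.place_subgroup P.ring_carrier]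
    by (simp add: residue_order_def)
qed

lemma residue_order_above:
  assumes Q: "Q \<in> places_above E P"
  shows "residue_order E Q = residue_order F P ^ rel_deg F P E Q"
proof -
  interpret Q: discrete_place R E Q by (rule discrete_place_above[OF Q])
  have "inv b \<in> \<O> F P" if "b \<in> \<O> F P" "b \<notin> Q" for b
    using that P.place_iff above_inter(1)[OF Q] by blast
  then show ?thesis
    using Q.residue_order_eq_power_dim[OF P.subring local_ring_subset[OF Q]] index_local_ring_above[OF Q]
    unfolding relative_degree_def by simp
qed

lemma deg_above:
  assumes Q: "Q \<in> places_above E P"
  shows "deg_of E Q = deg_of F P * rel_deg F P E Q"
proof -
  have "card k ^ deg_of E Q = card k ^ (deg_of F P * rel_deg F P E Q)"
    using residue_order_above[OF Q] residue_order_eq_power_deg[OF ff_base place]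
      residue_order_eq_power_deg[OF ff_ext places_aboveD(1)[OF Q]] by (simp add: power_mult)
  then show ?thesis using card_constants_ge_2 by simp
qed

lemma rel_deg_pos:
  assumes Q: "Q \<in> places_above E P"
  shows "1 \<le> rel_deg F P E Q"
  using deg_above[OF Q] deg_pos[OF ff_ext places_aboveD(1)[OF Q]] by (cases "rel_deg F P E Q") auto

end

section \<open>The fundamental inequality\<close>

context place_extension
begin

text \<open>Modulo a prime element \<open>t\<close> of \<open>P\<close> the semilocal ring of the places in \<open>S\<close> has at most \<open>q\<^sup>m\<close>
  elements, while by weak approximation it maps onto the product of the rings \<open>\<O>\<^sub>Q/Q\<^sup>e\<close>.\<close>

lemma prod_residue_order_le:
  assumes dim: "dimension m F E" and S: "finite S" "S \<subseteq> places_above E P"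
  shows "(\<Prod>Q\<in>S. residue_order E Q ^ ram F P E Q) \<le> residue_order F P ^ m"
proof -
  let ?C = "semilocal_ring E S" and ?e = "ram F P E"
  obtain t where t: "prime_element R F P t" by (rule P.exists_prime_element)
  note t_facts = P.prime_elementE[OF t] and E = ff_subfield[OF ff_ext]
  have S_place: "discrete_place R E Q" if "Q \<in> S" for Q using discrete_place_above S(2) that by blast
  have C: "subring ?C R" by (rule subring_semilocal_ring[OF S_place E])
  have OC: "\<O> F P \<subseteq> ?C" using local_ring_subset S(2) P.ring_subset sub by (auto simp: semilocal_ring_def)
  have "?C \<subseteq> E" by (auto simp: semilocal_ring_def)
  note bound = P.index_le_dimension[OF t_facts(4) _ _ C OC this dim]
  have fin: "finite_index ?C (t <# ?C)" and index_bound: "index ?C (t <# ?C) \<le> residue_order F P ^ m"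
    using bound t_facts(2) P.place_eq P.finite_index_place by (simp_all add: residue_order_def)
  have "(\<Prod>Q\<in>S. index (\<O> E Q) (val_ge E Q (int (?e Q)))) \<le> index ?C (t <# ?C)"
  proof (rule index_ge_prod[OF _ subringE(1)[OF C] fin S(1)])
    show "additive_subgroup (t <# ?C) R"
      using ideal_inD(1)[OF C ideal_in_l_coset[OF C]] OC t_facts(4) by blast
    show "\<exists>c\<in>?C. \<forall>Q\<in>S. c \<ominus> g Q \<in> val_ge E Q (int (?e Q))" if "g \<in> (\<Pi>\<^sub>E Q\<in>S. \<O> E Q)" for g
      using semilocal_approximation[OF S(1) S_place E] that by blast
    fix Q assume Q: "Q \<in> S"
    interpret Q: discrete_place R E Q by (rule S_place[OF Q])
    show "additive_subgroup (val_ge E Q (int (?e Q))) R" by (rule Q.val_ge_subgroup)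
    show "finite_index (\<O> E Q) (val_ge E Q (int (?e Q)))" by (rule Q.index_val_ge(1))
    show "\<O> E Q \<subseteq> carrier R" by (rule Q.ring_carrier)
    have "val E Q t = int (?e Q)"
      using val_above[OF _ t_facts(3,6)] Q S(2) P.val_prime_element[OF t] by auto
    then have "t <# \<O> E Q = val_ge E Q (int (?e Q))"
      using Q.l_coset_val_ge[of t 0] Q.val_ge_0 t_facts(3,6) sub by auto
    then show "t <# ?C \<subseteq> val_ge E Q (int (?e Q))"
      using Q unfolding semilocal_ring_def l_coset_def by blast
  qed
  moreover have "index (\<O> E Q) (val_ge E Q (int (?e Q))) = residue_order E Q ^ ?e Q" if "Q \<in> S" for Q
    using discrete_place.index_val_ge(2)[OF S_place[OF that]] .
  ultimately show ?thesis using index_bound by simp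
qed

lemma sum_ram_rel_deg_le:
  assumes "dimension m F E" and S: "finite S" "S \<subseteq> places_above E P"
  shows "(\<Sum>Q\<in>S. ram F P E Q * rel_deg F P E Q) \<le> m"
proof -
  have "residue_order E Q ^ ram F P E Q = residue_order F P ^ (ram F P E Q * rel_deg F P E Q)"
    if "Q \<in> S" for Q
    using residue_order_above[of Q] S(2) that by (auto simp: power_mult[symmetric] mult.commute)
  then have "residue_order F P ^ (\<Sum>Q\<in>S. ram F P E Q * rel_deg F P E Q) \<le> residue_order F P ^ m"
    using prod_residue_order_le[OF assms] by (simp add: power_sum)
  then show ?thesis using residue_order_ge_2[OF ff_base place] by (simp add: power_increasing_iff)
qed

theorem fundamental_inequality:
  assumes dim: "dimension m F E"
  shows "finite (places_above E P)"
    and "(\<Sum>Q\<in>places_above E P. ram F P E Q * rel_deg F P E Q) \<le> m"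
proof -
  have "card S \<le> m" if S: "finite S" "S \<subseteq> places_above E P" for S
  proof -
    have "1 \<le> ram F P E Q * rel_deg F P E Q" if "Q \<in> S" for Q
      using mult_le_mono[OF ram_pos rel_deg_pos, of Q Q] S(2) that by auto
    then have "(\<Sum>Q\<in>S. 1) \<le> (\<Sum>Q\<in>S. ram F P E Q * rel_deg F P E Q)" by (rule sum_mono)
    then show ?thesis using sum_ram_rel_deg_le[OF dim S] by simp
  qed
  then show finite: "finite (places_above E P)"
    using infinite_arbitrarily_large[of "places_above E P" "Suc m"] by (metis Suc_n_not_le_n)
  show "(\<Sum>Q\<in>places_above E P. ram F P E Q * rel_deg F P E Q) \<le> m"
    by (rule sum_ram_rel_deg_le[OF dim finite subset_refl])
qed

end

section \<open>Adjoining elements to ideals\<close>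

context cring
begin

definition ideal_adjoin :: "'a set \<Rightarrow> 'a set \<Rightarrow> 'a \<Rightarrow> 'a set"
  where "ideal_adjoin A I s = I <+>\<^bsub>R\<^esub> (s <# A)"

lemma ideal_adjoin_mem: "x \<in> ideal_adjoin A I s \<longleftrightarrow> (\<exists>i\<in>I. \<exists>a\<in>A. x = i \<oplus> s \<otimes> a)"
  unfolding ideal_adjoin_def by (rule set_add_l_coset_mem)

lemma ideal_in_adjoin:
  assumes "subring A R" "ideal_in I A" "s \<in> A"
  shows "ideal_in (ideal_adjoin A I s) A"
  unfolding ideal_adjoin_def by (rule ideal_in_set_add[OF assms(1,2) ideal_in_l_coset[OF assms(1,3)]])

lemma ideal_subset_adjoin:
  assumes "subring A R" "ideal_in I A" "s \<in> A"
  shows "I \<subseteq> ideal_adjoin A I s"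
  unfolding ideal_adjoin_def
  by (rule ideal_in_subset_set_add(1)[OF assms(1,2) ideal_in_l_coset[OF assms(1,3)]])

lemma mult_mem_ideal_adjoin:
  assumes "subring A R" "ideal_in I A" "s \<in> A" "a \<in> A"
  shows "s \<otimes> a \<in> ideal_adjoin A I s"
proof -
  have "s \<otimes> a \<in> s <# A" using assms(4) unfolding l_coset_mem by blast
  then show ?thesis
    unfolding ideal_adjoin_def
    using ideal_in_subset_set_add(2)[OF assms(1,2) ideal_in_l_coset[OF assms(1,3)]] by blast
qed

lemma self_mem_ideal_adjoin:
  assumes "subring A R" "ideal_in I A" "s \<in> A"
  shows "s \<in> ideal_adjoin A I s"
  using mult_mem_ideal_adjoin[OF assms subringE(3)[OF assms(1)]] subringE(1)[OF assms(1)] assms(3)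
  by auto

lemma ideal_adjoin_of_mem:
  assumes A: "subring A R" and I: "ideal_in I A" and s: "s \<in> I"
  shows "ideal_adjoin A I s = I"
proof
  show "ideal_adjoin A I s \<subseteq> I"
    using ideal_in_r_closed[OF A I _ s] additive_subgroup.a_closed[OF ideal_inD(1)[OF A I]]
    by (auto simp: ideal_adjoin_mem)
  show "I \<subseteq> ideal_adjoin A I s" using ideal_subset_adjoin[OF A I] s ideal_inD(2)[OF A I] by blast
qed

lemma finite_index_adjoin:
  assumes A: "subring A R" and I: "ideal_in I A" "finite_index A I" and s: "s \<in> A"
  shows "finite_index A (ideal_adjoin A I s)"
  using finite_index_antimono[OF ideal_inD(1)[OF A I(1)] ideal_inD(1)[OF A ideal_in_adjoin[OF A I(1) s]]
      subringE(1)[OF A] I(2) ideal_subset_adjoin[OF A I(1) s]] .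

text \<open>Multiplication by \<open>a\<close> maps \<open>A/(I + bA)\<close> onto \<open>(I + aA)/(I + abA)\<close>.\<close>

lemma index_adjoin_mult_le:
  assumes A: "subring A R" and I: "ideal_in I A" "finite_index A I" and a: "a \<in> A" and b: "b \<in> A"
  shows "index A (ideal_adjoin A I (a \<otimes> b)) \<le> index A (ideal_adjoin A I a) * index A (ideal_adjoin A I b)"
proof -
  let ?I = "ideal_adjoin A I"
  note AR = subringE(1)[OF A] and I_facts = ideal_inD[OF A I(1)]
  have ab: "a \<otimes> b \<in> A" using subringE(6)[OF A a b] .
  note ideal = ideal_in_adjoin[OF A I(1)] and fin = finite_index_adjoin[OF A I]
  note subgroup = ideal_inD(1)[OF A ideal]
  have sub: "?I (a \<otimes> b) \<subseteq> ?I a"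
  proof
    fix x assume "x \<in> ?I (a \<otimes> b)"
    then obtain i c where x: "i \<in> I" "c \<in> A" "x = i \<oplus> (a \<otimes> b) \<otimes> c" unfolding ideal_adjoin_mem by blast
    then have "x = i \<oplus> a \<otimes> (b \<otimes> c)" using a b AR by (simp add: m_assoc subset_iff)
    then show "x \<in> ?I a" using x(1) subringE(6)[OF A b x(2)] unfolding ideal_adjoin_mem by blast
  qed
  obtain T where T: "transversal A (?I b) T" "finite T" "card T = index A (?I b)"
    by (rule exists_transversal[OF subgroup[OF b] AR fin[OF b]])
  then have TA: "T \<subseteq> A" and cover_T: "\<And>x. x \<in> A \<Longrightarrow> \<exists>r\<in>T. x \<ominus> r \<in> ?I b"
    by (simp_all add: transversal_def)
  have cover: "\<exists>r\<in>(\<otimes>) a ` T. x \<ominus> r \<in> ?I (a \<otimes> b)" if "x \<in> ?I a" for x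
  proof -
    obtain i c where x: "i \<in> I" "c \<in> A" "x = i \<oplus> a \<otimes> c"
      using \<open>x \<in> ?I a\<close> unfolding ideal_adjoin_mem by blast
    obtain r where r: "r \<in> T" "c \<ominus> r \<in> ?I b" using cover_T[OF x(2)] by blast
    obtain j d where j: "j \<in> I" "d \<in> A" "c \<ominus> r = j \<oplus> b \<otimes> d"
      using r(2) unfolding ideal_adjoin_mem by blast
    have R: "i \<in> carrier R" "j \<in> carrier R" "c \<in> carrier R" "d \<in> carrier R" "r \<in> carrier R"
        "a \<in> carrier R" "b \<in> carrier R"
      using x(1,2) j(1,2) r(1) TA a b I_facts(2) AR by auto
    have "x \<ominus> a \<otimes> r = i \<oplus> a \<otimes> (c \<ominus> r)" unfolding x(3) using R by algebra
    also have "\<dots> = (i \<oplus> a \<otimes> j) \<oplus> (a \<otimes> b) \<otimes> d" unfolding j(3) using R by algebra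
    also have "\<dots> \<in> ?I (a \<otimes> b)"
      using additive_subgroup.a_closed[OF I_facts(1) x(1) I_facts(3)[OF a j(1)]] j(2)
      unfolding ideal_adjoin_mem by blast
    finally show ?thesis using r(1) by blast
  qed
  have IaR: "?I a \<subseteq> carrier R" using additive_subgroup.a_subset[OF subgroup[OF a]] .
  have aT: "finite ((\<otimes>) a ` T)" "(\<otimes>) a ` T \<subseteq> carrier R" using T(2) TA a AR by auto
  note bound = index_le_cover[OF subgroup[OF ab] IaR aT cover]
  have "index (?I a) (?I (a \<otimes> b)) \<le> index A (?I b)"
    using bound(2) card_image_le[OF T(2), of "(\<otimes>) a"] T(3) by simp
  then show ?thesis
    using index_tower(2)[OF subgroup[OF ab] subgroup[OF a] subring_additive_subgroup[OF A] sub
        ideal_inD(2)[OF A ideal[OF a]] fin[OF a] bound(1)] by simp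
qed

lemma index_adjoin_one:
  assumes A: "subring A R" and I: "ideal_in I A"
  shows "index A (ideal_adjoin A I \<one>) = 1"
proof -
  note one = subringE(3)[OF A]
  have "ideal_adjoin A I \<one> = A"
    using ideal.one_imp_carrier[OF ideal_in_adjoin[OF A I one]] self_mem_ideal_adjoin[OF A I one] by simp
  then show ?thesis using index_self(2)[OF subring_additive_subgroup[OF A]] by simp
qed

lemma index_adjoin_pow_le:
  assumes A: "subring A R" and I: "ideal_in I A" "finite_index A I" and a: "a \<in> A"
  shows "index A (ideal_adjoin A I (a [^] (n::nat))) \<le> index A (ideal_adjoin A I a) ^ n"
proof (induction n)
  case 0
  then show ?case using index_adjoin_one[OF A I(1)] by simp
next
  case (Suc n)
  have "index A (ideal_adjoin A I (a [^] Suc n))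
      \<le> index A (ideal_adjoin A I (a [^] n)) * index A (ideal_adjoin A I a)"
    using index_adjoin_mult_le[OF A I subring_nat_pow_closed[OF A a] a] by simp
  also have "\<dots> \<le> index A (ideal_adjoin A I a) ^ n * index A (ideal_adjoin A I a)" using Suc by simp
  finally show ?case by (simp add: mult.commute)
qed

lemma subring_finprod_closed:
  assumes A: "subring A R" and f: "\<And>i. i \<in> S \<Longrightarrow> f i \<in> A"
  shows "finprod R f S \<in> A"
  using f
proof (induction S rule: infinite_finite_induct)
  case (insert i S)
  then have "f i \<in> carrier R" "f \<in> S \<rightarrow> carrier R" using subringE(1)[OF A] by auto
  then show ?case using insert subringE(6)[OF A] by simp
qed (use subringE(3)[OF A] in simp_all)

lemma index_adjoin_prod_le:
  assumes A: "subring A R" and I: "ideal_in I A" "finite_index A I" and S: "finite S"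
    and s: "\<And>i. i \<in> S \<Longrightarrow> s i \<in> A"
  shows "index A (ideal_adjoin A I (\<Otimes>i\<in>S. s i [^] (n i::nat))) \<le> (\<Prod>i\<in>S. index A (ideal_adjoin A I (s i)) ^ n i)"
  using S s
proof (induction S rule: finite_induct)
  case empty
  then show ?case using index_adjoin_one[OF A I(1)] by simp
next
  case (insert i S)
  let ?p = "\<Otimes>i\<in>S. s i [^] n i"
  have pow: "s j [^] n j \<in> A" if "j \<in> insert i S" for j
    using subring_nat_pow_closed[OF A insert.prems[OF that]] .
  have p: "?p \<in> A" using pow by (intro subring_finprod_closed[OF A]) simp
  have "(\<Otimes>i\<in>insert i S. s i [^] n i) = s i [^] n i \<otimes> ?p"
    using insert.hyps pow subringE(1)[OF A] by (intro finprod_insert) auto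
  then have "index A (ideal_adjoin A I (\<Otimes>i\<in>insert i S. s i [^] n i))
      \<le> index A (ideal_adjoin A I (s i [^] n i)) * index A (ideal_adjoin A I ?p)"
    using index_adjoin_mult_le[OF A I pow p] by simp
  also have "\<dots> \<le> index A (ideal_adjoin A I (s i)) ^ n i * (\<Prod>j\<in>S. index A (ideal_adjoin A I (s j)) ^ n j)"
    using index_adjoin_pow_le[OF A I] insert by (intro mult_le_mono) auto
  finally show ?case using insert.hyps by simp
qed

end

section \<open>Places above two given places\<close>

locale place_composite = constant_field R k +
  lower: place_extension R k F E P + upper: place_extension R k F' E' P'
  for R (structure) and k F E P F' E' P' +
  fixes Us
  assumes base_subset: "F \<subseteq> F'" and ext_subset: "E \<subseteq> E'" and place_subset: "P \<subseteq> P'"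
    and dim_lower: "dimension (length Us) F E" and dim_upper: "dimension (length Us) F' E'"
    and basis_carrier: "set Us \<subseteq> carrier R" and basis_independent: "independent F' Us"
    and integral_basis: "Span (\<O> F P) Us = integral_closure_in R (\<O> F P) E"
    and coprime_ram: "\<And>Q. Q \<in> places_above E P \<Longrightarrow> coprime (ram F P E Q) (ram F P F' P')"
begin

abbreviation "\<A> \<equiv> semilocal_ring E (places_above E P)"

definition composite_ring ("\<A>''")
  where "\<A>' = Span (\<O> F' P') Us"

definition place_ideal
  where "place_ideal = Span P' Us"

definition common_places
  where "common_places Q = places_above E' Q \<inter> places_above E' P'"

lemma above_base: "P' \<in> places_above F' P"
  using upper.place place_subset by (simp add: places_over_def)

lemma ext_place: "Q \<in> places_above E P \<Longrightarrow> place_extension R k E E' Q"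
  using lower.ff_ext upper.ff_ext ext_subset places_aboveD(1) by unfold_locales

lemma base_place: "place_extension R k F F' P"
  using lower.ff_base upper.ff_base base_subset lower.place by unfold_locales

lemma base_ring_subset: "\<O> F P \<subseteq> \<O> F' P'"
  using place_extension.local_ring_subset[OF base_place above_base] .

lemmas finite_places = lower.fundamental_inequality(1)[OF dim_lower]

lemma integral_closure: "Span (\<O> F P) Us = \<A>"
  using integral_basis lower.integral_closure_eq by simp

lemma subring_\<A>: "subring \<A> R"
  using subring_semilocal_ring[OF lower.discrete_place_above ff_subfield[OF lower.ff_ext]] .

lemma \<A>_subset: "Q \<in> places_above E P \<Longrightarrow> \<A> \<subseteq> \<O> E Q" "\<A> \<subseteq> E"
  by (auto simp: semilocal_ring_def)

lemma base_subset_\<A>: "\<O> F P \<subseteq> \<A>"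
  using lower.local_ring_subset lower.P.ring_subset lower.sub by (auto simp: semilocal_ring_def)

lemma basis_in_\<A>: "set Us \<subseteq> \<A>"
  using mem_Span[OF lower.P.subring basis_carrier] integral_closure by simp

lemma \<A>_subset_composite: "\<A> \<subseteq> \<A>'"
  using Span_mono[OF base_ring_subset] integral_closure unfolding composite_ring_def by blast

lemma subring_composite: "subring \<A>' R"
  unfolding composite_ring_def
proof (rule subring_Span[OF upper.P.subring basis_carrier])
  show "\<one> \<in> Span (\<O> F' P') Us"
    using \<A>_subset_composite subringE(3)[OF subring_\<A>] unfolding composite_ring_def by blast
  show "u \<otimes> v \<in> Span (\<O> F' P') Us" if "u \<in> set Us" "v \<in> set Us" for u v
    using \<A>_subset_composite subringE(6)[OF subring_\<A>] basis_in_\<A> that unfolding composite_ring_def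
    by blast
qed

lemmas composite_carrier = subringE(1)[OF subring_composite]

lemma composite_subset:
  assumes "additive_subgroup M R" "\<And>a u. a \<in> \<O> F' P' \<Longrightarrow> u \<in> set Us \<Longrightarrow> a \<otimes> u \<in> M"
  shows "\<A>' \<subseteq> M"
  unfolding composite_ring_def by (rule Span_subset[OF assms])

lemma base_ring_scale: "a \<in> \<O> F' P' \<Longrightarrow> x \<in> \<A>' \<Longrightarrow> a \<otimes> x \<in> \<A>'"
  unfolding composite_ring_def
  using Span_mult[OF upper.P.ring_carrier _ subringE(6)[OF upper.P.subring] basis_carrier] upper.P.ring_carrier
  by blast

lemma base_ring_subset_composite: "\<O> F' P' \<subseteq> \<A>'"
  using base_ring_scale[OF _ subringE(3)[OF subring_composite]] upper.P.ring_carrier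
  by (auto simp: subset_iff)

lemma place_scale: "p \<in> P' \<Longrightarrow> x \<in> \<A>' \<Longrightarrow> p \<otimes> x \<in> place_ideal"
proof -
  assume p: "p \<in> P'" and x: "x \<in> \<A>'"
  have pR: "p \<in> carrier R" using p upper.P.carrier_subset by blast
  have "p \<otimes> a \<in> P'" if "a \<in> \<O> F' P'" for a
    using ideal_in_r_closed[OF upper.P.subring upper.P.ideal_place that p] .
  then show "p \<otimes> x \<in> place_ideal"
    using Span_mult[OF upper.P.ring_carrier pR _ basis_carrier] x
    unfolding composite_ring_def place_ideal_def by blast
qed

lemma place_subset_ideal: "P' \<subseteq> place_ideal"
  using place_scale[OF _ subringE(3)[OF subring_composite]] upper.P.carrier_subset
  by (auto simp: subset_iff)

lemma ideal_place_ideal: "ideal_in place_ideal \<A>'"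
proof -
  note J = Span_subgroup[OF upper.P.place_subgroup basis_carrier]
  have sub: "place_ideal \<subseteq> \<A>'"
    unfolding place_ideal_def composite_ring_def by (rule Span_mono[OF upper.P.place_subset])
  have "x \<otimes> y \<in> place_ideal" if x: "x \<in> \<A>'" and y: "y \<in> place_ideal" for x y
  proof -
    have xR: "x \<in> carrier R" using x composite_carrier by blast
    have "a \<otimes> u \<in> {y \<in> carrier R. x \<otimes> y \<in> place_ideal}" if au: "a \<in> P'" "u \<in> set Us" for a u
    proof -
      have R: "a \<in> carrier R" "u \<in> carrier R" using au upper.P.carrier_subset basis_carrier by auto
      have "x \<otimes> u \<in> \<A>'"
        using subringE(6)[OF subring_composite x] au(2) basis_in_\<A> \<A>_subset_composite by blast
      then have "a \<otimes> (x \<otimes> u) \<in> place_ideal" by (rule place_scale[OF au(1)])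
      moreover have "x \<otimes> (a \<otimes> u) = a \<otimes> (x \<otimes> u)" using R xR by (simp add: m_lcomm)
      ultimately show ?thesis using R by simp
    qed
    moreover have "additive_subgroup {y \<in> carrier R. x \<otimes> y \<in> place_ideal} R"
      unfolding place_ideal_def by (rule additive_subgroup_mult_vimage[OF J xR])
    ultimately show ?thesis using Span_subset y unfolding place_ideal_def by blast
  qed
  then show ?thesis using J sub unfolding ideal_in_iff[OF subring_composite] place_ideal_def by blast
qed

lemma finite_index_place_ideal: "finite_index \<A>' place_ideal"
proof (rule index_le_span(1)[OF upper.P.place_subgroup upper.P.ring_carrier upper.P.finite_index_place _
      composite_carrier basis_carrier])
  note J = ideal_inD(1)[OF subring_composite ideal_place_ideal]
  show "additive_subgroup place_ideal R" by (rule J)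
  show "a \<otimes> u \<in> place_ideal" if "a \<in> P'" "u \<in> set Us" for a u
    using place_scale that basis_in_\<A> \<A>_subset_composite by blast
  fix c assume c: "c \<in> \<A>'"
  then obtain as where as: "set as \<subseteq> \<O> F' P'" "length as = length Us" "c = combine as Us"
    unfolding composite_ring_def Span_iff_combine by blast
  have "c \<ominus> c = \<zero>" using c composite_carrier by (auto simp: a_minus_def r_neg)
  then show "\<exists>as. set as \<subseteq> \<O> F' P' \<and> length as = length Us \<and> c \<ominus> combine as Us \<in> place_ideal"
    using as additive_subgroup.zero_closed[OF J] by (intro exI[of _ as]) simp
qed

lemma index_place_ideal_ge: "residue_order F' P' ^ length Us \<le> index \<A>' place_ideal"
  unfolding residue_order_def
proof (rule index_ge_free[OF upper.P.place_subgroup subring_additive_subgroup[OF upper.P.subring]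
      upper.P.finite_index_place _ composite_carrier finite_index_place_ideal basis_carrier])
  show "additive_subgroup place_ideal R" using ideal_inD(1)[OF subring_composite ideal_place_ideal] .
  show "combine as Us \<in> \<A>'" if "set as \<subseteq> \<O> F' P'" "length as = length Us" for as
    unfolding composite_ring_def Span_iff_combine using that by blast
  fix as assume as: "set as \<subseteq> \<O> F' P'" "length as = length Us" "combine as Us \<in> place_ideal"
  then obtain bs where bs: "set bs \<subseteq> P'" "length bs = length Us" "combine as Us = combine bs Us"
    unfolding place_ideal_def Span_iff_combine by blast
  have F': "set as \<subseteq> F'" "set bs \<subseteq> F'" using as(1) bs(1) upper.P.place_subset upper.P.ring_subset by auto
  have "combine as Us \<in> Span F' Us" unfolding Span_iff_combine using F'(1) as(2) by blast
  then have "\<exists>!cs. set cs \<subseteq> F' \<and> length cs = length Us \<and> combine as Us = combine cs Us"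
    by (rule unique_decomposition[OF upper.P.subfield basis_independent])
  then have "as = bs" using F' as(2) bs(2,3) by blast
  then show "set as \<subseteq> P'" using bs(1) by simp
qed

definition separator
  where "separator Q = (SOME s. s \<in> \<A> \<and> s \<noteq> \<zero> \<and> val E Q s = 1 \<and> (\<forall>T\<in>places_above E P. T \<noteq> Q \<longrightarrow> val E T s = 0))"

lemma separator:
  assumes Q: "Q \<in> places_above E P"
  shows "separator Q \<in> \<A>" "separator Q \<noteq> \<zero>" "val E Q (separator Q) = 1"
    and "T \<in> places_above E P \<Longrightarrow> T \<noteq> Q \<Longrightarrow> val E T (separator Q) = 0"
    and "separator Q \<in> E" "separator Q \<in> \<A>'" "separator Q \<in> Q"
proof -
  interpret Q: discrete_place R E Q by (rule lower.discrete_place_above[OF Q])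
  have "\<exists>s. s \<in> \<A> \<and> s \<noteq> \<zero> \<and> val E Q s = 1 \<and> (\<forall>T\<in>places_above E P. T \<noteq> Q \<longrightarrow> val E T s = 0)"
    using exists_separating_element[OF finite_places lower.discrete_place_above Q] by blast
  then have s: "separator Q \<in> \<A> \<and> separator Q \<noteq> \<zero> \<and> val E Q (separator Q) = 1 \<and>
      (\<forall>T\<in>places_above E P. T \<noteq> Q \<longrightarrow> val E T (separator Q) = 0)"
    unfolding separator_def by (rule someI_ex)
  then show "separator Q \<in> \<A>" "separator Q \<noteq> \<zero>" "val E Q (separator Q) = 1"
    "T \<in> places_above E P \<Longrightarrow> T \<noteq> Q \<Longrightarrow> val E T (separator Q) = 0" by auto
  show "separator Q \<in> E" "separator Q \<in> \<A>'" using s \<A>_subset(2) \<A>_subset_composite by auto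
  then show "separator Q \<in> Q" using s Q.place_iff_val_pos by simp
qed

lemma separator_divides:
  assumes Q: "Q \<in> places_above E P" and a: "a \<in> \<A>" "a \<in> Q"
  shows "\<exists>b\<in>\<A>. a = separator Q \<otimes> b"
proof (rule semilocal_divides[OF lower.discrete_place_above ff_subfield[OF lower.ff_ext] separator(5,2)[OF Q]])
  show "a \<in> E" using a(1) \<A>_subset(2) by blast
  fix T assume T: "T \<in> places_above E P"
  interpret T: discrete_place R E T by (rule lower.discrete_place_above[OF T])
  show "a \<in> val_ge E T (val E T (separator Q))"
  proof (cases "T = Q")
    case True
    then show ?thesis using a(2) T.val_ge_1 separator(3)[OF Q] by simp
  next
    case False
    then show ?thesis using a(1) \<A>_subset(1)[OF T] T.val_ge_0 separator(4)[OF Q T False] by auto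
  qed
qed

definition above_ideal
  where "above_ideal Q = ideal_adjoin \<A>' place_ideal (separator Q)"

context
  fixes Q
  assumes Q: "Q \<in> places_above E P"
begin

lemmas ideal_above_ideal =
  ideal_in_adjoin[OF subring_composite ideal_place_ideal separator(6)[OF Q], folded above_ideal_def]
lemmas above_ideal_closed = ideal_inD[OF subring_composite ideal_above_ideal]
lemmas place_ideal_subset_above =
  ideal_subset_adjoin[OF subring_composite ideal_place_ideal separator(6)[OF Q], folded above_ideal_def]
lemmas separator_in_above =
  self_mem_ideal_adjoin[OF subring_composite ideal_place_ideal separator(6)[OF Q], folded above_ideal_def]
lemmas finite_index_above_ideal =
  finite_index_adjoin[OF subring_composite ideal_place_ideal finite_index_place_ideal separator(6)[OF Q],
    folded above_ideal_def]

lemma \<A>_inter_subset_above: "\<A> \<inter> Q \<subseteq> above_ideal Q"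
  using separator_divides[OF Q] \<A>_subset_composite
    mult_mem_ideal_adjoin[OF subring_composite ideal_place_ideal separator(6)[OF Q], folded above_ideal_def]
  by auto

end

text \<open>The product of the \<open>s\<^sub>Q\<close> to the powers \<open>e(Q|P)\<close> is divisible in \<open>\<A>\<close> by a prime element of \<open>P\<close>.\<close>

lemma prod_separators_in_place_ideal: "(\<Otimes>Q\<in>places_above E P. separator Q [^] ram F P E Q) \<in> place_ideal"
proof -
  let ?S = "places_above E P" and ?s = "\<lambda>Q. separator Q [^] ram F P E Q"
  let ?p = "\<Otimes>Q\<in>?S. ?s Q"
  obtain t where t: "prime_element R F P t" by (rule lower.P.exists_prime_element)
  note t_facts = lower.P.prime_elementE[OF t]
  have s_mem: "?s Q \<in> \<A>" if "Q \<in> ?S" for Q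
    using subring_nat_pow_closed[OF subring_\<A> separator(1)[OF that]] .
  have p: "?p \<in> \<A>" by (rule subring_finprod_closed[OF subring_\<A> s_mem])
  have tE: "t \<in> E" using t_facts(3) lower.sub by blast
  have "\<exists>b\<in>\<A>. ?p = t \<otimes> b"
  proof (rule semilocal_divides[OF lower.discrete_place_above ff_subfield[OF lower.ff_ext] tE t_facts(6)])
    show "?p \<in> E" using p \<A>_subset(2) by blast
    fix Q assume Q: "Q \<in> ?S"
    interpret Q: discrete_place R E Q by (rule lower.discrete_place_above[OF Q])
    have "?p = ?s Q \<otimes> (\<Otimes>T\<in>?S - {Q}. ?s T)"
    proof -
      have "(\<Otimes>T\<in>insert Q (?S - {Q}). ?s T) = ?s Q \<otimes> (\<Otimes>T\<in>?S - {Q}. ?s T)"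
        using finite_places s_mem Q subringE(1)[OF subring_\<A>] by (intro finprod_insert) auto
      then show ?thesis using Q by (simp add: insert_absorb)
    qed
    moreover have "(\<Otimes>T\<in>?S - {Q}. ?s T) \<in> val_ge E Q 0"
      using subring_finprod_closed[OF subring_\<A>, of "?S - {Q}" ?s] s_mem \<A>_subset(1)[OF Q] Q.val_ge_0
      by blast
    moreover have "?s Q \<in> val_ge E Q (int (ram F P E Q))"
      using Q.val_nat_pow[OF separator(5,2)[OF Q]] separator(3)[OF Q] by (simp add: val_ge_def)
    ultimately have "?p \<in> val_ge E Q (int (ram F P E Q))" using Q.val_ge_mult[of _ _ _ 0] by fastforce
    then show "?p \<in> val_ge E Q (val E Q t)"
      using lower.val_above[OF Q t_facts(3,6)] lower.P.val_prime_element[OF t] by simp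
  qed
  then obtain b where b: "b \<in> \<A>" "?p = t \<otimes> b" by blast
  have "t \<otimes> b \<in> place_ideal" using place_scale t_facts(1) place_subset b(1) \<A>_subset_composite by blast
  then show ?thesis unfolding b(2) .
qed

lemma index_place_ideal_le:
  "index \<A>' place_ideal \<le> (\<Prod>Q\<in>places_above E P. index \<A>' (above_ideal Q) ^ ram F P E Q)"
  using index_adjoin_prod_le[OF subring_composite ideal_place_ideal finite_index_place_ideal finite_places,
      of separator "ram F P E"] separator(6)
    ideal_adjoin_of_mem[OF subring_composite ideal_place_ideal prod_separators_in_place_ideal]
  by (simp add: above_ideal_def)

lemma residue_spanning_list:
  assumes Q: "Q \<in> places_above E P"
  obtains Ws where "set Ws \<subseteq> \<A>" "length Ws \<le> rel_deg F P E Q"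
    "\<And>c. c \<in> \<A> \<Longrightarrow> \<exists>as. set as \<subseteq> \<O> F P \<and> length as = length Ws \<and> c \<ominus> combine as Ws \<in> \<A> \<inter> Q"
proof (rule lower.P.exists_spanning_list[OF subring_\<A> base_subset_\<A>])
  interpret Q: discrete_place R E Q by (rule lower.discrete_place_above[OF Q])
  note \<A>R = subringE(1)[OF subring_\<A>]
  show "ideal_in (\<A> \<inter> Q) \<A>"
  proof (rule ideal_in_minusI[OF subring_\<A>])
    show "a \<ominus> b \<in> \<A> \<inter> Q" if "a \<in> \<A> \<inter> Q" "b \<in> \<A> \<inter> Q" for a b
      using that subring_minus_closed[OF subring_\<A>] additive_subgroup_minus_closed[OF Q.place_subgroup]
      by blast
    show "a \<otimes> x \<in> \<A> \<inter> Q" if "a \<in> \<A>" "x \<in> \<A> \<inter> Q" for a x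
      using that subringE(6)[OF subring_\<A>] Q.place_mult \<A>_subset(1)[OF Q] by blast
  qed (use subringE(2)[OF subring_\<A>] Q.zero_in_place in auto)
  show "nonunits (\<O> F P) \<subseteq> \<A> \<inter> Q"
    using lower.P.place_eq lower.P.place_subset base_subset_\<A> places_aboveD(2)[OF Q] by blast
  fix Vs assume Vs: "set Vs \<subseteq> \<A>" and independent: "lower.P.independent_mod (\<A> \<inter> Q) Vs"
  note finite_quotient = index_mono[OF Q.finite_index_place \<A>_subset(1)[OF Q]]
  have combine_\<A>: "combine as Vs \<in> \<A>" if "set as \<subseteq> \<O> F P" for as
    using combine_mem[OF subring_additive_subgroup[OF subring_\<A>] _ that Vs] base_subset_\<A>
      subringE(6)[OF subring_\<A>] by blast
  have "index (\<O> F P) P ^ length Vs \<le> index \<A> Q"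
  proof (rule index_ge_free[OF lower.P.place_subgroup subring_additive_subgroup[OF lower.P.subring]
        lower.P.finite_index_place Q.place_subgroup \<A>R finite_quotient(1)])
    show "set Vs \<subseteq> carrier R" using Vs \<A>R by (rule subset_trans)
    show "set as \<subseteq> P" if "set as \<subseteq> \<O> F P" "length as = length Vs" "combine as Vs \<in> Q" for as
      using independent that combine_\<A> lower.P.place_eq unfolding lower.P.independent_mod_def by blast
  qed (rule combine_\<A>)
  also have "\<dots> \<le> residue_order F P ^ rel_deg F P E Q"
    using finite_quotient(2) lower.residue_order_above[OF Q] by (simp add: residue_order_def)
  finally show "length Vs \<le> rel_deg F P E Q"
    using residue_order_ge_2[OF lower.ff_base lower.place]
    by (simp add: residue_order_def power_increasing_iff)
qed (use that in blast)

lemma composite_subset_span_add: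
  assumes Q: "Q \<in> places_above E P" and Ws: "set Ws \<subseteq> \<A>"
    and span: "\<And>c. c \<in> \<A> \<Longrightarrow> \<exists>as. set as \<subseteq> \<O> F P \<and> length as = length Ws \<and> c \<ominus> combine as Ws \<in> \<A> \<inter> Q"
  shows "\<A>' \<subseteq> Span (\<O> F' P') Ws <+> above_ideal Q"
proof (rule composite_subset)
  note \<A>R = subringE(1)[OF subring_\<A>] and I = above_ideal_closed[OF Q]
  have WsR: "set Ws \<subseteq> carrier R" using Ws \<A>R by (rule subset_trans)
  note B = Span_subgroup[OF subring_additive_subgroup[OF upper.P.subring] WsR]
  show "additive_subgroup (Span (\<O> F' P') Ws <+> above_ideal Q) R"
    by (rule add_additive_subgroups[OF B I(1)])
  fix a u assume a: "a \<in> \<O> F' P'" and "u \<in> set Us"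
  then have u: "u \<in> \<A>" using basis_in_\<A> by blast
  obtain as where as: "set as \<subseteq> \<O> F P" "length as = length Ws" "u \<ominus> combine as Ws \<in> \<A> \<inter> Q"
    using span[OF u] by blast
  define w where "w = combine as Ws"
  have w: "w \<in> Span (\<O> F' P') Ws"
    unfolding w_def Span_iff_combine using as(1,2) base_ring_subset by blast
  have R: "a \<in> carrier R" "u \<in> carrier R" "w \<in> carrier R"
    using a u upper.P.ring_carrier \<A>R w additive_subgroup.a_subset[OF B] by auto
  have "u \<ominus> w \<in> above_ideal Q" using \<A>_inter_subset_above[OF Q] as(3) unfolding w_def by blast
  then have "a \<otimes> (u \<ominus> w) \<in> above_ideal Q" using I(3) a base_ring_subset_composite by blast
  moreover have "a \<otimes> w \<in> Span (\<O> F' P') Ws"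
    using Span_mult[OF upper.P.ring_carrier R(1) subringE(6)[OF upper.P.subring a] WsR w] .
  moreover have "a \<otimes> u = a \<otimes> w \<oplus> a \<otimes> (u \<ominus> w)" using R by algebra
  ultimately show "a \<otimes> u \<in> Span (\<O> F' P') Ws <+> above_ideal Q" unfolding set_add_mem by blast
qed

lemma index_above_ideal_le:
  assumes Q: "Q \<in> places_above E P"
  shows "index \<A>' (above_ideal Q) \<le> residue_order F' P' ^ rel_deg F P E Q"
proof -
  obtain Ws where Ws: "set Ws \<subseteq> \<A>" "length Ws \<le> rel_deg F P E Q"
      "\<And>c. c \<in> \<A> \<Longrightarrow> \<exists>as. set as \<subseteq> \<O> F P \<and> length as = length Ws \<and> c \<ominus> combine as Ws \<in> \<A> \<inter> Q"
    using residue_spanning_list[OF Q] by blast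
  have WsR: "set Ws \<subseteq> carrier R" using Ws(1) subringE(1)[OF subring_\<A>] by (rule subset_trans)
  note I = above_ideal_closed[OF Q]
  have sub: "\<A>' \<subseteq> Span (\<O> F' P') Ws <+> above_ideal Q"
    by (rule composite_subset_span_add[OF Q Ws(1)]) (rule Ws(3))
  have "index \<A>' (above_ideal Q) \<le> index (\<O> F' P') P' ^ length Ws"
  proof (rule index_le_span(2)[OF upper.P.place_subgroup upper.P.ring_carrier upper.P.finite_index_place
        I(1) composite_carrier WsR])
    show "a \<otimes> u \<in> above_ideal Q" if "a \<in> P'" "u \<in> set Ws" for a u
      using place_scale that Ws(1) \<A>_subset_composite place_ideal_subset_above[OF Q] by blast
    fix c assume "c \<in> \<A>'"
    then obtain w j where c: "w \<in> Span (\<O> F' P') Ws" "j \<in> above_ideal Q" "c = w \<oplus> j"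
      using sub unfolding subset_iff set_add_mem by blast
    then obtain as where as: "set as \<subseteq> \<O> F' P'" "length as = length Ws" "w = combine as Ws"
      unfolding Span_iff_combine by blast
    have "w \<in> carrier R" "j \<in> carrier R"
      using c(1,2) Span_in_carrier[OF upper.P.ring_carrier WsR] additive_subgroup.a_subset[OF I(1)]
      by auto
    then have "c \<ominus> w = j" unfolding c(3) by algebra
    then show "\<exists>as. set as \<subseteq> \<O> F' P' \<and> length as = length Ws \<and> c \<ominus> combine as Ws \<in> above_ideal Q"
      using as c(2) by auto
  qed
  also have "\<dots> \<le> residue_order F' P' ^ rel_deg F P E Q"
    using Ws(2) residue_order_ge_2[OF upper.ff_base upper.place]
    by (simp add: residue_order_def power_increasing)
  finally show ?thesis .
qed

lemma common_placesD:
  assumes Q: "Q \<in> places_above E P" and Q': "Q' \<in> common_places Q"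
  shows "Q' \<in> places_above E' Q" "Q' \<in> places_above E' P'" "Q' \<in> places_of E'"
    and "discrete_place R E' Q'" "\<A>' \<subseteq> \<O> E' Q'" "above_ideal Q \<subseteq> Q'"
proof -
  show Q'_above: "Q' \<in> places_above E' Q" "Q' \<in> places_above E' P'"
    using Q' by (simp_all add: common_places_def)
  then show "Q' \<in> places_of E'" using places_aboveD(1) by blast
  show Q'_place: "discrete_place R E' Q'" by (rule upper.discrete_place_above[OF Q'_above(2)])
  interpret Q': discrete_place R E' Q' by (rule Q'_place)
  have "\<A> \<subseteq> \<O> E' Q'"
    using place_extension.local_ring_subset[OF ext_place[OF Q] Q'_above(1)] \<A>_subset(1)[OF Q] by blast
  then have "a \<otimes> u \<in> \<O> E' Q'" if "a \<in> \<O> F' P'" "u \<in> set Us" for a u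
    using subringE(6)[OF Q'.subring] upper.local_ring_subset[OF Q'_above(2)] basis_in_\<A> that by blast
  then show sub: "\<A>' \<subseteq> \<O> E' Q'"
    using composite_subset[OF subring_additive_subgroup[OF Q'.subring]] by blast
  have mult: "a \<otimes> x \<in> Q'" if "a \<in> Q'" "x \<in> \<A>'" for a x
    using ideal_in_r_closed[OF Q'.subring Q'.ideal_place] that sub by blast
  have "a \<otimes> u \<in> Q'" if "a \<in> P'" "u \<in> set Us" for a u
    using mult places_aboveD(2)[OF Q'_above(2)] that basis_in_\<A> \<A>_subset_composite by blast
  then have "place_ideal \<subseteq> Q'" unfolding place_ideal_def by (rule Span_subset[OF Q'.place_subgroup])
  moreover have "separator Q \<otimes> a \<in> Q'" if "a \<in> \<A>'" for a
    using mult separator(7)[OF Q] places_aboveD(2)[OF Q'_above(1)] that by blast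
  ultimately show "above_ideal Q \<subseteq> Q'"
    unfolding above_ideal_def
    by (auto simp: ideal_adjoin_mem intro!: additive_subgroup.a_closed[OF Q'.place_subgroup])
qed

lemma frobenius_above_ideal:
  assumes Q: "Q \<in> places_above E P" and n: "deg_of F' P' dvd n" "deg_of E Q dvd n" and x: "x \<in> \<A>'"
  shows "x [^] (card k ^ n) \<ominus> x \<in> above_ideal Q"
proof -
  let ?q = "card k ^ n" and ?M = "{x \<in> carrier R. x [^] (card k ^ n) \<ominus> x \<in> above_ideal Q}"
  note I = above_ideal_closed[OF Q]
  interpret Q: discrete_place R E Q by (rule lower.discrete_place_above[OF Q])
  have "additive_subgroup ?M R"
  proof (rule additive_subgroup_minusI)
    have "?q \<noteq> 0" using card_constants_ge_2 by simp
    then show "\<zero> \<in> ?M"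
      using additive_subgroup.zero_closed[OF I(1)] by (simp add: nat_pow_zero a_minus_def)
    fix a b assume ab: "a \<in> ?M" "b \<in> ?M"
    then have R: "a \<in> carrier R" "b \<in> carrier R" by auto
    have "(u \<ominus> v) \<ominus> (a \<ominus> b) = (u \<ominus> a) \<ominus> (v \<ominus> b)" if "u \<in> carrier R" "v \<in> carrier R" for u v
      using that R by algebra
    then have "(a \<ominus> b) [^] ?q \<ominus> (a \<ominus> b) = (a [^] ?q \<ominus> a) \<ominus> (b [^] ?q \<ominus> b)"
      unfolding frobenius_constants_minus[OF R] using R by simp
    then show "a \<ominus> b \<in> ?M" using ab additive_subgroup_minus_closed[OF I(1)] by simp
  qed auto
  moreover have "a \<otimes> u \<in> ?M" if a: "a \<in> \<O> F' P'" and u: "u \<in> set Us" for a u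
  proof -
    have uA: "u \<in> \<A>" "u \<in> \<A>'" using u basis_in_\<A> \<A>_subset_composite by auto
    have R: "a \<in> carrier R" "u \<in> carrier R" using a u upper.P.ring_carrier basis_carrier by auto
    have "u [^] ?q \<ominus> u \<in> Q"
      using pow_card_constants[OF lower.ff_ext places_aboveD(1)[OF Q] _ n(2)] \<A>_subset(1)[OF Q] uA(1)
      by blast
    moreover have "u [^] ?q \<ominus> u \<in> \<A>"
      using subring_minus_closed[OF subring_\<A> subring_nat_pow_closed[OF subring_\<A> uA(1)] uA(1)] .
    ultimately have "u [^] ?q \<ominus> u \<in> above_ideal Q" using \<A>_inter_subset_above[OF Q] by blast
    moreover have "a [^] ?q \<in> \<A>'"
      using subring_nat_pow_closed[OF upper.P.subring a] base_ring_subset_composite by blast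
    ultimately have "a [^] ?q \<otimes> (u [^] ?q \<ominus> u) \<in> above_ideal Q" using I(3) by blast
    moreover have "(a [^] ?q \<ominus> a) \<otimes> u \<in> above_ideal Q"
      using place_scale[OF pow_card_constants[OF upper.ff_base upper.place a n(1)] uA(2)]
        place_ideal_subset_above[OF Q] by blast
    moreover have "(a \<otimes> u) [^] ?q \<ominus> a \<otimes> u = a [^] ?q \<otimes> (u [^] ?q \<ominus> u) \<oplus> (a [^] ?q \<ominus> a) \<otimes> u"
    proof -
      have "b \<otimes> v \<ominus> a \<otimes> u = b \<otimes> (v \<ominus> u) \<oplus> (b \<ominus> a) \<otimes> u" if "b \<in> carrier R" "v \<in> carrier R" for b v
        using that R by algebra
      then show ?thesis using R by (simp add: nat_pow_distrib)
    qed
    ultimately show ?thesis using additive_subgroup.a_closed[OF I(1)] R by simp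
  qed
  ultimately have "\<A>' \<subseteq> ?M" by (rule composite_subset)
  then show ?thesis using x by blast
qed

lemma common_placesI:
  assumes Q: "Q \<in> places_above E P" and Q': "Q' \<in> places_of E'" "above_ideal Q \<subseteq> Q'"
  shows "Q' \<in> common_places Q"
proof -
  have P': "P' \<subseteq> Q'" using place_subset_ideal place_ideal_subset_above[OF Q] Q'(2) by blast
  then have above: "Q' \<in> places_above E' P" "Q' \<in> places_above E' P'"
    using Q'(1) place_subset by (auto simp: places_over_def)
  interpret FE': place_extension R k F E' P
    using lower.ff_base upper.ff_ext lower.sub ext_subset lower.place by unfold_locales auto
  note T = FE'.above_inter_intermediate[OF lower.ff_ext lower.sub ext_subset above(1)]
  interpret T: discrete_place R E "Q' \<inter> E" by (rule lower.discrete_place_above[OF T(1)])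
  have "separator Q \<in> Q' \<inter> E" using separator_in_above[OF Q] Q'(2) separator(5)[OF Q] by blast
  then have "1 \<le> val E (Q' \<inter> E) (separator Q)"
    using T.place_iff_val_pos[OF separator(5,2)[OF Q]] by blast
  then have "Q' \<inter> E = Q" using separator(4)[OF Q T(1)] by force
  then show ?thesis using T(2) above(2) by (simp add: common_places_def)
qed

lemma one_in_adjoin_above_ideal:
  assumes Q: "Q \<in> places_above E P" and c: "c \<in> \<A>'" and unit: "\<And>Q'. Q' \<in> common_places Q \<Longrightarrow> c \<notin> Q'"
  shows "\<one> \<in> ideal_adjoin \<A>' (above_ideal Q) c"
proof (rule ccontr)
  let ?K = "ideal_adjoin \<A>' (above_ideal Q) c"
  assume "\<one> \<notin> ?K"
  note K = ideal_in_adjoin[OF subring_composite ideal_above_ideal[OF Q] c]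
    and sub = ideal_subset_adjoin[OF subring_composite ideal_above_ideal[OF Q] c]
  have "\<A>' \<subseteq> E'"
  proof (rule composite_subset)
    note E' = subfieldE(1)[OF ff_subfield[OF upper.ff_ext]]
    show "additive_subgroup E' R" by (rule subring_additive_subgroup[OF E'])
    show "a \<otimes> u \<in> E'" if "a \<in> \<O> F' P'" "u \<in> set Us" for a u
      using subringE(6)[OF E'] that upper.P.ring_subset upper.sub basis_in_\<A> \<A>_subset(2) ext_subset
      by blast
  qed
  moreover have "k \<subseteq> \<A>'"
    using constants_subset[OF upper.ff_base upper.place] base_ring_subset_composite by blast
  moreover have "separator Q \<in> ?K" using separator_in_above[OF Q] sub by blast
  ultimately obtain Q' where Q': "Q' \<in> places_of E'" "?K \<subseteq> Q'"
    using exists_place_containing_ideal[OF upper.ff_ext subring_composite _ _ K \<open>\<one> \<notin> ?K\<close> _ separator(2)[OF Q]]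
    by blast
  then have "Q' \<in> common_places Q" using common_placesI[OF Q Q'(1)] sub by blast
  moreover have "c \<in> Q'"
    using self_mem_ideal_adjoin[OF subring_composite ideal_above_ideal[OF Q] c] Q'(2) by blast
  ultimately show False using unit by blast
qed

text \<open>The ring \<open>\<A>'/I\<^sub>Q\<close> is reduced, since some power of Frobenius acts on it as the identity.\<close>

lemma mem_above_ideal:
  assumes Q: "Q \<in> places_above E P" and x: "x \<in> \<A>'" "\<And>Q'. Q' \<in> common_places Q \<Longrightarrow> x \<in> Q'"
  shows "x \<in> above_ideal Q"
proof -
  note I = above_ideal_closed[OF Q]
  define n where "n = lcm (deg_of F' P') (deg_of E Q)"
  have "1 \<le> deg_of F' P'" "1 \<le> deg_of E Q"
    using deg_pos upper.ff_base upper.place lower.ff_ext places_aboveD(1)[OF Q] by blast+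
  then have "n \<noteq> 0" by (simp add: n_def)
  then have "2 \<le> card k ^ n" using card_constants_ge_2 self_le_power[of "card k" n] by linarith
  then obtain r where r: "card k ^ n = Suc (Suc r)" by (metis add_2_eq_Suc le_Suc_ex)
  have pow: "x [^] Suc (Suc r) \<ominus> x \<in> above_ideal Q"
    using frobenius_above_ideal[OF Q _ _ x(1), of n] r by (simp add: n_def)
  let ?c = "\<one> \<ominus> x [^] Suc r"
  have c: "?c \<in> \<A>'"
    using subring_minus_closed[OF subring_composite subringE(3)] subring_nat_pow_closed x(1) subring_composite
    by blast
  have R: "x \<in> carrier R" "?c \<in> carrier R" using x(1) c composite_carrier by auto
  have "?c \<notin> Q'" if Q': "Q' \<in> common_places Q" for Q'
  proof
    assume c_mem: "?c \<in> Q'"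
    interpret Q': discrete_place R E' Q' by (rule common_placesD(4)[OF Q Q'])
    have "x [^] r \<in> \<O> E' Q'"
      using subring_nat_pow_closed[OF Q'.subring] x(1) common_placesD(5)[OF Q Q'] by blast
    then have "x [^] Suc r \<in> Q'" using Q'.place_mult x(2)[OF Q'] by simp
    then have "?c \<oplus> x [^] Suc r \<in> Q'"
      using additive_subgroup.a_closed[OF Q'.place_subgroup c_mem] by blast
    moreover have "?c \<oplus> x [^] Suc r = \<one>" using R(1) by (simp add: a_minus_def a_assoc l_neg)
    ultimately show False using Q'.one_notin_place by simp
  qed
  then obtain i a where i: "i \<in> above_ideal Q" "a \<in> \<A>'" "\<one> = i \<oplus> ?c \<otimes> a"
    using one_in_adjoin_above_ideal[OF Q c] unfolding ideal_adjoin_mem by blast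
  have R': "i \<in> carrier R" "a \<in> carrier R"
    using i(1,2) additive_subgroup.a_subset[OF I(1)] composite_carrier by auto
  have "x = x \<otimes> (i \<oplus> ?c \<otimes> a)" unfolding i(3)[symmetric] using R(1) by simp
  also have "\<dots> = x \<otimes> i \<ominus> a \<otimes> (x [^] Suc (Suc r) \<ominus> x)"
  proof -
    have "x \<otimes> (i \<oplus> (\<one> \<ominus> y) \<otimes> a) = x \<otimes> i \<ominus> a \<otimes> (y \<otimes> x \<ominus> x)" if "y \<in> carrier R" for y
      using that R(1) R' by algebra
    then show ?thesis using R(1) by simp
  qed
  also have "\<dots> \<in> above_ideal Q"
    using additive_subgroup_minus_closed[OF I(1) I(3)[OF x(1) i(1)] I(3)[OF i(2) pow]] .
  finally show ?thesis .
qed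

end

section \<open>Counting the places of the composite\<close>

lemma prod_le_imp_eq:
  fixes a b :: "'i \<Rightarrow> nat"
  assumes "finite S" "\<And>i. i \<in> S \<Longrightarrow> 0 < a i \<and> a i \<le> b i" "prod b S \<le> prod a S" "j \<in> S"
  shows "a j = b j"
proof (rule ccontr)
  assume "a j \<noteq> b j"
  then have less: "a j < b j" using assms(2,4) by force
  have "prod a S = a j * prod a (S - {j})" using prod.remove[OF assms(1,4)] .
  also have "\<dots> < b j * prod b (S - {j})"
  proof (rule mult_less_le_imp_less[OF less])
    show "prod a (S - {j}) \<le> prod b (S - {j})" using assms(2) by (intro prod_mono) auto
    show "0 < prod a (S - {j})" using assms(2) by (intro prod_pos) auto
  qed simp
  also have "\<dots> = prod b S" using prod.remove[OF assms(1,4), of b] by simp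
  finally show False using assms(3) by simp
qed

context place_composite
begin

lemma ram_le_common:
  assumes Q: "Q \<in> places_above E P" and Q': "Q' \<in> common_places Q"
  shows "ram F P E Q \<le> ram F' P' E' Q'"
proof -
  note above = common_placesD[OF Q Q']
  interpret FE': place_extension R k F E' P
    using lower.ff_base upper.ff_ext lower.sub ext_subset lower.place by unfold_locales auto
  have "ram F P E' Q' = ram E Q E' Q' * ram F P E Q"
    using FE'.ram_intermediate[OF lower.ff_ext lower.sub ext_subset Q above(1)] .
  moreover have "ram F P E' Q' = ram F' P' E' Q' * ram F P F' P'"
    using FE'.ram_intermediate[OF upper.ff_base base_subset upper.sub above_base above(2)] .
  ultimately have "ram F P E Q dvd ram F' P' E' Q' * ram F P F' P'" by (metis dvd_triv_right)
  then have "ram F P E Q dvd ram F' P' E' Q'"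
    using coprime_ram[OF Q] by (simp add: coprime_dvd_mult_left_iff)
  then show ?thesis using upper.ram_pos[OF above(2)] by (intro dvd_imp_le) auto
qed

lemma finite_common_places: "finite (common_places Q)"
  using upper.fundamental_inequality(1)[OF dim_upper] by (simp add: common_places_def)

lemma common_places_disjoint:
  assumes "Q \<in> places_above E P" "T \<in> places_above E P" "Q \<noteq> T"
  shows "common_places Q \<inter> common_places T = {}"
proof -
  have "Q' \<inter> E = Q" "Q' \<inter> E = T" if "Q' \<in> common_places Q \<inter> common_places T" for Q'
    using place_extension.above_inter(1)[OF ext_place] assms(1,2) that by (auto simp: common_places_def)
  then show ?thesis using assms(3) by blast
qed

lemma index_composite_le:
  assumes Q: "Q \<in> places_above E P" and Q': "Q' \<in> common_places Q"
  shows "finite_index \<A>' Q'" "0 < index \<A>' Q'" "index \<A>' Q' \<le> residue_order E' Q'"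
proof -
  interpret Q': discrete_place R E' Q' by (rule common_placesD(4)[OF Q Q'])
  note quotient = index_mono[OF Q'.finite_index_place common_placesD(5)[OF Q Q']]
  show "finite_index \<A>' Q'" "index \<A>' Q' \<le> residue_order E' Q'"
    using quotient by (simp_all add: residue_order_def)
  then show "0 < index \<A>' Q'" using index_pos subringE(3)[OF subring_composite] by blast
qed

lemma index_above_ideal_le_prod:
  assumes Q: "Q \<in> places_above E P"
  shows "index \<A>' (above_ideal Q) \<le> (\<Prod>Q'\<in>common_places Q. index \<A>' Q')"
proof (rule index_le_prod[OF subring_additive_subgroup[OF subring_composite] above_ideal_closed(1)[OF Q]
      finite_index_above_ideal[OF Q] finite_common_places])
  show "additive_subgroup Q' R" if "Q' \<in> common_places Q" for Q'
    using discrete_place.place_subgroup[OF common_placesD(4)[OF Q that]] .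
  show "finite_index \<A>' Q'" if "Q' \<in> common_places Q" for Q' using index_composite_le(1)[OF Q that] .
  show "x \<in> above_ideal Q" if "x \<in> \<A>'" "\<And>Q'. Q' \<in> common_places Q \<Longrightarrow> x \<in> Q'" for x
    using mem_above_ideal[OF Q that] .
qed

lemma prod_common_places_le:
  "(\<Prod>Q\<in>places_above E P. \<Prod>Q'\<in>common_places Q. residue_order E' Q' ^ ram F' P' E' Q')
    \<le> residue_order F' P' ^ length Us"
proof -
  let ?U = "\<Union>Q\<in>places_above E P. common_places Q"
  have finite: "finite ?U" using finite_places finite_common_places by blast
  have "(\<Prod>Q\<in>places_above E P. \<Prod>Q'\<in>common_places Q. residue_order E' Q' ^ ram F' P' E' Q')
      = (\<Prod>Q'\<in>?U. residue_order E' Q' ^ ram F' P' E' Q')"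
    using finite_places finite_common_places common_places_disjoint
    by (intro prod.UNION_disjoint[symmetric]) auto
  also have "\<dots> \<le> residue_order F' P' ^ length Us"
    by (rule upper.prod_residue_order_le[OF dim_upper finite]) (auto simp: common_places_def)
  finally show ?thesis .
qed

lemma power_length_le_prod:
  "residue_order F' P' ^ length Us \<le> (\<Prod>Q\<in>places_above E P. index \<A>' (above_ideal Q) ^ ram F P E Q)"
  using index_place_ideal_ge index_place_ideal_le by (rule le_trans)

lemma index_above_ideal_pos: "Q \<in> places_above E P \<Longrightarrow> 0 < index \<A>' (above_ideal Q)"
  using index_pos[OF finite_index_above_ideal] subringE(3)[OF subring_composite] by blast

lemma index_above_ideal_eq:
  assumes Q: "Q \<in> places_above E P"
  shows "index \<A>' (above_ideal Q) = residue_order F' P' ^ rel_deg F P E Q"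
proof -
  let ?q = "residue_order F' P'" and ?c = "\<lambda>Q. index \<A>' (above_ideal Q)"
    and ?e = "ram F P E" and ?f = "rel_deg F P E"
  have "(\<Prod>Q\<in>places_above E P. (?q ^ ?f Q) ^ ?e Q) = ?q ^ (\<Sum>Q\<in>places_above E P. ?e Q * ?f Q)"
    by (simp add: power_sum power_mult[symmetric] mult.commute)
  also have "\<dots> \<le> ?q ^ length Us"
    using lower.fundamental_inequality(2)[OF dim_lower] residue_order_ge_2[OF upper.ff_base upper.place]
    by (intro power_increasing) auto
  finally have prod_bound: "(\<Prod>Q\<in>places_above E P. (?q ^ ?f Q) ^ ?e Q) \<le> (\<Prod>Q\<in>places_above E P. ?c Q ^ ?e Q)"
    using power_length_le_prod by simp
  have "0 < ?c Q ^ ?e Q \<and> ?c Q ^ ?e Q \<le> (?q ^ ?f Q) ^ ?e Q" if "Q \<in> places_above E P" for Q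
    using index_above_ideal_pos[OF that] index_above_ideal_le[OF that] by (simp add: power_mono)
  then have "?c Q ^ ?e Q = (?q ^ ?f Q) ^ ?e Q" by (rule prod_le_imp_eq[OF finite_places _ prod_bound Q])
  then show ?thesis using lower.ram_pos[OF Q] by (simp add: power_eq_iff_eq_base)
qed

text \<open>All the inequalities between \<open>|\<A>'/I\<^sub>Q|\<^sup>e\<close> and the product of the \<open>|\<O>\<^sub>Q\<^sub>'/Q'|\<^sup>e\<^sup>'\<close> are equalities,
  because the products of the two ends over all \<open>Q\<close> agree.\<close>

lemma index_above_ideal_eq_prod:
  assumes Q: "Q \<in> places_above E P"
  shows "index \<A>' (above_ideal Q) = (\<Prod>Q'\<in>common_places Q. residue_order E' Q')"
    and "Q' \<in> common_places Q \<Longrightarrow> index \<A>' Q' = residue_order E' Q'"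
proof -
  let ?c = "\<lambda>Q. index \<A>' (above_ideal Q)" and ?i = "\<lambda>Q'. index \<A>' Q'" and ?r = "residue_order E'"
  let ?e = "ram F P E" and ?e' = "ram F' P' E'"
  have le_residue: "prod ?i (common_places Q) \<le> prod ?r (common_places Q)" if "Q \<in> places_above E P" for Q
    using index_composite_le(3)[OF that] by (intro prod_mono) auto
  have residue_pow: "prod ?r (common_places Q) ^ ?e Q \<le> (\<Prod>Q'\<in>common_places Q. ?r Q' ^ ?e' Q')"
    if "Q \<in> places_above E P" for Q
    unfolding prod_power_distrib
    using ram_le_common[OF that] index_composite_le(2,3)[OF that]
    by (intro prod_mono conjI power_increasing) (auto simp: Suc_le_eq intro: less_le_trans)
  have c_le: "?c Q \<le> prod ?r (common_places Q)" if "Q \<in> places_above E P" for Q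
    using index_above_ideal_le_prod[OF that] le_residue[OF that] by (rule le_trans)
  have "?c Q ^ ?e Q = (\<Prod>Q'\<in>common_places Q. ?r Q' ^ ?e' Q')"
  proof (rule prod_le_imp_eq[OF finite_places _ _ Q, where b = "\<lambda>Q. \<Prod>Q'\<in>common_places Q. ?r Q' ^ ?e' Q'"])
    show "0 < ?c Q ^ ?e Q \<and> ?c Q ^ ?e Q \<le> (\<Prod>Q'\<in>common_places Q. ?r Q' ^ ?e' Q')"
      if "Q \<in> places_above E P" for Q
      using index_above_ideal_pos[OF that] le_trans[OF power_mono[OF c_le[OF that]] residue_pow[OF that]]
      by simp
    show "(\<Prod>Q\<in>places_above E P. \<Prod>Q'\<in>common_places Q. ?r Q' ^ ?e' Q') \<le> (\<Prod>Q\<in>places_above E P. ?c Q ^ ?e Q)"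
      using prod_common_places_le power_length_le_prod by (rule le_trans)
  qed
  then have "prod ?r (common_places Q) ^ ?e Q \<le> ?c Q ^ ?e Q" using residue_pow[OF Q] by simp
  then have "prod ?r (common_places Q) \<le> ?c Q" using lower.ram_pos[OF Q] by (simp add: power_mono_iff)
  then show eq: "?c Q = prod ?r (common_places Q)" using c_le[OF Q] by simp
  show "?i Q' = ?r Q'" if Q': "Q' \<in> common_places Q"
  proof (rule prod_le_imp_eq[OF finite_common_places _ _ Q'])
    show "prod ?r (common_places Q) \<le> prod ?i (common_places Q)"
      using index_above_ideal_le_prod[OF Q] eq by simp
    show "0 < ?i Q' \<and> ?i Q' \<le> ?r Q'" if "Q' \<in> common_places Q" for Q'
      using index_composite_le(2,3)[OF Q that] by blast
  qed
qed

lemma sum_rel_deg_common: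
  assumes Q: "Q \<in> places_above E P"
  shows "(\<Sum>Q'\<in>common_places Q. rel_deg F' P' E' Q') = rel_deg F P E Q"
proof -
  have "residue_order E' Q' = residue_order F' P' ^ rel_deg F' P' E' Q'" if "Q' \<in> common_places Q" for Q'
    using upper.residue_order_above[OF common_placesD(2)[OF Q that]] .
  then have "residue_order F' P' ^ (\<Sum>Q'\<in>common_places Q. rel_deg F' P' E' Q') = residue_order F' P' ^ rel_deg F P E Q"
    using index_above_ideal_eq_prod(1)[OF Q] index_above_ideal_eq[OF Q] by (simp add: power_sum)
  then show ?thesis using residue_order_ge_2[OF upper.ff_base upper.place] by simp
qed

lemma frobenius_common_place:
  assumes Q: "Q \<in> places_above E P" and Q': "Q' \<in> common_places Q"
    and n: "deg_of F' P' dvd n" "deg_of E Q dvd n" and a: "a \<in> \<O> E' Q'"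
  shows "a [^] (card k ^ n) \<ominus> a \<in> Q'"
proof -
  let ?q = "card k ^ n"
  note common = common_placesD[OF Q Q']
  interpret Q': discrete_place R E' Q' by (rule common(4))
  obtain x where x: "x \<in> \<A>'" "a \<ominus> x \<in> Q'"
    using index_eq_imp_cover[OF Q'.place_subgroup Q'.ring_carrier Q'.finite_index_place common(5)]
      index_above_ideal_eq_prod(2)[OF Q Q'] a by (auto simp: residue_order_def)
  have R: "a \<in> carrier R" "x \<in> carrier R" using a x(1) Q'.ring_carrier composite_carrier by auto
  have "?q \<noteq> 0" using card_constants_ge_2 by simp
  then obtain r where r: "?q = Suc r" by (cases ?q) auto
  have "(a \<ominus> x) [^] r \<in> \<O> E' Q'"
    using subring_nat_pow_closed[OF Q'.subring] x(2) Q'.place_subset by blast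
  then have "(a \<ominus> x) [^] ?q \<in> Q'" unfolding r using Q'.place_mult x(2) by simp
  then have "a [^] ?q \<ominus> x [^] ?q \<in> Q'" unfolding frobenius_constants_minus[OF R] .
  moreover have "x [^] ?q \<ominus> x \<in> Q'" using frobenius_above_ideal[OF Q n x(1)] common(6) by blast
  ultimately have "(a [^] ?q \<ominus> x [^] ?q) \<oplus> (x [^] ?q \<ominus> x) \<ominus> (a \<ominus> x) \<in> Q'"
    using additive_subgroup.a_closed[OF Q'.place_subgroup] additive_subgroup_minus_closed[OF Q'.place_subgroup _ x(2)]
    by blast
  moreover have "(u \<ominus> v) \<oplus> (v \<ominus> x) \<ominus> (a \<ominus> x) = u \<ominus> a" if "u \<in> carrier R" "v \<in> carrier R" for u v
    using that R by algebra
  ultimately show ?thesis using R by simp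
qed

lemma deg_common_place:
  assumes Q: "Q \<in> places_above E P" and Q': "Q' \<in> common_places Q"
  shows "deg_of E' Q' = lcm (deg_of E Q) (deg_of F' P')"
proof -
  let ?n = "lcm (deg_of E Q) (deg_of F' P')"
  note common = common_placesD[OF Q Q']
  have "1 \<le> deg_of F' P'" "1 \<le> deg_of E Q"
    using deg_pos upper.ff_base upper.place lower.ff_ext places_aboveD(1)[OF Q] by blast+
  then have "1 \<le> ?n" using lcm_pos_nat[of "deg_of E Q" "deg_of F' P'"] by simp
  then have "deg_of E' Q' \<le> ?n"
    using frobenius_common_place[OF Q Q'] by (intro deg_le[OF upper.ff_ext common(3)]) auto
  moreover have "deg_of E Q dvd deg_of E' Q'"
    unfolding place_extension.deg_above[OF ext_place[OF Q] common(1)] by simp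
  moreover have "deg_of F' P' dvd deg_of E' Q'" unfolding upper.deg_above[OF common(2)] by simp
  ultimately have "deg_of E' Q' \<le> ?n" "?n dvd deg_of E' Q'" by (auto intro: lcm_least)
  moreover from this(2) have "?n \<le> deg_of E' Q'"
    using deg_pos[OF upper.ff_ext common(3)] by (intro dvd_imp_le) auto
  ultimately show ?thesis by simp
qed

theorem card_common_places:
  assumes Q: "Q \<in> places_above E P"
  shows "card (common_places Q) * lcm (deg_of E Q) (deg_of F' P') = rel_deg F P E Q * deg_of F' P'"
proof -
  have "rel_deg F P E Q * deg_of F' P' = (\<Sum>Q'\<in>common_places Q. rel_deg F' P' E' Q' * deg_of F' P')"
    unfolding sum_rel_deg_common[OF Q, symmetric] by (simp add: sum_distrib_right)
  also have "\<dots> = (\<Sum>Q'\<in>common_places Q. lcm (deg_of E Q) (deg_of F' P'))"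
    using upper.deg_above[OF common_placesD(2)[OF Q]] deg_common_place[OF Q]
    by (intro sum.cong) (auto simp: mult.commute)
  finally show ?thesis by simp
qed

end

section \<open>Existence of the limits\<close>

locale field_tower = constant_field R k for R (structure) and k +
  fixes T :: "nat \<Rightarrow> 'a set"
  assumes ff_tower: "ff (T n)" and tower_Suc: "T n \<subseteq> T (Suc n)"
    and finite_dimension_Suc: "finite_dimension (T n) (T (Suc n))"
begin

lemma tower_mono: "m \<le> n \<Longrightarrow> T m \<subseteq> T n"
  using lift_Suc_mono_le[of T] tower_Suc by blast

lemma tower_subfield: "subfield (T n) R"
  using ff_subfield[OF ff_tower] .

lemma finite_dimension_tower: "finite_dimension (T 0) (T n)"
proof (induction n)
  case 0
  then show ?case using finite_dimensionI[OF dimension_one[OF tower_subfield]] by blast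
next
  case (Suc n)
  then show ?case
    using telescopic_base_dim(1)[OF tower_subfield tower_subfield Suc finite_dimension_Suc] by blast
qed

lemma dimension_tower: "dimension (dim (T 0) (T n)) (T 0) (T n)"
  using finite_dimensionE[OF tower_subfield finite_dimension_tower] by (simp add: over_def)

lemma dim_tower_Suc: "dim (T 0) (T (Suc n)) = dim (T 0) (T n) * dim (T n) (T (Suc n))"
  using telescopic_base_dim(2)[OF tower_subfield tower_subfield finite_dimension_tower finite_dimension_Suc]
  by (simp add: over_def)

lemma dim_tower_pos: "0 < dim (T 0) (T n)"
proof (rule ccontr)
  assume "\<not> 0 < dim (T 0) (T n)"
  then have "dimension 0 (T 0) (T n)" using dimension_tower[of n] by simp
  then have "T n = {\<zero>}" using dimension_zero[OF tower_subfield] by blast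
  then show False using subringE(3)[OF subfieldE(1)[OF tower_subfield[of n]]] by auto
qed

end

locale field_tower_place = field_tower R k T for R (structure) and k T +
  fixes P
  assumes bottom_place: "P \<in> places_of (T 0)"
begin

lemma place_extension_tower: "place_extension R k (T 0) (T n) P"
  using ff_tower tower_mono[of 0 n] bottom_place by unfold_locales auto

lemma finite_places_above: "finite (places_above (T n) P)"
  using place_extension.fundamental_inequality(1)[OF place_extension_tower dimension_tower] .

abbreviation "num_places d n \<equiv> num_places_over R k (T n) d P"

definition points :: "nat \<Rightarrow> nat \<Rightarrow> nat"
  where "points r n = (\<Sum>Q | Q \<in> places_above (T n) P \<and> deg_of (T n) Q dvd r. deg_of (T n) Q)"

lemma sum_deg_eq_sum_num_places:
  assumes "finite D"
  shows "(\<Sum>Q | Q \<in> places_above (T n) P \<and> deg_of (T n) Q \<in> D. deg_of (T n) Q) = (\<Sum>d\<in>D. d * num_places d n)"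
proof -
  let ?S = "{Q \<in> places_above (T n) P. deg_of (T n) Q \<in> D}"
  have "(\<Sum>Q\<in>?S. deg_of (T n) Q) = (\<Sum>d\<in>D. \<Sum>Q | Q \<in> ?S \<and> deg_of (T n) Q = d. deg_of (T n) Q)"
    using finite_places_above[of n] assms by (intro sum.group[symmetric]) auto
  also have "\<dots> = (\<Sum>d\<in>D. d * num_places d n)"
  proof (rule sum.cong[OF refl])
    fix d assume "d \<in> D"
    then have "{Q. Q \<in> ?S \<and> deg_of (T n) Q = d} = {Q \<in> places_above (T n) P. deg_of (T n) Q = d}" by blast
    then show "(\<Sum>Q | Q \<in> ?S \<and> deg_of (T n) Q = d. deg_of (T n) Q) = d * num_places d n"
      unfolding num_places_over_def by simp
  qed
  finally show ?thesis .
qed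

lemma points_eq_sum:
  assumes "1 \<le> r"
  shows "points r n = (\<Sum>d | d dvd r. d * num_places d n)"
  using sum_deg_eq_sum_num_places[of "{d. d dvd r}" n] assms unfolding points_def by simp

lemma sum_deg_above_le:
  assumes P': "P' \<in> places_of (T n)"
  shows "finite (places_above (T (Suc n)) P')"
    and "(\<Sum>Q\<in>places_above (T (Suc n)) P'. deg_of (T (Suc n)) Q) \<le> dim (T n) (T (Suc n)) * deg_of (T n) P'"
proof -
  interpret step: place_extension R k "T n" "T (Suc n)" P'
    using ff_tower tower_Suc P' by unfold_locales
  let ?e = "ram (T n) P' (T (Suc n))" and ?f = "rel_deg (T n) P' (T (Suc n))"
  have "dimension (dim (T n) (T (Suc n))) (T n) (T (Suc n))"
    using finite_dimensionE[OF tower_subfield finite_dimension_Suc] by (simp add: over_def)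
  note inequality = step.fundamental_inequality[OF this]
  show "finite (places_above (T (Suc n)) P')" by (rule inequality(1))
  have "deg_of (T (Suc n)) Q \<le> deg_of (T n) P' * (?e Q * ?f Q)" if "Q \<in> places_above (T (Suc n)) P'" for Q
    using step.deg_above[OF that] step.ram_pos[OF that] by (simp add: Suc_le_eq)
  then have "(\<Sum>Q\<in>places_above (T (Suc n)) P'. deg_of (T (Suc n)) Q)
      \<le> (\<Sum>Q\<in>places_above (T (Suc n)) P'. deg_of (T n) P' * (?e Q * ?f Q))" by (rule sum_mono)
  also have "\<dots> \<le> dim (T n) (T (Suc n)) * deg_of (T n) P'"
    using inequality(2) by (simp add: sum_distrib_left[symmetric] mult.commute)
  finally show "(\<Sum>Q\<in>places_above (T (Suc n)) P'. deg_of (T (Suc n)) Q) \<le> dim (T n) (T (Suc n)) * deg_of (T n) P'" .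
qed

lemma points_Suc_le: "points r (Suc n) \<le> dim (T n) (T (Suc n)) * points r n"
proof -
  let ?X = "\<lambda>n. {Q \<in> places_above (T n) P. deg_of (T n) Q dvd r}"
  let ?deg = "deg_of (T (Suc n))"
  note finite = finite_places_above
  have restrict: "Q \<inter> T n \<in> places_above (T n) P" "Q \<in> places_above (T (Suc n)) (Q \<inter> T n)"
    if "Q \<in> places_above (T (Suc n)) P" for Q
    using place_extension.above_inter_intermediate[OF place_extension_tower ff_tower _ tower_Suc that]
      tower_mono[of 0 n] by auto
  have image: "(\<lambda>Q. Q \<inter> T n) ` ?X (Suc n) \<subseteq> ?X n"
  proof (rule image_subsetI)
    fix Q assume Q: "Q \<in> ?X (Suc n)"
    then have above: "Q \<inter> T n \<in> places_above (T n) P" "Q \<in> places_above (T (Suc n)) (Q \<inter> T n)"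
      using restrict by auto
    interpret step: place_extension R k "T n" "T (Suc n)" "Q \<inter> T n"
      using ff_tower tower_Suc places_aboveD(1)[OF above(1)] by unfold_locales
    have "deg_of (T n) (Q \<inter> T n) dvd ?deg Q" unfolding step.deg_above[OF above(2)] by simp
    then show "Q \<inter> T n \<in> ?X n" using above(1) Q dvd_trans by blast
  qed
  have "points r (Suc n) = (\<Sum>P'\<in>?X n. \<Sum>Q | Q \<in> ?X (Suc n) \<and> Q \<inter> T n = P'. ?deg Q)"
    unfolding points_def using finite by (intro sum.group[OF _ _ image, symmetric]) auto
  also have "\<dots> \<le> (\<Sum>P'\<in>?X n. dim (T n) (T (Suc n)) * deg_of (T n) P')"
  proof (rule sum_mono)
    fix P' assume "P' \<in> ?X n"
    then have P': "P' \<in> places_of (T n)" using places_aboveD(1) by blast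
    have "(\<Sum>Q | Q \<in> ?X (Suc n) \<and> Q \<inter> T n = P'. ?deg Q) \<le> (\<Sum>Q\<in>places_above (T (Suc n)) P'. ?deg Q)"
      using restrict(2) by (intro sum_mono2[OF sum_deg_above_le(1)[OF P']]) auto
    then show "(\<Sum>Q | Q \<in> ?X (Suc n) \<and> Q \<inter> T n = P'. ?deg Q) \<le> dim (T n) (T (Suc n)) * deg_of (T n) P'"
      using sum_deg_above_le(2)[OF P'] by (rule le_trans)
  qed
  also have "\<dots> = dim (T n) (T (Suc n)) * points r n" unfolding points_def by (simp add: sum_distrib_left)
  finally show ?thesis .
qed

lemma points_convergent: "convergent (\<lambda>n. real (points r n) / real (dim (T 0) (T n)))"
proof -
  have "decseq (\<lambda>n. real (points r n) / real (dim (T 0) (T n)))"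
  proof (rule decseq_SucI)
    fix n
    have "points r (Suc n) * dim (T 0) (T n) \<le> points r n * dim (T 0) (T (Suc n))"
      using mult_right_mono[OF points_Suc_le[of r n], of "dim (T 0) (T n)"] dim_tower_Suc[of n]
      by (simp add: mult_ac)
    then have "real (points r (Suc n)) * real (dim (T 0) (T n)) \<le> real (points r n) * real (dim (T 0) (T (Suc n)))"
      by (metis of_nat_le_iff of_nat_mult)
    then show "real (points r (Suc n)) / real (dim (T 0) (T (Suc n))) \<le> real (points r n) / real (dim (T 0) (T n))"
      using dim_tower_pos by (simp add: divide_simps mult.commute)
  qed
  then obtain l where "(\<lambda>n. real (points r n) / real (dim (T 0) (T n))) \<longlonglongrightarrow> l"
    by (rule decseq_convergent[of _ 0]) simp
  then show ?thesis by (rule convergentI)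
qed

lemma num_places_convergent:
  assumes "1 \<le> r"
  shows "convergent (\<lambda>n. real (num_places r n) / real (dim (T 0) (T n)))"
  using assms
proof (induction r rule: less_induct)
  case (less r)
  let ?b = "\<lambda>d n. real (num_places d n) / real (dim (T 0) (T n))" and ?D = "{d. d dvd r} - {r}"
  have "convergent (\<lambda>n. \<Sum>d\<in>?D. real d * ?b d n)"
  proof (rule convergent_sum)
    fix d assume "d \<in> ?D"
    then have "d < r" "1 \<le> d" using less(2) dvd_imp_le[of d r] dvd_pos_nat[of r d] by auto
    then have "convergent (?b d)" by (rule less(1))
    then show "convergent (\<lambda>n. real d * ?b d n)" by (intro convergent_mult convergent_const)
  qed
  then have "convergent (\<lambda>n. real (points r n) / real (dim (T 0) (T n)) - (\<Sum>d\<in>?D. real d * ?b d n))"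
    by (intro convergent_diff points_convergent)
  moreover have "real (points r n) / real (dim (T 0) (T n)) - (\<Sum>d\<in>?D. real d * ?b d n) = real r * ?b r n" for n
  proof -
    have "real (points r n) = (\<Sum>d | d dvd r. real d * real (num_places d n))"
      using points_eq_sum[OF less(2), of n] by simp
    also have "\<dots> = real r * real (num_places r n) + (\<Sum>d\<in>?D. real d * real (num_places d n))"
      using less(2) by (subst sum.remove[of _ r]) auto
    finally show ?thesis by (simp add: add_divide_distrib sum_divide_distrib)
  qed
  ultimately have scaled: "convergent (\<lambda>n. real r * ?b r n)" by (simp only:)
  have "real r \<noteq> 0" using less(2) by simp
  then show ?case using scaled convergent_mult_const_iff[of "real r" "?b r"] by blast
qed

theorem num_places_tendsto_nu:
  assumes "1 \<le> r"
  shows "(\<lambda>n. real (num_places r n) / real (dim (T 0) (T n))) \<longlonglongrightarrow> nu R k r P T"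
  using num_places_convergent[OF assms] unfolding nu_def by (simp add: convergent_LIMSEQ_iff)

end

section \<open>The composite tower\<close>

context field
begin

lemma subfield_Span:
  assumes K: "subfield K R" "K \<subseteq> Span K Us" and Us: "set Us \<subseteq> carrier R" and subring: "subring (Span K Us) R"
  shows "subfield (Span K Us) R"
proof (rule subfieldI'[OF subring])
  note finite = Span_finite_dimension[OF K(1) Us]
  fix x assume x: "x \<in> Span K Us - {\<zero>}"
  then have xR: "x \<in> carrier R" using subringE(1)[OF subring] by blast
  have "(algebraic over K) x" using finite_dimension_imp_algebraic[OF K(1) subring finite] x by blast
  then have "subfield (simple_extension K x) R" using simple_extension_is_subfield[OF K(1) xR] by simp
  then have "inv x \<in> simple_extension K x"
    using subfield_inv(1) simple_extension_mem[OF subfieldE(1)[OF K(1)] xR] x by blast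
  then show "inv x \<in> Span K Us" using simple_extension_subring_incl[OF subring K(2)] x by blast
qed

lemma composite_field_eq_Span:
  assumes F: "subfield F R" and E: "subfield E R" and K: "subfield K R" and sub: "F \<subseteq> E" "F \<subseteq> K"
    and Us: "set Us \<subseteq> carrier R" "Span F Us = E"
  shows "composite_field R E K = Span K Us"
proof
  note Kr = subfieldE(1)[OF K] and Er = subfieldE(1)[OF E] and KR = subfieldE(3)[OF K]
  have EK: "E \<union> K \<subseteq> carrier R" using KR subfieldE(3)[OF E] by blast
  have E_Span: "E \<subseteq> Span K Us" using Span_mono[OF sub(2)] Us(2) by blast
  have UsE: "set Us \<subseteq> E" using mem_Span[OF subfieldE(1)[OF F] Us(1)] Us(2) by blast
  have ring: "subring (Span K Us) R"
    using subringE(3,6)[OF Er] E_Span UsE by (intro subring_Span[OF Kr Us(1)]) auto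
  have K_Span: "K \<subseteq> Span K Us"
  proof
    fix a assume a: "a \<in> K"
    have "a \<otimes> \<one> \<in> Span K Us"
      using Span_mult[OF KR _ subringE(6)[OF Kr a] Us(1) subringE(3)[OF ring]] a KR by blast
    then show "a \<in> Span K Us" using a KR by auto
  qed
  show "composite_field R E K \<subseteq> Span K Us"
    unfolding composite_field_def
    using generate_field_min_subfield1[OF EK subfield_Span[OF K K_Span Us(1) ring]] E_Span K_Span
    by blast
  have G: "subring (composite_field R E K) R"
    unfolding composite_field_def using subfieldE(1)[OF generate_field_is_subfield[OF EK]] .
  have "E \<union> K \<subseteq> composite_field R E K" unfolding composite_field_def by (auto intro: generate_field.incl)
  then show "Span K Us \<subseteq> composite_field R E K"
    using UsE subringE(6)[OF G] by (intro Span_subset[OF subring_additive_subgroup[OF G]]) blast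
qed

end

locale composite_tower = constant_field R k +
  base: field_tower_place R k F P + composite: field_tower R k "composite_sequence R E F"
  for R (structure) and k F P E +
  fixes Us
  assumes ext_subfield: "subfield E R" and base_subset: "F 0 \<subseteq> E"
    and basis: "integral_basis_at R (F 0) P E Us" and dim_ext: "dimension (length Us) (F 0) E"
    and disjoint: "1 \<le> n \<Longrightarrow> linearly_disjoint R (F 0) E (F n)"
    and coprime_ram: "Q \<in> places_above E P \<Longrightarrow> 1 \<le> n \<Longrightarrow> P' \<in> places_above (F n) P \<Longrightarrow>
      coprime (ram (F 0) P E Q) (ram (F 0) P (F n) P')"
begin

abbreviation "C \<equiv> composite_sequence R E F"

lemma subset_composite: "E \<subseteq> C n" "F n \<subseteq> C n"
  unfolding composite_sequence_def composite_field_def by (auto intro: generate_field.incl)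

lemma composite_zero: "C 0 = E"
proof
  have "E \<union> F 0 \<subseteq> carrier R" using subfieldE(3)[OF ext_subfield] base_subset by auto
  then show "C 0 \<subseteq> E"
    unfolding composite_sequence_def composite_field_def
    using generate_field_min_subfield1[OF _ ext_subfield] base_subset by blast
qed (rule subset_composite(1))

lemma ff_E: "ff E"
  using composite.ff_tower[of 0] composite_zero by simp

lemma basis_facts:
  "set Us \<subseteq> carrier R" "Span (\<O> (F 0) P) Us = integral_closure_in R (\<O> (F 0) P) E"
  "set as \<subseteq> \<O> (F 0) P \<Longrightarrow> length as = length Us \<Longrightarrow> combine as Us = \<zero> \<Longrightarrow> set as \<subseteq> {\<zero>}"
  using basis unfolding integral_basis_at_def module_basis_def by auto

lemma bottom_discrete_place: "discrete_place R (F 0) P"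
  using ff_discrete_place[OF base.ff_tower base.bottom_place] .

lemma basis_in_ext: "set Us \<subseteq> E"
proof -
  interpret P: discrete_place R "F 0" P by (rule bottom_discrete_place)
  show ?thesis
    using mem_Span[OF P.subring basis_facts(1)] basis_facts(2) unfolding integral_closure_in_def by blast
qed

lemma basis_independent:
  shows "independent (F 0) Us" and "1 \<le> n \<Longrightarrow> independent (F n) Us"
proof -
  interpret P: discrete_place R "F 0" P by (rule bottom_discrete_place)
  have "P.independent_mod {\<zero>} Us"
    using basis_facts(3) P.zero_nonunit unfolding P.independent_mod_def by blast
  then show independent: "independent (F 0) Us"
    using P.independent_mod_imp_independent[OF basis_facts(1)] by blast
  show "1 \<le> n \<Longrightarrow> independent (F n) Us"
    using disjoint basis_in_ext independent unfolding linearly_disjoint_def by blast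
qed

lemma Span_basis: "Span (F 0) Us = E"
  using independent_length_eq_dimension[OF base.tower_subfield dim_ext basis_independent(1) basis_in_ext]
  by simp

lemma dimension_composite:
  assumes "1 \<le> n"
  shows "dimension (length Us) (F n) (C n)"
proof -
  have "C n = Span (F n) Us"
    unfolding composite_sequence_def
    using composite_field_eq_Span[OF base.tower_subfield ext_subfield base.tower_subfield base_subset
        base.tower_mono[of 0 n] basis_facts(1) Span_basis] by simp
  then show ?thesis using dimensionI[OF base.tower_subfield basis_independent(2)[OF assms]] by simp
qed

lemma dim_composite:
  assumes n: "1 \<le> n"
  shows "dim (C 0) (C n) = dim (F 0) (F n)"
proof -
  have finite: "finite_dimension (F 0) E" "finite_dimension (F n) (C n)" "finite_dimension E (C n)"
    using finite_dimensionI[OF dim_ext] finite_dimensionI[OF dimension_composite[OF n]]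
      composite.finite_dimension_tower[of n] composite_zero by auto
  have dims: "dim (F 0) E = length Us" "dim (F n) (C n) = length Us"
    using dimI[OF base.tower_subfield dim_ext] dimI[OF base.tower_subfield dimension_composite[OF n]]
    by (simp_all add: over_def)
  have "dim (F 0) (C n) = dim (F 0) (F n) * length Us"
    using telescopic_base_dim(2)[OF base.tower_subfield base.tower_subfield base.finite_dimension_tower finite(2)]
      dims(2) by (simp add: over_def)
  moreover have "dim (F 0) (C n) = length Us * dim E (C n)"
    using telescopic_base_dim(2)[OF base.tower_subfield ext_subfield finite(1,3)] dims(1)
    by (simp add: over_def)
  moreover have "length Us \<noteq> 0"
  proof
    assume "length Us = 0"
    then have "E = {\<zero>}" using dim_ext dimension_zero[OF base.tower_subfield] by simp
    then show False using subringE(3)[OF subfieldE(1)[OF ext_subfield]] by auto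
  qed
  ultimately show ?thesis using composite_zero by simp
qed

lemma place_composite_level:
  assumes n: "1 \<le> n" and P': "P' \<in> places_above (F n) P"
  shows "place_composite R k (F 0) E P (F n) (C n) P' Us"
proof unfold_locales
  show "ff (F 0)" "ff E" "ff (F n)" "ff (C n)" by (rule base.ff_tower ff_E composite.ff_tower)+
  show "F 0 \<subseteq> E" "F 0 \<subseteq> F n" "E \<subseteq> C n" "F n \<subseteq> C n"
    using base_subset base.tower_mono[of 0 n] subset_composite by auto
  show "P \<in> places_of (F 0)" "P' \<in> places_of (F n)" "P \<subseteq> P'"
    using base.bottom_place places_aboveD[OF P'] by auto
  show "dimension (length Us) (F 0) E" "dimension (length Us) (F n) (C n)" "independent (F n) Us"
    by (rule dim_ext dimension_composite[OF n] basis_independent(2)[OF n])+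
  show "set Us \<subseteq> carrier R" "Span (\<O> (F 0) P) Us = integral_closure_in R (\<O> (F 0) P) E"
    by (rule basis_facts)+
  show "coprime (ram (F 0) P E Q) (ram (F 0) P (F n) P')" if "Q \<in> places_above E P" for Q
    by (rule coprime_ram[OF that n P'])
qed

lemma card_places_with_restriction:
  assumes Q: "Q \<in> places_above E P" and n: "1 \<le> n" and P': "P' \<in> places_above (F n) P"
  shows "s * card {Q' \<in> places_above (C n) Q. deg_of (C n) Q' = s \<and> Q' \<inter> F n = P'} =
    (if lcm (deg_of E Q) (deg_of (F n) P') = s then rel_deg (F 0) P E Q * deg_of (F n) P' else 0)"
proof -
  interpret level: place_composite R k "F 0" E P "F n" "C n" P' Us by (rule place_composite_level[OF n P'])
  have "{Q' \<in> places_above (C n) Q. Q' \<inter> F n = P'} = level.common_places Q"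
    using level.upper.above_inter(1) unfolding level.common_places_def by (auto simp: places_over_def)
  then have "{Q' \<in> places_above (C n) Q. deg_of (C n) Q' = s \<and> Q' \<inter> F n = P'} =
      {Q' \<in> level.common_places Q. deg_of (C n) Q' = s}" by blast
  also have "\<dots> = (if lcm (deg_of E Q) (deg_of (F n) P') = s then level.common_places Q else {})"
    using level.deg_common_place[OF Q] by auto
  finally show ?thesis using level.card_common_places[OF Q] by (auto simp: mult.commute)
qed

lemma restrict_above:
  assumes Q: "Q \<in> places_above E P" and Q': "Q' \<in> places_above (C n) Q"
  shows "Q' \<inter> F n \<in> places_above (F n) P"
proof -
  have "F 0 \<subseteq> C n" using base_subset subset_composite(1) by (rule subset_trans)
  then interpret place_extension R k "F 0" "C n" P
    by unfold_locales (rule base.ff_tower composite.ff_tower base.bottom_place | assumption)+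
  have "Q' \<in> places_above (C n) P" using Q' places_aboveD(2)[OF Q] by (auto simp: places_over_def)
  then show ?thesis
    by (rule above_inter_intermediate(1)[OF base.ff_tower base.tower_mono[OF le0] subset_composite(2)])
qed

lemma num_places_composite:
  assumes Q: "Q \<in> places_above E P" and s: "1 \<le> s" and n: "1 \<le> n"
  shows "s * num_places_over R k (C n) s Q =
    rel_deg (F 0) P E Q * (\<Sum>d | lcm (deg_of E Q) d = s. d * num_places_over R k (F n) d P)"
proof -
  let ?S = "places_above (F n) P" and ?X = "{Q' \<in> places_above (C n) Q. deg_of (C n) Q' = s}"
  let ?D = "{d. lcm (deg_of E Q) d = s}" and ?f = "rel_deg (F 0) P E Q"
  interpret Q: field_tower_place R k C Q
    using composite_zero places_aboveD(1)[OF Q] by unfold_locales simp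
  note finite_S = base.finite_places_above[of n]
  have finite_X: "finite ?X" using Q.finite_places_above[of n] by simp
  have "?D \<subseteq> {d. d dvd s}" by auto
  moreover have "finite {d. d dvd s}" using s by simp
  ultimately have finite_D: "finite ?D" by (rule finite_subset)

  have "s * card ?X = (\<Sum>P'\<in>?S. s * card {Q' \<in> ?X. Q' \<inter> F n = P'})"
  proof -
    have "(\<Sum>P'\<in>?S. \<Sum>Q' | Q' \<in> ?X \<and> Q' \<inter> F n = P'. (1::nat)) = (\<Sum>Q'\<in>?X. 1)"
      using restrict_above[OF Q] by (intro sum.group[OF finite_X finite_S]) auto
    then show ?thesis by (simp add: sum_distrib_left[symmetric])
  qed
  also have "\<dots> = (\<Sum>P'\<in>?S. if deg_of (F n) P' \<in> ?D then ?f * deg_of (F n) P' else 0)"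
    using card_places_with_restriction[OF Q n, of _ s] by (intro sum.cong[OF refl]) simp
  also have "\<dots> = (\<Sum>P' | P' \<in> ?S \<and> deg_of (F n) P' \<in> ?D. ?f * deg_of (F n) P')"
    by (rule sum.inter_filter[OF finite_S, symmetric])
  also have "\<dots> = ?f * (\<Sum>d\<in>?D. d * num_places_over R k (F n) d P)"
    using base.sum_deg_eq_sum_num_places[OF finite_D, of n] by (simp only: sum_distrib_left[symmetric])
  finally show ?thesis unfolding num_places_over_def .
qed

theorem nu_composite:
  assumes Q: "Q \<in> places_above E P" and s: "1 \<le> s"
  shows "nu R k s Q C =
    real (rel_deg (F 0) P E Q) / real s * (\<Sum>d | lcm (deg_of E Q) d = s. real d * nu R k d P F)"
proof -
  let ?D = "{d. lcm (deg_of E Q) d = s}" and ?f = "rel_deg (F 0) P E Q"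
  let ?b = "\<lambda>d n. real (num_places_over R k (F n) d P) / real (dim (F 0) (F n))"
  have "?b d \<longlonglongrightarrow> nu R k d P F" if d: "d \<in> ?D" for d
    using base.num_places_tendsto_nu[of d] d s by (cases d) auto
  then have "(\<lambda>n. real ?f / real s * (\<Sum>d\<in>?D. real d * ?b d n))
      \<longlonglongrightarrow> real ?f / real s * (\<Sum>d\<in>?D. real d * nu R k d P F)"
    by (intro tendsto_mult tendsto_const tendsto_sum)
  moreover have "\<forall>\<^sub>F n in sequentially. real ?f / real s * (\<Sum>d\<in>?D. real d * ?b d n) =
      real (num_places_over R k (C n) s Q) / real (dim (C 0) (C n))"
  proof (rule eventually_sequentiallyI[of 1])
    fix n :: nat assume n: "1 \<le> n"
    have "real s * real (num_places_over R k (C n) s Q) =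
        real ?f * (\<Sum>d\<in>?D. real d * real (num_places_over R k (F n) d P))"
      using arg_cong[OF num_places_composite[OF Q s n], of real] by simp
    then have count: "real (num_places_over R k (C n) s Q) =
        real ?f / real s * (\<Sum>d\<in>?D. real d * real (num_places_over R k (F n) d P))"
      using s by (simp add: field_simps)
    show "real ?f / real s * (\<Sum>d\<in>?D. real d * ?b d n) =
        real (num_places_over R k (C n) s Q) / real (dim (C 0) (C n))"
      unfolding dim_composite[OF n] count by (simp add: sum_divide_distrib[symmetric])
  qed
  ultimately have "(\<lambda>n. real (num_places_over R k (C n) s Q) / real (dim (C 0) (C n)))
      \<longlonglongrightarrow> real ?f / real s * (\<Sum>d\<in>?D. real d * nu R k d P F)"
    by (rule Lim_transform_eventually)
  then show ?thesis unfolding nu_def by (rule limI)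
qed

end

lemma (in field) tower_imp_field_tower:
  assumes "tower R k T" "finite k"
  shows "field_tower R k T"
proof -
  have T: "function_field R k (T n)" "T n \<subset> T (Suc n)" "finite_separable_extension R (T n) (T (Suc n))" for n
    using assms(1) unfolding tower_def by auto
  show ?thesis
  proof (intro field_tower.intro constant_field.intro constant_field_axioms.intro field_tower_axioms.intro)
    show "field R" by (rule field_axioms)
    show "subfield k R" using T(1) by (simp add: function_field_def)
    show "finite k" by fact
    show "function_field R k (T n)" "T n \<subseteq> T (Suc n)" for n using T by blast+
    show "finite_dimension (T n) (T (Suc n))" for n using T(3) by (simp add: finite_separable_extension_def)
  qed
qed

theorem theorem3p11:
  fixes L :: "('a, 'b) ring_scheme"
    and k E P :: "'a set"
    and F :: "nat \<Rightarrow> 'a set"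
    and M :: "'a set set"
    and y :: 'a
    and q m :: nat
  assumes "algebraic_closure L (F 0)"
    and "finite k" and "card k = q"
    and "tower L k F"
    and "finite_separable_extension L (F 0) E"
    and "is_composite_tower L k E F"
    and "y \<in> E" and "E = generate_field L (insert y (F 0))"
    and "m = ring.dim L (F 0) E"
    and "M = {P \<in> places L k (F 0).
               integral_basis_at L (F 0) P E (map (\<lambda>i. y [^]\<^bsub>L\<^esub> i) [0..<m])}"
    and "P \<in> M"
    and "\<forall>Q\<in>places_over L k E P. \<forall>n\<ge>1. \<forall>P'\<in>places_over L k (F n) P.
           coprime (ramification_index L (F 0) P E Q) (ramification_index L (F 0) P (F n) P')"
  shows "\<forall>Q\<in>places_over L k E P. \<forall>s\<ge>1.
           nu L k s Q (composite_sequence L E F) =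
             real (relative_degree L (F 0) P E Q) / real s *
               (\<Sum>d | lcm (place_degree L k E Q) d = s. real d * nu L k d P F)"
proof -
  let ?Us = "map (\<lambda>i. y [^]\<^bsub>L\<^esub> i) [0..<m]"
  interpret L: field L using assms(1) by (simp add: algebraic_closure_def)
  have E: "subfield E L" "F 0 \<subseteq> E" "L.finite_dimension (F 0) E"
    using assms(5) by (auto simp: finite_separable_extension_def)
  have P: "P \<in> places L k (F 0)" "integral_basis_at L (F 0) P E ?Us" using assms(10,11) by auto
  have composite: "tower L k (composite_sequence L E F)" "\<And>n. 1 \<le> n \<Longrightarrow> linearly_disjoint L (F 0) E (F n)"
    using assms(6) by (auto simp: is_composite_tower_def)
  interpret F: field_tower L k F by (rule L.tower_imp_field_tower[OF assms(4,2)])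
  interpret base: field_tower_place L k F P using P(1) by unfold_locales
  interpret EF: field_tower L k "composite_sequence L E F"
    by (rule L.tower_imp_field_tower[OF composite(1) assms(2)])
  have "L.dimension (length ?Us) (F 0) E"
    using L.finite_dimensionE[OF F.tower_subfield E(3)] assms(9) by (simp add: over_def)
  then interpret composite_tower L k F P E ?Us
    using E(1,2) P(2) composite(2) assms(12)
    by (intro composite_tower.intro composite_tower_axioms.intro F.constant_field_axioms
        base.field_tower_place_axioms EF.field_tower_axioms) auto
  show ?thesis using nu_composite by blast
qed

end
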